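(* There exists a constant $C>0$, depending only on $n$ and $s$, such that for every $\mu\in(0,1)$ and every minimizer $F_*\in\mathcal K$ of $P_S$ in $\mathcal K$ with volume constraint $|F_*|=\mu$ (i.e. $P_S(F_* )\le P_S(F)$ for all $F\in\mathcal K$ with $|F|=\mu$), one has $$\mathrm{Def}(F_* )\le C\,\mu^{\frac{n^2-s^2}{2n^2(n-1)}}.$$
   Context: Fix $n\ge 2$ and $s\in(0,1)$. Write $x=(x_1,x')\in\mathbb R\times\mathbb R^{n-1}$, $e_1=(1,0,\dots,0)$, and let $S:=[-1/2,1/2]\times\mathbb R^{n-1}$. Define the kernel $K(x):=\sum_{k\in\mathbb Z}|x+ke_1|^{-n-s}$ (with values in $(0,+\infty]$), and for a measurable $E\subseteq\mathbb R^n$ set $P_S(E):=\int_{E\cap S}\int_{S\setminus E}K(x-y)\,dx\,dy$. The class $\mathcal K$ consists of all sets $F=\{(x_1,x')\in S: |x'|\le f(x_1)\}$ where $f:[-1/2,1/2]\to[0,+\infty]$ is even and non-increasing on $[0,1/2]$. $|\cdot|$ denotes Lebesgue measure. The Fraenkel asymmetry of a set $E$ with $0<|E|<\infty$ is $\mathrm{Def}(E):=\inf\{|E\Delta B|/|E|\}$, the infimum being over all balls $B\subset\mathbb R^n$ with $|B|=|E|$, where $\Delta$ is the symmetric difference. *)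

theory Defs
  imports "HOL-Analysis.Analysis"
begin

text \<open>Points of R^n are written x = (x1, x') with x1 real and x' in R^(n-1),
  i.e. we work in the product type real \<times> 'b; the dimension is n = DIM(real \<times> 'b).
  The norm on the product type is the Euclidean one.\<close>

definition strip :: "(real \<times> 'b::euclidean_space) set" where
  "strip = {-1/2..1/2} \<times> UNIV"

definition per_kernel :: "real \<Rightarrow> real \<times> 'b::euclidean_space \<Rightarrow> ennreal" where
  "per_kernel s x =
     (\<integral>\<^sup>+ k. (let d = norm (x + (real_of_int k, 0)) in
                 if d = 0 then \<infinity> else ennreal (d powr (- (real DIM(real \<times> 'b) + s))))
        \<partial>count_space (UNIV :: int set))"

definition per_P :: "real \<Rightarrow> (real \<times> 'b::euclidean_space) set \<Rightarrow> ennreal" where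
  "per_P s E =
     (\<integral>\<^sup>+ y \<in> E \<inter> strip. (\<integral>\<^sup>+ x \<in> strip - E. per_kernel s (x - y) \<partial>lebesgue) \<partial>lebesgue)"

definition classK :: "(real \<times> 'b::euclidean_space) set set" where
  "classK = {F. \<exists>f :: real \<Rightarrow> ennreal.
      (\<forall>t\<in>{-1/2..1/2}. f (- t) = f t) \<and>
      (\<forall>a b. 0 \<le> a \<and> a \<le> b \<and> b \<le> 1/2 \<longrightarrow> f b \<le> f a) \<and>
      F = {p \<in> strip. ennreal (norm (snd p)) \<le> f (fst p)}}"

definition fraenkel_asym :: "'a::euclidean_space set \<Rightarrow> real" where
  "fraenkel_asym E =
     (INF B \<in> {ball c r | c r. measure lebesgue (ball c r) = measure lebesgue E}.
        measure lebesgue ((E - B) \<union> (B - E)) / measure lebesgue E)"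

end

theory Submission
  imports Defs
begin

text \<open>
Write \<open>P\<close> for the fractional perimeter of \<open>\<real>\<^sup>n\<close>. Unfolding the periodic kernel gives \<open>P(F) \<le> P_S(F) + I(F)\<close>, where \<open>I(F)\<close>
is the interaction of \<open>F\<close> with its translates by nonzero multiples of \<open>e_1\<close>, and \<open>P_S(B) \<le> P(B)\<close> for the ball \<open>B\<close> of
volume \<open>\<mu>\<close>. A minimizer \<open>F\<close> therefore has isoperimetric deficit at most \<open>I(F)\<close>.

For sets in the class \<open>\<K>\<close> the deficit controls the square of the asymmetry. Polarizing such a set in a hyperplane through
the origin gains an explicit double integral, in which the two mismatched parts contribute equally because the set is
invariant under \<open>x \<mapsto> - x\<close>. Averaging over the hyperplanes, and using that the set is star-shaped, bounds its distance to a
centred ball inside a fixed large ball; the mass further out is thin, hence expensive, and is cut off. The isoperimetric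
inequality itself also follows from polarization: among all sets reachable with no larger perimeter, the distance to
the ball has infimum zero.

The mass of \<open>F\<close> outside \<open>B\<close> bounds the radius \<open>\<rho>\<close> of \<open>F\<close> at \<open>x_1 = 1/4\<close>, and \<open>I(F)\<close> is at most a constant times
\<open>\<mu>\<^sup>2 + \<rho> powr (n - (1 + s)/2)\<close>. Inserting this into the stability estimate gives an inequality for the asymmetry alone, which yields
the exponent.
\<close>

section \<open>Measure-preserving involutions and polarization\<close>

text \<open>The polarization identity cancels self-interactions, so it needs an integrable kernel,
  while the kernel of the theorem is not integrable at the origin. Gains are therefore computed for
  the kernels (|z|^2 + eps) powr -((n + s) / 2), with constants that do not depend on eps, and only
  then is eps sent to 0.

  The estimate is quadratic because reflecting one of two points on the same side of a hyperplane
  raises their squared distance by four times the product of their distances to the hyperplane. The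
  gain of a polarization is thus bounded below by a product of two integrals.

  The final inequality is a bootstrap. Let l be the radius of the ball of volume mu and x the mass
  of the rescaled set outside the unit ball. The neck radius is itself bounded in terms of x, which
  leads to x^2 <= K (l^(n+s) + l^(nq-n+s) x^q) with q < 2, so the power of x on the right can be
  absorbed. The powers of l that come out are at least as good as the required one.\<close>

lemma nn_integral_lborel_translate:
  fixes f :: "'a::euclidean_space \<Rightarrow> ennreal"
  assumes [measurable]: "f \<in> borel_measurable borel"
  shows "(\<integral>\<^sup>+x. f (x + a) \<partial>lborel) = (\<integral>\<^sup>+x. f x \<partial>lborel)"
proof -
  have "(\<integral>\<^sup>+x. f x \<partial>lborel) = (\<integral>\<^sup>+x. f x \<partial>distr lborel borel ((+) a))"
    by (simp add: lborel_distr_plus)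
  also have "\<dots> = (\<integral>\<^sup>+x. f (x + a) \<partial>lborel)"
    by (subst nn_integral_distr) (auto simp: add.commute)
  finally show ?thesis by simp
qed

lemma nn_integral_lborel_scaleR:
  fixes f :: "'a::euclidean_space \<Rightarrow> ennreal"
  assumes [measurable]: "f \<in> borel_measurable borel" and c: "c \<noteq> 0"
  shows "(\<integral>\<^sup>+x. f x \<partial>lborel) = ennreal (\<bar>c\<bar> ^ DIM('a)) * (\<integral>\<^sup>+x. f (c *\<^sub>R x) \<partial>lborel)"
  by (subst lborel_affine[OF c, of 0])
     (simp add: nn_integral_density nn_integral_distr nn_integral_cmult)

lemma nn_integral_lborel_swap:
  fixes f :: "'a::euclidean_space \<Rightarrow> 'b::euclidean_space \<Rightarrow> ennreal"
  assumes [measurable]: "(\<lambda>(x, y). f x y) \<in> borel_measurable (borel \<Otimes>\<^sub>M borel)"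
  shows "(\<integral>\<^sup>+x. (\<integral>\<^sup>+y. f x y \<partial>lborel) \<partial>lborel) = (\<integral>\<^sup>+y. (\<integral>\<^sup>+x. f x y \<partial>lborel) \<partial>lborel)"
  by (rule lborel_pair.Fubini') (simp add: borel_prod)

text \<open>An argument without determinants: for the unit ball \<open>B\<close>, the product of the
  measures of \<open>A\<close> and \<open>B\<close> is a convolution integral. Since
  \<open>T\<close> preserves norms and is its own inverse, translation and Fubini move
  \<open>T\<close> from the shift onto the argument of \<open>indicator A\<close>. Finally
  \<open>B\<close> cancels, its measure being positive and finite.\<close>

lemma distr_lborel_linear_involution:
  fixes T :: "'a::euclidean_space \<Rightarrow> 'a"
  assumes lin: "linear T" and nrm: "\<And>x. norm (T x) = norm x" and inv: "\<And>x. T (T x) = x"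
  shows "distr lborel borel T = lborel"
proof (rule measure_eqI)
  have T_meas[measurable]: "T \<in> borel_measurable borel"
    by (rule borel_measurable_continuous_onI) (use lin in \<open>simp add: linear_continuous_on linear_conv_bounded_linear\<close>)
  show "sets (distr lborel borel T) = sets lborel" by simp
  fix A assume "A \<in> sets (distr lborel borel T)"
  then have A[measurable]: "A \<in> sets borel" by simp
  define B where "B = ball (0::'a) 1"
  have B[measurable]: "B \<in> sets borel" by (simp add: B_def)
  have pos: "emeasure lborel B \<noteq> 0" and fin: "emeasure lborel B \<noteq> \<infinity>"
    using emeasure_lborel_ball_finite[of "0::'a" 1] content_ball_gt_0_iff[of "0::'a" 1]
    by (auto simp: B_def measure_def)
  have "emeasure lborel A * emeasure lborel B
      = (\<integral>\<^sup>+y. (\<integral>\<^sup>+x. indicator A x \<partial>lborel) * indicator B y \<partial>lborel)"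
    by (simp add: nn_integral_cmult)
  also have "\<dots> = (\<integral>\<^sup>+y. (\<integral>\<^sup>+x. indicator A (x + T y) \<partial>lborel) * indicator B y \<partial>lborel)"
    by (subst nn_integral_lborel_translate) auto
  also have "\<dots> = (\<integral>\<^sup>+y. (\<integral>\<^sup>+x. indicator A (x + T y) * indicator B y \<partial>lborel) \<partial>lborel)"
    by (simp add: nn_integral_multc)
  also have "\<dots> = (\<integral>\<^sup>+x. (\<integral>\<^sup>+y. indicator A (x + T y) * indicator B y \<partial>lborel) \<partial>lborel)"
    by (rule nn_integral_lborel_swap) measurable
  \<comment> \<open>Replacing \<open>y\<close> by \<open>y - T x\<close> turns
    \<open>x + T y\<close> into \<open>T y\<close>, because \<open>T (T x) = x\<close>.\<close>
  also have "\<dots> = (\<integral>\<^sup>+x. (\<integral>\<^sup>+y. indicator A (T y) * indicator B (y - T x) \<partial>lborel) \<partial>lborel)"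
  proof (rule nn_integral_cong)
    fix x
    show "(\<integral>\<^sup>+y. indicator A (x + T y) * indicator B y \<partial>lborel)
        = (\<integral>\<^sup>+y. indicator A (T y) * indicator B (y - T x) \<partial>lborel)"
      using nn_integral_lborel_translate[of "\<lambda>y. indicator A (T y) * indicator B (y - T x)" "T x"]
      by (simp add: linear_add[OF lin] inv add.commute)
  qed
  also have "\<dots> = (\<integral>\<^sup>+y. (\<integral>\<^sup>+x. indicator A (T y) * indicator B (y - T x) \<partial>lborel) \<partial>lborel)"
    by (rule nn_integral_lborel_swap) measurable
  also have "\<dots> = (\<integral>\<^sup>+y. indicator A (T y) * emeasure lborel B \<partial>lborel)"
  proof (rule nn_integral_cong)
    fix y
    have "norm (y - T x) = norm (x - T y)" for x
      using nrm[of "y - T x"] by (simp add: linear_diff[OF lin] inv norm_minus_commute)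
    then have *: "indicator B (y - T x) = (indicator B (x + (- T y)) :: ennreal)" for x
      by (simp add: B_def indicator_def)
    have "(\<integral>\<^sup>+x. indicator A (T y) * indicator B (y - T x) \<partial>lborel)
      = indicator A (T y) * (\<integral>\<^sup>+x. indicator B (x + (- T y)) \<partial>lborel)"
      unfolding * by (rule nn_integral_cmult) measurable
    also have "(\<integral>\<^sup>+x. indicator B (x + (- T y)) \<partial>lborel) = emeasure lborel B"
      by (subst nn_integral_lborel_translate) auto
    finally show "(\<integral>\<^sup>+x. indicator A (T y) * indicator B (y - T x) \<partial>lborel) = indicator A (T y) * emeasure lborel B" .
  qed
  also have "\<dots> = (\<integral>\<^sup>+y. indicator A (T y) \<partial>lborel) * emeasure lborel B"
    by (rule nn_integral_multc) measurable
  also have "(\<integral>\<^sup>+y. indicator A (T y) \<partial>lborel) = emeasure (distr lborel borel T) A"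
    by (simp add: nn_integral_indicator[symmetric] nn_integral_distr del: nn_integral_indicator)
  finally show "emeasure (distr lborel borel T) A = emeasure lborel A"
    using pos fin by (metis ennreal_mult_divide_eq infinity_ennreal_def mult_divide_eq_ennreal)
qed

section \<open>Interaction energies and nonlocal perimeters\<close>

definition interaction :: "('a::euclidean_space \<Rightarrow> ennreal) \<Rightarrow> 'a set \<Rightarrow> 'a set \<Rightarrow> ennreal" where
  "interaction \<kappa> U V = (\<integral>\<^sup>+x. (\<integral>\<^sup>+y. \<kappa> (x - y) * indicator U x * indicator V y \<partial>lborel) \<partial>lborel)"

definition perimeter :: "('a::euclidean_space \<Rightarrow> ennreal) \<Rightarrow> 'a set \<Rightarrow> ennreal" where
  "perimeter \<kappa> E = interaction \<kappa> E (- E)"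

lemma interaction_mono:
  assumes "\<And>z. \<kappa> z \<le> \<kappa>' z" "U \<subseteq> U'" "V \<subseteq> V'"
  shows "interaction \<kappa> U V \<le> interaction \<kappa>' U' V'"
  unfolding interaction_def using assms
  by (intro nn_integral_mono mult_mono) (auto simp: indicator_def)

lemma perimeter_mono: "(\<And>z. \<kappa> z \<le> \<kappa>' z) \<Longrightarrow> perimeter \<kappa> E \<le> perimeter \<kappa>' E"
  unfolding perimeter_def by (rule interaction_mono) auto

lemma interaction_swap:
  fixes U V :: "'a::euclidean_space set"
  assumes [measurable]: "\<kappa> \<in> borel_measurable borel" "U \<in> sets borel" "V \<in> sets borel"
    and even: "\<And>z. \<kappa> (- z) = \<kappa> z"
  shows "interaction \<kappa> U V = interaction \<kappa> V U"
proof -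
  have "interaction \<kappa> U V = (\<integral>\<^sup>+y. (\<integral>\<^sup>+x. \<kappa> (x - y) * indicator U x * indicator V y \<partial>lborel) \<partial>lborel)"
    unfolding interaction_def by (rule nn_integral_lborel_swap) measurable
  also have "\<dots> = interaction \<kappa> V U"
    unfolding interaction_def
    by (intro nn_integral_cong) (metis even minus_diff_eq mult.assoc mult.commute)
  finally show ?thesis .
qed

lemma interaction_Un_left:
  fixes U V :: "'a::euclidean_space set"
  assumes [measurable]: "\<kappa> \<in> borel_measurable borel" "U \<in> sets borel" "U' \<in> sets borel" "V \<in> sets borel"
    and "U \<inter> U' = {}"
  shows "interaction \<kappa> (U \<union> U') V = interaction \<kappa> U V + interaction \<kappa> U' V"
proof -
  have "indicator (U \<union> U') x = (indicator U x + indicator U' x :: ennreal)" for x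
    using assms(5) by (auto simp: indicator_def)
  then show ?thesis
    unfolding interaction_def
    by (simp add: distrib_left distrib_right nn_integral_add)
qed

lemma interaction_Un_right:
  fixes U V :: "'a::euclidean_space set"
  assumes [measurable]: "\<kappa> \<in> borel_measurable borel" "U \<in> sets borel" "V' \<in> sets borel" "V \<in> sets borel"
    and "V \<inter> V' = {}"
  shows "interaction \<kappa> U (V \<union> V') = interaction \<kappa> U V + interaction \<kappa> U V'"
proof -
  have "indicator (V \<union> V') x = (indicator V x + indicator V' x :: ennreal)" for x
    using assms(5) by (auto simp: indicator_def)
  then show ?thesis
    unfolding interaction_def
    by (simp add: distrib_left distrib_right nn_integral_add)
qed

lemma nn_integral_lborel_uminus:
  fixes f :: "'a::euclidean_space \<Rightarrow> ennreal"
  assumes [measurable]: "f \<in> borel_measurable borel"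
  shows "(\<integral>\<^sup>+x. f (- x) \<partial>lborel) = (\<integral>\<^sup>+x. f x \<partial>lborel)"
  using nn_integral_lborel_scaleR[of f "-1"] by simp

lemma nn_integral_lborel_diff:
  fixes f :: "'a::euclidean_space \<Rightarrow> ennreal"
  assumes [measurable]: "f \<in> borel_measurable borel"
  shows "(\<integral>\<^sup>+y. f (x - y) \<partial>lborel) = (\<integral>\<^sup>+z. f z \<partial>lborel)"
    and "(\<integral>\<^sup>+y. f (y - x) \<partial>lborel) = (\<integral>\<^sup>+z. f z \<partial>lborel)"
proof -
  have "(\<integral>\<^sup>+y. f (x - y) \<partial>lborel) = (\<integral>\<^sup>+y. f (- (y + (- x))) \<partial>lborel)"
    by simp
  also have "\<dots> = (\<integral>\<^sup>+z. f (- z) \<partial>lborel)"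
    by (rule nn_integral_lborel_translate) measurable
  finally show "(\<integral>\<^sup>+y. f (x - y) \<partial>lborel) = (\<integral>\<^sup>+z. f z \<partial>lborel)"
    by (simp add: nn_integral_lborel_uminus)
  show "(\<integral>\<^sup>+y. f (y - x) \<partial>lborel) = (\<integral>\<^sup>+z. f z \<partial>lborel)"
    using nn_integral_lborel_translate[of f "- x"] by simp
qed

lemma interaction_UNIV:
  fixes U :: "'a::euclidean_space set"
  assumes [measurable]: "\<kappa> \<in> borel_measurable borel" "U \<in> sets borel"
  shows "interaction \<kappa> U UNIV = emeasure lborel U * (\<integral>\<^sup>+z. \<kappa> z \<partial>lborel)"
proof -
  have "(\<integral>\<^sup>+y. \<kappa> (x - y) * indicator U x * indicator UNIV y \<partial>lborel)
      = (\<integral>\<^sup>+z. \<kappa> z \<partial>lborel) * indicator U x" for x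
    by (simp add: nn_integral_multc nn_integral_lborel_diff)
  then show ?thesis
    unfolding interaction_def by (simp add: nn_integral_cmult mult.commute[of "emeasure _ _"])
qed

text \<open>For an integrable kernel, perimeter and self-interaction add up to a quantity that
  depends on the volume only, so a rearrangement that raises the one lowers the other by the same
  amount. The additive form avoids subtraction in \<open>ennreal\<close>.\<close>

lemma perimeter_plus_self_interaction:
  fixes E :: "'a::euclidean_space set"
  assumes [measurable]: "\<kappa> \<in> borel_measurable borel" "E \<in> sets borel"
  shows "perimeter \<kappa> E + interaction \<kappa> E E = emeasure lborel E * (\<integral>\<^sup>+z. \<kappa> z \<partial>lborel)"
proof -
  have "interaction \<kappa> E (- E \<union> E) = perimeter \<kappa> E + interaction \<kappa> E E"
    unfolding perimeter_def by (rule interaction_Un_right) auto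
  moreover have "- E \<union> E = UNIV" by auto
  ultimately show ?thesis by (simp add: interaction_UNIV)
qed

section \<open>Polarization for an abstract reflection and half-space\<close>

locale polarizer =
  fixes \<sigma> :: "'a::euclidean_space \<Rightarrow> 'a" and H :: "'a set"
  assumes meas_refl[measurable]: "\<sigma> \<in> borel_measurable borel"
    and meas_side[measurable]: "H \<in> sets borel"
    and invol[simp]: "\<sigma> (\<sigma> x) = x"
    and isom: "dist (\<sigma> x) (\<sigma> y) = dist x y"
    and distr_refl: "distr lborel borel \<sigma> = lborel"
    and other_side: "x \<in> H \<Longrightarrow> \<sigma> x \<notin> H"
    and sides: "x \<in> H \<or> \<sigma> x \<in> H \<or> \<sigma> x = x"
    and closer: "x \<in> H \<Longrightarrow> y \<in> H \<Longrightarrow> dist x y \<le> dist x (\<sigma> y)"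
begin

definition gained :: "'a set \<Rightarrow> 'a set" where
  "gained E = {x \<in> H. x \<notin> E \<and> \<sigma> x \<in> E}"

text \<open>By \<open>sides\<close>, these points lie in \<open>H\<close>: they are the points on
  the good side whose mirror image is missing. Polarization changes the self-interaction only
  through pairs of a point here and a point of \<open>gained\<close>.\<close>

definition kept :: "'a set \<Rightarrow> 'a set" where
  "kept E = {x \<in> E. \<sigma> x \<notin> E \<and> \<sigma> x \<notin> H}"

definition polarize :: "'a set \<Rightarrow> 'a set" where
  "polarize E = (E - \<sigma> -` gained E) \<union> gained E"

lemma vimage_sets[measurable (raw)]: "U \<in> sets borel \<Longrightarrow> \<sigma> -` U \<in> sets borel"
  using measurable_sets[OF meas_refl] by simp

lemma gained_sets[measurable (raw)]:
  assumes [measurable]: "E \<in> sets borel"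
  shows "gained E \<in> sets borel"
  unfolding gained_def by measurable

lemma kept_sets[measurable (raw)]:
  assumes [measurable]: "E \<in> sets borel"
  shows "kept E \<in> sets borel"
  unfolding kept_def by measurable

lemma polarize_sets[measurable (raw)]:
  assumes [measurable]: "E \<in> sets borel"
  shows "polarize E \<in> sets borel"
  unfolding polarize_def by measurable

lemma nn_integral_refl:
  "f \<in> borel_measurable borel \<Longrightarrow> (\<integral>\<^sup>+x. f (\<sigma> x) \<partial>lborel) = (\<integral>\<^sup>+x. f x \<partial>lborel)"
  by (subst (2) distr_refl[symmetric]) (simp add: nn_integral_distr)

lemma emeasure_vimage: "U \<in> sets borel \<Longrightarrow> emeasure lborel (\<sigma> -` U) = emeasure lborel U"
  by (subst (2) distr_refl[symmetric]) (simp add: emeasure_distr)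

lemma interaction_vimage:
  assumes [measurable]: "\<phi> \<in> borel_measurable borel" "U \<in> sets borel" "V \<in> sets borel"
  shows "interaction (\<lambda>z. \<phi> (norm z)) (\<sigma> -` U) (\<sigma> -` V) = interaction (\<lambda>z. \<phi> (norm z)) U V"
proof -
  let ?f = "\<lambda>x y. \<phi> (norm (x - y)) * indicator U x * indicator V y"
  have "interaction (\<lambda>z. \<phi> (norm z)) (\<sigma> -` U) (\<sigma> -` V) = (\<integral>\<^sup>+x. (\<integral>\<^sup>+y. ?f (\<sigma> x) (\<sigma> y) \<partial>lborel) \<partial>lborel)"
    unfolding interaction_def
    by (intro nn_integral_cong) (simp add: indicator_def isom[unfolded dist_norm])
  also have "\<dots> = (\<integral>\<^sup>+x. (\<integral>\<^sup>+y. ?f (\<sigma> x) y \<partial>lborel) \<partial>lborel)"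
    by (intro nn_integral_cong nn_integral_refl) measurable
  also have "\<dots> = (\<integral>\<^sup>+x. (\<integral>\<^sup>+y. ?f x y \<partial>lborel) \<partial>lborel)"
    by (rule nn_integral_refl) measurable
  finally show ?thesis by (simp add: interaction_def)
qed

lemma emeasure_polarize:
  assumes [measurable]: "E \<in> sets borel"
  shows "emeasure lborel (polarize E) = emeasure lborel E"
proof -
  let ?B = "gained E"
  have "emeasure lborel (polarize E) = emeasure lborel (E - \<sigma> -` ?B) + emeasure lborel ?B"
    unfolding polarize_def by (rule plus_emeasure[symmetric]) (auto simp: gained_def)
  also have "\<dots> = emeasure lborel (E - \<sigma> -` ?B) + emeasure lborel (\<sigma> -` ?B)"
    by (simp add: emeasure_vimage)
  also have "\<dots> = emeasure lborel ((E - \<sigma> -` ?B) \<union> \<sigma> -` ?B)"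
    by (rule plus_emeasure) auto
  also have "(E - \<sigma> -` ?B) \<union> \<sigma> -` ?B = E"
    by (auto simp: gained_def)
  finally show ?thesis .
qed

text \<open>\<open>E\<close> splits into a mirror-symmetric part, the part \<open>A\<close> kept in
  \<open>H\<close>, and the mirror image of \<open>B\<close>; polarization replaces the last piece
  by \<open>B\<close>. Interactions with the symmetric part and within \<open>B\<close> do not
  change, as the reflection is an isometry. The self-interaction grows only through the pairs in
  \<open>A\<close> and \<open>B\<close>, each counted twice, and the perimeter drops by that
  growth.\<close>

theorem perimeter_polarize:
  fixes \<phi> :: "real \<Rightarrow> ennreal"
  defines "\<kappa> \<equiv> \<lambda>z. \<phi> (norm z)"
  assumes [measurable]: "\<phi> \<in> borel_measurable borel" "E \<in> sets borel"
    and anti: "\<And>a b. 0 \<le> a \<Longrightarrow> a \<le> b \<Longrightarrow> \<phi> b \<le> \<phi> a"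
    and int: "(\<integral>\<^sup>+z. \<kappa> z \<partial>lborel) \<noteq> \<infinity>" and E: "emeasure lborel E \<noteq> \<infinity>"
  shows "perimeter \<kappa> (polarize E) + 2 * (\<integral>\<^sup>+x. (\<integral>\<^sup>+y. (\<phi> (dist x y) - \<phi> (dist x (\<sigma> y)))
            * indicator (kept E) x * indicator (gained E) y \<partial>lborel) \<partial>lborel) = perimeter \<kappa> E"
proof -
  define B where "B = gained E"
  define A where "A = kept E"
  define S where "S = {x \<in> E. \<sigma> x \<in> E}"
  define C where "C = E - \<sigma> -` B"
  define G where "G = (\<integral>\<^sup>+x. (\<integral>\<^sup>+y. (\<phi> (dist x y) - \<phi> (dist x (\<sigma> y)))
            * indicator A x * indicator B y \<partial>lborel) \<partial>lborel)"
  have [measurable]: "\<kappa> \<in> borel_measurable borel" "B \<in> sets borel" "A \<in> sets borel" "S \<in> sets borel" "C \<in> sets borel"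
    by (simp_all add: \<kappa>_def B_def A_def S_def C_def)
  have even: "\<kappa> (- z) = \<kappa> z" for z by (simp add: \<kappa>_def)
  have AH: "A \<subseteq> H" unfolding A_def kept_def using sides by fastforce
  have BH: "B \<subseteq> H" by (auto simp: B_def gained_def)
  have CAS: "C = A \<union> S" "A \<inter> S = {}"
    by (auto simp: C_def A_def S_def B_def gained_def kept_def)
  have E_eq: "E = C \<union> \<sigma> -` B" "C \<inter> \<sigma> -` B = {}"
    and P_eq: "polarize E = C \<union> B" "C \<inter> B = {}"
    by (auto simp: C_def B_def gained_def polarize_def)
  have S_inv: "\<sigma> -` S = S" by (auto simp: S_def)
  have SB: "interaction \<kappa> S B = interaction \<kappa> S (\<sigma> -` B)"
    using interaction_vimage[of \<phi> S B] S_inv by (simp add: \<kappa>_def)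
  have BB: "interaction \<kappa> (\<sigma> -` B) (\<sigma> -` B) = interaction \<kappa> B B"
    using interaction_vimage[of \<phi> B B] by (simp add: \<kappa>_def)
  \<comment> \<open>On \<open>A\<close> and \<open>B\<close>, both inside \<open>H\<close>,
    \<open>closer\<close> and the monotone profile make the difference in \<open>G\<close> a genuine
    one, so the truncated subtraction of \<open>ennreal\<close> never cuts anything off.\<close>
  have AB: "interaction \<kappa> A B = interaction \<kappa> A (\<sigma> -` B) + G"
  proof -
    have "(\<integral>\<^sup>+y. \<kappa> (x - y) * indicator A x * indicator (\<sigma> -` B) y \<partial>lborel)
        = (\<integral>\<^sup>+y. \<kappa> (x - \<sigma> y) * indicator A x * indicator B y \<partial>lborel)" for x
      using nn_integral_refl[of "\<lambda>y. \<kappa> (x - y) * indicator A x * indicator (\<sigma> -` B) y"]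
      by (simp add: indicator_def)
    then have "interaction \<kappa> A (\<sigma> -` B) + G = (\<integral>\<^sup>+x. (\<integral>\<^sup>+y. \<kappa> (x - \<sigma> y) * indicator A x * indicator B y \<partial>lborel) \<partial>lborel) + G"
      by (simp add: interaction_def)
    also have "\<dots> = (\<integral>\<^sup>+x. (\<integral>\<^sup>+y. \<kappa> (x - \<sigma> y) * indicator A x * indicator B y
         + (\<phi> (dist x y) - \<phi> (dist x (\<sigma> y))) * indicator A x * indicator B y \<partial>lborel) \<partial>lborel)"
      unfolding G_def by (subst nn_integral_add[symmetric]; (measurable)?)
         (subst nn_integral_add[symmetric]; (measurable)?; simp)
    also have "\<dots> = interaction \<kappa> A B"
      unfolding interaction_def
    proof (intro nn_integral_cong)
      fix x y
      show "\<kappa> (x - \<sigma> y) * indicator A x * indicator B y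
         + (\<phi> (dist x y) - \<phi> (dist x (\<sigma> y))) * indicator A x * indicator B y
         = \<kappa> (x - y) * indicator A x * indicator B y"
      proof (cases "x \<in> A \<and> y \<in> B")
        case True
        then have "dist x y \<le> dist x (\<sigma> y)" using AH BH closer by blast
        then have "\<phi> (dist x (\<sigma> y)) \<le> \<phi> (dist x y)" by (intro anti) auto
        then show ?thesis using True by (simp add: \<kappa>_def dist_norm)
      qed (auto simp: indicator_def)
    qed
    finally show ?thesis by simp
  qed
  have CB: "interaction \<kappa> C B = interaction \<kappa> C (\<sigma> -` B) + G"
    using CAS(2) by (simp add: CAS(1) interaction_Un_left AB SB ac_simps)
  have "interaction \<kappa> (C \<union> B) (C \<union> B) = interaction \<kappa> C C + 2 * interaction \<kappa> C B + interaction \<kappa> B B"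
    using P_eq(2) interaction_swap[of \<kappa> C B] even
    by (simp add: interaction_Un_left interaction_Un_right Int_commute mult_2 ac_simps)
  also have "\<dots> = interaction \<kappa> C C + 2 * interaction \<kappa> C (\<sigma> -` B) + interaction \<kappa> (\<sigma> -` B) (\<sigma> -` B) + 2 * G"
    by (simp add: CB BB distrib_left ac_simps)
  also have "interaction \<kappa> C C + 2 * interaction \<kappa> C (\<sigma> -` B) + interaction \<kappa> (\<sigma> -` B) (\<sigma> -` B)
     = interaction \<kappa> (C \<union> \<sigma> -` B) (C \<union> \<sigma> -` B)"
    using E_eq(2) interaction_swap[of \<kappa> C "\<sigma> -` B"] even
    by (simp add: interaction_Un_left interaction_Un_right Int_commute mult_2 ac_simps)
  finally have II: "interaction \<kappa> (polarize E) (polarize E) = interaction \<kappa> E E + 2 * G"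
    using E_eq(1) P_eq(1) by simp
  \<comment> \<open>Finite self-interaction allows the cancellation that ends the proof;
    integrability of the kernel and finite volume enter here.\<close>
  have fE: "interaction \<kappa> E E \<noteq> \<infinity>"
  proof -
    have "interaction \<kappa> E E \<le> emeasure lborel E * (\<integral>\<^sup>+z. \<kappa> z \<partial>lborel)"
      by (simp add: perimeter_plus_self_interaction[symmetric])
    also have "\<dots> < \<infinity>" using int E by (simp add: ennreal_mult_less_top less_top)
    finally show ?thesis by simp
  qed
  have "perimeter \<kappa> (polarize E) + 2 * G + interaction \<kappa> E E = perimeter \<kappa> E + interaction \<kappa> E E"
    using perimeter_plus_self_interaction[of \<kappa> E] perimeter_plus_self_interaction[of \<kappa> "polarize E"]
    by (simp add: emeasure_polarize II ac_simps)
  then show ?thesis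
    using fE by (simp add: G_def A_def B_def ennreal_add_left_cancel add.commute)
qed

end

section \<open>Reflections and the isoperimetric inequality for radially decreasing kernels\<close>

text \<open>The mirror is the hyperplane \<open>x \<bullet> u = h\<close>. The normal
  \<open>u\<close> is left unnormalized because averages over mirrors integrate \<open>u\<close>
  over a solid ball; at \<open>u = 0\<close> the map is the identity.\<close>

definition reflection :: "'a::euclidean_space \<Rightarrow> real \<Rightarrow> 'a \<Rightarrow> 'a" where
  "reflection u h x = x - (2 * (x \<bullet> u - h) / (u \<bullet> u)) *\<^sub>R u"

lemma reflection_measurable[measurable (raw)]:
  assumes [measurable]: "f \<in> borel_measurable M" "g \<in> borel_measurable M" "k \<in> borel_measurable M"
  shows "(\<lambda>x. reflection (f x) (g x) (k x)) \<in> borel_measurable M"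
  unfolding reflection_def by measurable

lemma reflection_inner: "u \<noteq> 0 \<Longrightarrow> reflection u h x \<bullet> u = 2 * h - x \<bullet> u"
  by (simp add: reflection_def inner_diff_left)

lemma reflection_reflection[simp]: "reflection u h (reflection u h x) = x"
proof (cases "u = 0")
  case False
  have "reflection u h (reflection u h x) = x - ((2 * (x \<bullet> u - h) / (u \<bullet> u)) + (2 * (reflection u h x \<bullet> u - h) / (u \<bullet> u))) *\<^sub>R u"
    unfolding scaleR_add_left reflection_def[of u h "reflection u h x"] by (simp add: reflection_def)
  also have "(2 * (x \<bullet> u - h) / (u \<bullet> u)) + (2 * (reflection u h x \<bullet> u - h) / (u \<bullet> u)) = 0"
    unfolding reflection_inner[OF False] add_divide_distrib[symmetric] by simp
  finally show ?thesis by simp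
qed (simp add: reflection_def)

text \<open>The correction is four times the product of the signed distances to the hyperplane. Its
  sign yields the half-space property of a polarizer and the comparison of norms; its size later
  measures the gain of a polarization.\<close>

lemma dist_reflection_sq:
  assumes "u \<noteq> 0"
  shows "(dist x (reflection u h y))\<^sup>2 = (dist x y)\<^sup>2 + 4 * (h - x \<bullet> u) * (h - y \<bullet> u) / (u \<bullet> u)"
proof -
  define t where "t = 2 * (h - y \<bullet> u) / (u \<bullet> u)"
  have t: "t * (u \<bullet> u) = 2 * (h - y \<bullet> u)" using assms by (simp add: t_def)
  have "2 * (y \<bullet> u - h) = - (2 * (h - y \<bullet> u))" by simp
  then have r: "reflection u h y = y + t *\<^sub>R u"
    unfolding reflection_def t_def by (simp only: minus_divide_left[symmetric] scaleR_minus_left diff_minus_eq_add)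
  have "(dist x (reflection u h y))\<^sup>2 = (x - y - t *\<^sub>R u) \<bullet> (x - y - t *\<^sub>R u)"
    by (simp add: r dist_norm power2_norm_eq_inner algebra_simps)
  also have "\<dots> = (dist x y)\<^sup>2 + t * (t * (u \<bullet> u)) - 2 * t * (x \<bullet> u - y \<bullet> u)"
    by (simp add: dist_norm power2_norm_eq_inner inner_diff_left inner_diff_right inner_commute algebra_simps)
  also have "\<dots> = (dist x y)\<^sup>2 + t * (2 * (h - x \<bullet> u))"
    unfolding t by (simp add: algebra_simps)
  also have "t * (2 * (h - x \<bullet> u)) = 4 * (h - x \<bullet> u) * (h - y \<bullet> u) / (u \<bullet> u)"
  proof -
    have "(2 * a / d) * (2 * b) = 4 * b * a / d" for a b d :: real by simp
    then show ?thesis unfolding t_def .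
  qed
  finally show ?thesis .
qed

lemma dist_reflection: "dist (reflection u h x) (reflection u h y) = dist x y"
proof (cases "u = 0")
  case False
  have "h - reflection u h x \<bullet> u = - (h - x \<bullet> u)"
    using False by (simp add: reflection_inner)
  then have "(dist (reflection u h x) (reflection u h y))\<^sup>2
      = (dist y (reflection u h x))\<^sup>2 - 4 * (h - y \<bullet> u) * (h - x \<bullet> u) / (u \<bullet> u)"
  proof -
    have *: "4 * (- a) * b / d = - (4 * b * a / d)" for a b d :: real by simp
    assume "h - reflection u h x \<bullet> u = - (h - x \<bullet> u)"
    then show ?thesis
      unfolding dist_reflection_sq[OF False, of "reflection u h x" h y] by (simp only: * dist_commute)
  qed
  also have "\<dots> = (dist x y)\<^sup>2"
    unfolding dist_reflection_sq[OF False] by (simp add: dist_commute)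
  finally show ?thesis by simp
qed (simp add: reflection_def)

lemma norm_reflection_sq:
  assumes "u \<noteq> 0"
  shows "(norm (reflection u h x))\<^sup>2 = (norm x)\<^sup>2 + 4 * h * (h - x \<bullet> u) / (u \<bullet> u)"
  using dist_reflection_sq[OF assms, of 0 h x] by simp

lemma linear_reflection: "linear (reflection u 0)"
  by (rule linearI)
     (simp_all add: reflection_def inner_add_left algebra_simps add_divide_distrib)

lemma norm_reflection[simp]: "norm (reflection u 0 x) = norm x"
  using dist_reflection[of u 0 x 0] by (simp add: reflection_def)

lemma distr_lborel_reflection: "distr lborel borel (reflection u h) = lborel"
proof -
  have "reflection u h = (+) ((2 * h / (u \<bullet> u)) *\<^sub>R u) \<circ> reflection u 0"
    by (auto simp: reflection_def diff_divide_distrib right_diff_distrib scaleR_diff_left)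
  then have "distr lborel borel (reflection u h)
      = distr (distr lborel borel (reflection u 0)) borel ((+) ((2 * h / (u \<bullet> u)) *\<^sub>R u))"
    by (simp add: distr_distr)
  also have "distr lborel borel (reflection u 0) = lborel"
    by (rule distr_lborel_linear_involution) (simp_all add: linear_reflection)
  finally show ?thesis by (simp add: lborel_distr_plus)
qed

lemma polarizer_reflection:
  assumes u: "u \<noteq> 0"
  shows "polarizer (reflection u h) {x. x \<bullet> u < h}"
proof
  have side: "reflection u h x \<bullet> u = 2 * h - x \<bullet> u" for x
    using u by (rule reflection_inner)
  show "distr lborel borel (reflection u h) = lborel" by (rule distr_lborel_reflection)
  show "reflection u h x \<notin> {x. x \<bullet> u < h}" if "x \<in> {x. x \<bullet> u < h}" for x
    using that by (simp add: side)
  show "x \<in> {x. x \<bullet> u < h} \<or> reflection u h x \<in> {x. x \<bullet> u < h} \<or> reflection u h x = x" for x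
    by (cases "x \<bullet> u = h") (auto simp: side, simp add: reflection_def)
  show "dist x y \<le> dist x (reflection u h y)" if "x \<in> {x. x \<bullet> u < h}" "y \<in> {x. x \<bullet> u < h}" for x y
  proof (rule power2_le_imp_le)
    show "(dist x y)\<^sup>2 \<le> (dist x (reflection u h y))\<^sup>2"
      using that by (simp add: dist_reflection_sq[OF u])
  qed simp
qed (simp_all add: dist_reflection)

text \<open>For fixed \<open>x\<close>, the mirrors with normal \<open>u\<close> send
  \<open>x\<close> to the points \<open>x + t *\<^sub>R u\<close>, and \<open>t\<close> depends
  linearly on \<open>h\<close>. Integrating over \<open>u\<close> and \<open>h\<close> therefore
  amounts to integrating over all targets \<open>y\<close>, and the Jacobian supplies the squared
  distance. Consequently some single reflection carries a definite part of \<open>X\<close> into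
  \<open>Y\<close>.\<close>

lemma reflection_average_lower:
  fixes X Y :: "'a::euclidean_space set"
  assumes [measurable]: "X \<in> sets borel" "Y \<in> sets borel"
    and Q: "X \<subseteq> ball 0 Q" "Y \<subseteq> ball 0 Q" "Q > 0"
    and XY: "\<And>x y. x \<in> X \<Longrightarrow> y \<in> Y \<Longrightarrow> norm x < norm y"
    and M: "\<And>u h. u \<noteq> 0 \<Longrightarrow> h > 0 \<Longrightarrow> emeasure lborel {x \<in> X. reflection u h x \<in> Y} \<le> M"
  shows "ennreal (1 / ((2 * Q + 1) ^ DIM('a) * (2 * (2 * Q + 1)\<^sup>2))) *
     (\<integral>\<^sup>+x. (\<integral>\<^sup>+y. ennreal ((dist x y)\<^sup>2) * indicator X x * indicator Y y \<partial>lborel) \<partial>lborel)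
     \<le> M * ennreal Q * emeasure lborel (ball (0::'a) 1)"
proof -
  define c where "c = 1 / ((2 * Q + 1) ^ DIM('a) * (2 * (2 * Q + 1)\<^sup>2))"
  have c0: "c \<ge> 0" using Q by (simp add: c_def)
  define b :: "'a \<Rightarrow> ennreal" where "b = indicator (ball 0 1)"
  define i :: "real \<Rightarrow> ennreal" where "i = indicator {0<..<Q}"
  have [measurable]: "b \<in> borel_measurable borel" "i \<in> borel_measurable borel"
    unfolding b_def i_def by (auto intro!: borel_measurable_indicator)
  have [measurable]: "ball (0::'a) 1 \<in> sets borel" "{2*Q<..<2*Q+1} \<in> sets borel" by auto
  let ?i = "\<lambda>x u h. indicator X x * indicator Y (reflection u h x) * b u * i h"
  have inner: "ennreal c * (\<integral>\<^sup>+y. ennreal ((dist x y)\<^sup>2) * indicator X x * indicator Y y \<partial>lborel)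
     \<le> (\<integral>\<^sup>+u. (\<integral>\<^sup>+h. ?i x u h \<partial>lborel) \<partial>lborel)" for x
  proof (cases "x \<in> X")
    case x: True
    \<comment> \<open>Substitution \<open>h = x \<bullet> u + (u \<bullet> u / 2) * t\<close>, with
      half the squared norm of \<open>u\<close> as Jacobian. The window for \<open>t\<close> starts
      at \<open>2 * Q\<close> so that each target in the ball is reached with
      \<open>norm u < 1\<close>.\<close>
    have step1: "(\<integral>\<^sup>+t. ennreal ((norm u)\<^sup>2 / 2) * indicator (ball 0 1) u * indicator Y (x + t *\<^sub>R u) * indicator {2*Q<..<2*Q+1} t \<partial>lborel)
       \<le> (\<integral>\<^sup>+h. ?i x u h \<partial>lborel)" (is "?l u \<le> ?r u") for u
    proof (cases "u = 0")
      case u: False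
      have uu: "u \<bullet> u > 0" using u by simp
      have refl: "reflection u (x \<bullet> u + (u \<bullet> u / 2) * t) x = x + t *\<^sub>R u" for t
        using uu by (simp add: reflection_def)
      have "?r u = ennreal (u \<bullet> u / 2) * (\<integral>\<^sup>+t. ?i x u (x \<bullet> u + (u \<bullet> u / 2) * t) \<partial>lborel)"
        using nn_integral_real_affine[of "\<lambda>h. ?i x u h" "u \<bullet> u / 2" "x \<bullet> u"] uu by simp
      also have "\<dots> = (\<integral>\<^sup>+t. ennreal (u \<bullet> u / 2) * ?i x u (x \<bullet> u + (u \<bullet> u / 2) * t) \<partial>lborel)"
        by (rule nn_integral_cmult[symmetric]) measurable
      also have "\<dots> \<ge> ?l u"
      proof (rule nn_integral_mono)
        fix t
        show "ennreal ((norm u)\<^sup>2 / 2) * indicator (ball 0 1) u * indicator Y (x + t *\<^sub>R u) * indicator {2*Q<..<2*Q+1} t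
          \<le> ennreal (u \<bullet> u / 2) * ?i x u (x \<bullet> u + (u \<bullet> u / 2) * t)"
        proof (cases "norm u < 1 \<and> x + t *\<^sub>R u \<in> Y \<and> 2*Q < t \<and> t < 2*Q+1")
          case True
          define y where "y = x + t *\<^sub>R u"
          define h where "h = x \<bullet> u + (u \<bullet> u / 2) * t"
          have t: "t > 0" using True Q by linarith
          \<comment> \<open>Only mirrors with positive \<open>h\<close> are averaged. That
            \<open>h\<close> is positive follows from \<open>norm x < norm y\<close>, as the
            difference of the squared norms is \<open>2 * t * h\<close>.\<close>
          have "norm x < norm y" using XY x True by (simp add: y_def)
          then have "x \<bullet> x < y \<bullet> y" by (simp add: norm_lt)
          moreover have "y \<bullet> y - x \<bullet> x = 2 * t * h"
            by (simp add: y_def h_def inner_add_left inner_add_right inner_commute algebra_simps)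
          ultimately have h0: "h > 0" using t zero_less_mult_pos[of "2 * t" h] by linarith
          have "h = (x + y) \<bullet> u / 2" by (simp add: y_def h_def inner_add_left algebra_simps)
          also have "\<dots> \<le> norm (x + y) * norm u / 2"
            using norm_cauchy_schwarz[of "x + y" u] by simp
          also have "\<dots> \<le> norm (x + y) * 1 / 2" using True by (intro divide_right_mono mult_left_mono) auto
          also have "\<dots> < Q" using norm_triangle_ineq[of x y] x Q True
            by (fastforce simp: y_def subset_iff)
          finally have "h < Q" .
          moreover have "reflection u h x = y" by (simp only: h_def refl y_def)
          ultimately show ?thesis using True x h0
            unfolding h_def[symmetric] y_def[symmetric] by (simp add: power2_norm_eq_inner b_def i_def)
        qed (auto simp: indicator_def)
      qed
      finally show ?thesis .
    qed simp
    have "ennreal c * (\<integral>\<^sup>+y. ennreal ((dist x y)\<^sup>2) * indicator X x * indicator Y y \<partial>lborel)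
        = ennreal c * (\<integral>\<^sup>+y. ennreal ((norm (y - x))\<^sup>2) * indicator Y y \<partial>lborel)"
      using x by (simp add: dist_norm norm_minus_commute)
    also have "\<dots> = ennreal c * (\<integral>\<^sup>+z. ennreal ((norm z)\<^sup>2) * indicator Y (x + z) \<partial>lborel)"
      using nn_integral_lborel_translate[of "\<lambda>y. ennreal ((norm (y - x))\<^sup>2) * indicator Y y" x]
      by (simp add: add.commute)
    also have "\<dots> = (\<integral>\<^sup>+z. ennreal (c * (norm z)\<^sup>2) * indicator Y (x + z) \<partial>lborel)"
    proof (subst nn_integral_cmult[symmetric])
      show "(\<integral>\<^sup>+z. ennreal c * (ennreal ((norm z)\<^sup>2) * indicator Y (x + z)) \<partial>lborel)
          = (\<integral>\<^sup>+z. ennreal (c * (norm z)\<^sup>2) * indicator Y (x + z) \<partial>lborel)"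
        using c0 by (intro nn_integral_cong) (simp add: ennreal_mult' mult.assoc)
    qed measurable
    also have "\<dots> = (\<integral>\<^sup>+t. (\<integral>\<^sup>+z. ennreal (c * (norm z)\<^sup>2) * indicator Y (x + z) \<partial>lborel) * indicator {2*Q<..<2*Q+1} t \<partial>lborel)"
      by (simp add: nn_integral_cmult)
    also have "\<dots> \<le> (\<integral>\<^sup>+t. (\<integral>\<^sup>+u. ennreal ((norm u)\<^sup>2 / 2) * indicator (ball 0 1) u * indicator Y (x + t *\<^sub>R u) * indicator {2*Q<..<2*Q+1} t \<partial>lborel) \<partial>lborel)"
    proof (rule nn_integral_mono)
      fix t :: real
      show "(\<integral>\<^sup>+z. ennreal (c * (norm z)\<^sup>2) * indicator Y (x + z) \<partial>lborel) * indicator {2*Q<..<2*Q+1} t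
        \<le> (\<integral>\<^sup>+u. ennreal ((norm u)\<^sup>2 / 2) * indicator (ball 0 1) u * indicator Y (x + t *\<^sub>R u) * indicator {2*Q<..<2*Q+1} t \<partial>lborel)"
      proof (cases "2*Q < t \<and> t < 2*Q+1")
        case t: True
        then have t0: "t > 0" using Q by linarith
        have "(\<integral>\<^sup>+z. ennreal (c * (norm z)\<^sup>2) * indicator Y (x + z) \<partial>lborel)
           = (\<integral>\<^sup>+u. ennreal (t ^ DIM('a)) * (ennreal (c * (norm (t *\<^sub>R u))\<^sup>2) * indicator Y (x + t *\<^sub>R u)) \<partial>lborel)"
          using t0 by (subst nn_integral_lborel_scaleR[where c=t]) (auto simp: nn_integral_cmult)
        also have "\<dots> \<le> (\<integral>\<^sup>+u. ennreal ((norm u)\<^sup>2 / 2) * indicator (ball 0 1) u * indicator Y (x + t *\<^sub>R u) \<partial>lborel)"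
        proof (rule nn_integral_mono)
          fix u
          show "ennreal (t ^ DIM('a)) * (ennreal (c * (norm (t *\<^sub>R u))\<^sup>2) * indicator Y (x + t *\<^sub>R u))
             \<le> ennreal ((norm u)\<^sup>2 / 2) * indicator (ball 0 1) u * indicator Y (x + t *\<^sub>R u)"
          proof (cases "x + t *\<^sub>R u \<in> Y")
            case True
            have "norm (t *\<^sub>R u) \<le> norm (x + t *\<^sub>R u) + norm x"
              by (metis add_diff_cancel_left' norm_triangle_ineq4)
            also have "\<dots> < 2 * Q" using x Q True by (fastforce simp: subset_iff)
            finally have "t * norm u < 2 * Q" using t0 by simp
            then have "t * norm u < t * 1" using t by linarith
            then have u: "norm u < 1" using t0 by (simp only: mult_less_cancel_left_pos)
            have "t ^ DIM('a) * (c * (norm (t *\<^sub>R u))\<^sup>2) = (t ^ DIM('a) * t\<^sup>2) * c * (norm u)\<^sup>2"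
              by (simp add: power_mult_distrib)
            \<comment> \<open>The shape of \<open>c\<close> comes from here: the window for
              \<open>t\<close> bounds the power \<open>DIM('a) + 2\<close> of \<open>t\<close>, and
              the further factor two matches the weight.\<close>
            also have "\<dots> \<le> ((2*Q+1) ^ DIM('a) * (2*Q+1)\<^sup>2) * c * (norm u)\<^sup>2"
              using t t0 Q by (intro mult_right_mono mult_mono power_mono) (auto simp: c_def)
            also have "\<dots> = (norm u)\<^sup>2 / 2"
              using Q by (simp add: c_def field_simps)
            finally show ?thesis using True u t0 Q
              by (simp add: ennreal_mult'[symmetric] c_def ennreal_leI)
          qed simp
        qed
        finally show ?thesis using t by simp
      qed simp
    qed
    also have "\<dots> = (\<integral>\<^sup>+u. ?l u \<partial>lborel)"
      by (rule nn_integral_lborel_swap) measurable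
    also have "\<dots> \<le> (\<integral>\<^sup>+u. ?r u \<partial>lborel)"
      by (intro nn_integral_mono step1)
    finally show ?thesis .
  qed simp
  have "ennreal c * (\<integral>\<^sup>+x. (\<integral>\<^sup>+y. ennreal ((dist x y)\<^sup>2) * indicator X x * indicator Y y \<partial>lborel) \<partial>lborel)
      = (\<integral>\<^sup>+x. ennreal c * (\<integral>\<^sup>+y. ennreal ((dist x y)\<^sup>2) * indicator X x * indicator Y y \<partial>lborel) \<partial>lborel)"
    by (rule nn_integral_cmult[symmetric]) measurable
  also have "\<dots> \<le> (\<integral>\<^sup>+x. (\<integral>\<^sup>+u. (\<integral>\<^sup>+h. ?i x u h \<partial>lborel) \<partial>lborel) \<partial>lborel)"
    by (intro nn_integral_mono inner)
  also have "\<dots> = (\<integral>\<^sup>+u. (\<integral>\<^sup>+x. (\<integral>\<^sup>+h. ?i x u h \<partial>lborel) \<partial>lborel) \<partial>lborel)"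
    by (rule nn_integral_lborel_swap) measurable
  also have "\<dots> = (\<integral>\<^sup>+u. (\<integral>\<^sup>+h. (\<integral>\<^sup>+x. ?i x u h \<partial>lborel) \<partial>lborel) \<partial>lborel)"
    by (intro nn_integral_cong nn_integral_lborel_swap) measurable
  also have "\<dots> \<le> (\<integral>\<^sup>+u. (\<integral>\<^sup>+h. M * indicator {0<..<Q} h * indicator (ball (0::'a) 1) u \<partial>lborel) \<partial>lborel)"
  proof (rule nn_integral_mono_AE)
    have "AE u in lborel. (u::'a) \<noteq> 0" by (rule AE_lborel_singleton)
    then show "AE u in lborel. (\<integral>\<^sup>+h. (\<integral>\<^sup>+x. ?i x u h \<partial>lborel) \<partial>lborel)
       \<le> (\<integral>\<^sup>+h. M * indicator {0<..<Q} h * indicator (ball (0::'a) 1) u \<partial>lborel)"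
    proof eventually_elim
      case (elim u)
      show ?case
      proof (rule nn_integral_mono)
        fix h :: real
        have "(\<integral>\<^sup>+x. ?i x u h \<partial>lborel) =
          (\<integral>\<^sup>+x. indicator {x \<in> X. reflection u h x \<in> Y} x * (b u * i h) \<partial>lborel)"
          by (intro nn_integral_cong) (auto simp: indicator_def)
        also have "\<dots> = emeasure lborel {x \<in> X. reflection u h x \<in> Y} * (b u * i h)"
          by (subst nn_integral_multc) auto
        also have "\<dots> \<le> M * indicator {0<..<Q} h * indicator (ball (0::'a) 1) u"
          using M[OF elim, of h] by (auto simp: indicator_def b_def i_def)
        finally show "(\<integral>\<^sup>+x. ?i x u h \<partial>lborel) \<le> M * indicator {0<..<Q} h * indicator (ball (0::'a) 1) u" .
      qed
    qed
  qed
  also have "\<dots> = M * ennreal Q * emeasure lborel (ball (0::'a) 1)"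
    using Q by (simp add: nn_integral_cmult nn_integral_multc nn_integral_cmult_indicator)
  finally show ?thesis by (simp add: c_def)
qed


section \<open>The ball minimizes the perimeter of an integrable kernel\<close>

lemma perimeter_le_perimeter_plus_symdiff:
  fixes E :: "'a::euclidean_space set"
  assumes [measurable]: "\<kappa> \<in> borel_measurable borel" "E \<in> sets borel" "E' \<in> sets borel"
    and even: "\<And>z. \<kappa> (- z) = \<kappa> z"
  shows "perimeter \<kappa> E \<le> perimeter \<kappa> E' +
     (emeasure lborel (E - E') + emeasure lborel (E' - E)) * (\<integral>\<^sup>+z. \<kappa> z \<partial>lborel)"
proof -
  have "perimeter \<kappa> E = interaction \<kappa> ((E \<inter> E') \<union> (E - E')) (- E)"
    unfolding perimeter_def by (rule arg_cong[where f="\<lambda>U. interaction \<kappa> U (- E)"]) auto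
  also have "\<dots> = interaction \<kappa> (E \<inter> E') (- E) + interaction \<kappa> (E - E') (- E)"
    by (rule interaction_Un_left) auto
  also have "interaction \<kappa> (E \<inter> E') (- E) \<le> interaction \<kappa> E' ((- E') \<union> (E' - E))"
    by (rule interaction_mono) auto
  also have "\<dots> = perimeter \<kappa> E' + interaction \<kappa> E' (E' - E)"
    unfolding perimeter_def by (rule interaction_Un_right) auto
  also have "interaction \<kappa> E' (E' - E) = interaction \<kappa> (E' - E) E'"
    by (rule interaction_swap) (auto simp: even)
  also have "\<dots> \<le> interaction \<kappa> (E' - E) UNIV"
    by (rule interaction_mono) auto
  also have "interaction \<kappa> (E - E') (- E) \<le> interaction \<kappa> (E - E') UNIV"
    by (rule interaction_mono) auto
  finally show ?thesis
    by (simp add: interaction_UNIV add_mono distrib_right distrib_left ac_simps)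
qed

text \<open>For \<open>h > 0\<close> the origin lies in the chosen half-space, so every point that
  polarization moves gets closer to the origin. No mass leaves a centred ball, and the mass that
  enters it is a definite decrease of the mass outside.\<close>

lemma emeasure_polarize_diff_ball:
  fixes E :: "'a::euclidean_space set"
  assumes u: "u \<noteq> 0" and h: "h > 0" and [measurable]: "E \<in> sets borel"
  defines "E' \<equiv> polarizer.polarize (reflection u h) {x. x \<bullet> u < h} E"
  shows "emeasure lborel (E' - ball 0 R) + emeasure lborel {x \<in> ball 0 R - E. reflection u h x \<in> E - ball 0 R}
     \<le> emeasure lborel (E - ball 0 R)"
    and "E \<subseteq> ball 0 Q \<Longrightarrow> E' \<subseteq> ball 0 Q"
proof -
  interpret polarizer "reflection u h" "{x. x \<bullet> u < h}" by (rule polarizer_reflection[OF u])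
  let ?\<sigma> = "reflection u h" and ?B = "ball 0 R :: 'a set"
  define G where "G = gained E"
  have [measurable]: "G \<in> sets borel" by (simp add: G_def)
  have le_norm: "norm x < norm (?\<sigma> x) \<longleftrightarrow> x \<bullet> u < h" for x
  proof -
    have "norm x < norm (?\<sigma> x) \<longleftrightarrow> (norm x)\<^sup>2 < (norm (?\<sigma> x))\<^sup>2"
      by (metis norm_ge_zero pos2 power_mono_iff linorder_not_le)
    also have "\<dots> \<longleftrightarrow> 0 < 4 * h * (h - x \<bullet> u) / (u \<bullet> u)"
      by (simp add: norm_reflection_sq[OF u])
    also have "\<dots> \<longleftrightarrow> x \<bullet> u < h"
      using u h by (simp add: pos_less_divide_eq zero_less_mult_iff del: times_divide_eq_left)
    finally show ?thesis .
  qed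
  have G: "x \<in> G \<longleftrightarrow> norm x < norm (?\<sigma> x) \<and> x \<notin> E \<and> ?\<sigma> x \<in> E" for x
    by (auto simp: G_def gained_def le_norm)
  define N where "N = {x \<in> ?B - E. ?\<sigma> x \<in> E - ?B}"
  have [measurable]: "N \<in> sets borel" by (simp add: N_def)
  have "emeasure lborel (G - ?B) + emeasure lborel N = emeasure lborel ((G - ?B) \<union> N)"
    by (rule plus_emeasure) (auto simp: N_def)
  also have "\<dots> \<le> emeasure lborel (?\<sigma> -` (?\<sigma> -` G - ?B))"
    by (rule emeasure_mono) (auto simp: N_def G)
  also have "\<dots> = emeasure lborel (?\<sigma> -` G - ?B)"
    by (rule emeasure_vimage) auto
  finally have 1: "emeasure lborel (G - ?B) + emeasure lborel N \<le> emeasure lborel (?\<sigma> -` G - ?B)" .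
  have "emeasure lborel (E' - ?B) = emeasure lborel ((E - ?\<sigma> -` G - ?B) \<union> (G - ?B))"
    unfolding E'_def polarize_def G_def[symmetric] by (simp add: Un_Diff)
  also have "\<dots> \<le> emeasure lborel (E - ?\<sigma> -` G - ?B) + emeasure lborel (G - ?B)"
    by (rule emeasure_subadditive) auto
  finally have "emeasure lborel (E' - ?B) + emeasure lborel N
     \<le> emeasure lborel (E - ?\<sigma> -` G - ?B) + (emeasure lborel (G - ?B) + emeasure lborel N)"
    by (simp add: add_mono add.assoc[symmetric])
  also have "\<dots> \<le> emeasure lborel (E - ?\<sigma> -` G - ?B) + emeasure lborel (?\<sigma> -` G - ?B)"
    by (intro add_mono 1 order_refl)
  also have "\<dots> = emeasure lborel ((E - ?\<sigma> -` G - ?B) \<union> (?\<sigma> -` G - ?B))"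
    by (rule plus_emeasure) auto
  also have "(E - ?\<sigma> -` G - ?B) \<union> (?\<sigma> -` G - ?B) = E - ?B"
    by (auto simp: G)
  finally show "emeasure lborel (E' - ?B) + emeasure lborel {x \<in> ?B - E. ?\<sigma> x \<in> E - ?B} \<le> emeasure lborel (E - ?B)"
    by (simp add: N_def)
  show "E \<subseteq> ball 0 Q \<Longrightarrow> E' \<subseteq> ball 0 Q"
    unfolding E'_def polarize_def G_def[symmetric] by (fastforce simp: G)
qed

lemma exists_ball_measure:
  assumes "0 \<le> m"
  obtains r where "r \<ge> 0" "measure lborel (ball (0::'a::euclidean_space) r) = m"
proof
  let ?v = "unit_ball_vol (real DIM('a))"
  let ?r = "root DIM('a) (m / ?v)"
  show "?r \<ge> 0" using assms by simp
  have "?r ^ DIM('a) = m / ?v" using assms by simp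
  then show "measure lborel (ball (0::'a) ?r) = m"
    using assms by (simp add: content_ball less_imp_neq[OF unit_ball_vol_pos, symmetric])
qed

text \<open>The ball of radius \<open>r\<close> about any point absorbs at most half of the mass
  \<open>m\<close> of \<open>Y\<close>; the rest is at distance at least \<open>r\<close>.\<close>

lemma dist_sq_integral_lower:
  fixes X Y :: "'a::euclidean_space set"
  assumes [measurable]: "X \<in> sets borel" "Y \<in> sets borel"
    and m: "emeasure lborel X \<ge> ennreal m" "emeasure lborel Y \<ge> ennreal m" "m \<ge> 0"
    and r: "r \<ge> 0" "measure lborel (ball (0::'a) r) = m / 2"
  shows "ennreal (m * (r\<^sup>2 * (m / 2))) \<le>
      (\<integral>\<^sup>+x. (\<integral>\<^sup>+y. ennreal ((dist x y)\<^sup>2) * indicator X x * indicator Y y \<partial>lborel) \<partial>lborel)"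
proof -
  have *: "ennreal (r\<^sup>2 * (m / 2)) \<le> (\<integral>\<^sup>+y. ennreal ((dist x y)\<^sup>2) * indicator Y y \<partial>lborel)" for x
  proof -
    have "emeasure lborel (ball x r) = ennreal (m / 2)"
      using r emeasure_lborel_ball_finite[of x r]
      by (subst emeasure_eq_ennreal_measure) (auto simp: content_ball)
    then have "ennreal m \<le> emeasure lborel (Y - ball x r) + ennreal (m / 2)"
      using emeasure_subadditive[of "Y - ball x r" lborel "ball x r"] m(2)
      by (metis (no_types, lifting) Un_Diff_cancel2 assms(2) borel_open dual_order.trans emeasure_mono open_ball sets.Diff sets.Un sets_lborel sup.cobounded1)
    moreover have "ennreal m = ennreal (m / 2) + ennreal (m / 2)"
      using m by (simp add: ennreal_plus[symmetric] del: ennreal_plus)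
    ultimately have Y: "ennreal (m / 2) \<le> emeasure lborel (Y - ball x r)"
      by (simp add: add.commute)
    have "ennreal (r\<^sup>2 * (m / 2)) \<le> ennreal (r\<^sup>2) * emeasure lborel (Y - ball x r)"
      using Y mult_left_mono[OF Y, of "ennreal (r\<^sup>2)"] by (simp add: ennreal_mult'[symmetric])
    also have "\<dots> = (\<integral>\<^sup>+y. ennreal (r\<^sup>2) * indicator (Y - ball x r) y \<partial>lborel)"
      by (simp add: nn_integral_cmult_indicator)
    also have "\<dots> \<le> (\<integral>\<^sup>+y. ennreal ((dist x y)\<^sup>2) * indicator Y y \<partial>lborel)"
      using r by (intro nn_integral_mono) (auto simp: indicator_def intro!: ennreal_leI power_mono)
    finally show ?thesis .
  qed
  have "ennreal (m * (r\<^sup>2 * (m / 2))) \<le> emeasure lborel X * ennreal (r\<^sup>2 * (m / 2))"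
    using m mult_right_mono[OF m(1), of "ennreal (r\<^sup>2 * (m / 2))"] by (simp add: ennreal_mult'[symmetric])
  also have "\<dots> = (\<integral>\<^sup>+x. ennreal (r\<^sup>2 * (m / 2)) * indicator X x \<partial>lborel)"
    by (subst nn_integral_cmult_indicator) (auto simp: mult.commute)
  also have "\<dots> \<le> (\<integral>\<^sup>+x. (\<integral>\<^sup>+y. ennreal ((dist x y)\<^sup>2) * indicator Y y \<partial>lborel) * indicator X x \<partial>lborel)"
    by (intro nn_integral_mono mult_right_mono *) auto
  also have "\<dots> = (\<integral>\<^sup>+x. (\<integral>\<^sup>+y. ennreal ((dist x y)\<^sup>2) * indicator X x * indicator Y y \<partial>lborel) \<partial>lborel)"
    by (intro nn_integral_cong) (simp add: indicator_def)
  finally show ?thesis .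
qed


lemma emeasure_lborel_eq_measure_subset_ball:
  assumes "A \<subseteq> ball (0::'a::euclidean_space) Q"
  shows "emeasure lborel A = ennreal (measure lborel A)"
  using emeasure_bounded_finite[of A] bounded_subset[OF bounded_ball assms]
  by (simp add: emeasure_eq_ennreal_measure less_top[symmetric])

text \<open>Compactness is bypassed. If the mass outside the ball had a positive infimum over
  \<open>S\<close>, a set close enough to the infimum would admit a polarization that stays in
  \<open>S\<close> and falls below it. Once the infimum is zero, continuity of the perimeter under
  small symmetric differences concludes.\<close>

lemma perimeter_ball_le_bounded:
  fixes \<phi> :: "real \<Rightarrow> ennreal" and E :: "'a::euclidean_space set"
  defines "\<kappa> \<equiv> \<lambda>z. \<phi> (norm z)"
  assumes [measurable]: "\<phi> \<in> borel_measurable borel" "E \<in> sets borel"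
    and anti: "\<And>a b. 0 \<le> a \<Longrightarrow> a \<le> b \<Longrightarrow> \<phi> b \<le> \<phi> a"
    and int: "(\<integral>\<^sup>+z. \<kappa> z \<partial>lborel) \<noteq> \<infinity>"
    and EQ: "E \<subseteq> ball 0 Q" "R \<le> Q" "0 < Q"
    and ER: "emeasure lborel E = emeasure lborel (ball (0::'a) R)"
  shows "perimeter \<kappa> (ball 0 R) \<le> perimeter \<kappa> E"
proof -
  have [measurable]: "\<kappa> \<in> borel_measurable borel" by (simp add: \<kappa>_def)
  let ?B = "ball 0 R :: 'a set"
  define S where "S = {E' \<in> sets borel. E' \<subseteq> ball 0 Q \<and> emeasure lborel E' = emeasure lborel ?B \<and> perimeter \<kappa> E' \<le> perimeter \<kappa> E}"
  define m where "m = (\<lambda>E'. measure lborel (E' - ?B))"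
  define M where "M = Inf (m ` S)"
  have ES: "E \<in> S" using EQ ER by (simp add: S_def)
  have bdd: "bdd_below (m ` S)" by (rule bdd_belowI2[where m=0]) (simp add: m_def)
  have M_le: "M \<le> m E'" if "E' \<in> S" for E' unfolding M_def using bdd that by (simp add: cINF_lower)
  have M0: "M \<ge> 0" unfolding M_def by (rule cINF_greatest) (use ES in \<open>auto simp: m_def\<close>)
  have near: "\<exists>E'\<in>S. m E' < M + e" if "e > 0" for e
    using cInf_lessD[of "m ` S" "M + e"] that ES by (auto simp: M_def)
  have sym: "emeasure lborel (E' - ?B) = ennreal (m E')" "emeasure lborel (?B - E') = ennreal (m E')" if "E' \<in> S" for E'
  proof -
    have [measurable]: "E' \<in> sets borel" and Q: "E' \<subseteq> ball 0 Q" using that by (auto simp: S_def)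
    have B: "?B \<subseteq> ball 0 Q" using EQ by auto
    show 1: "emeasure lborel (E' - ?B) = ennreal (m E')"
      unfolding m_def using Q by (intro emeasure_lborel_eq_measure_subset_ball[of _ Q]) auto
    have "emeasure lborel (E' - ?B) + emeasure lborel (E' \<inter> ?B) = emeasure lborel ((E' - ?B) \<union> (E' \<inter> ?B))"
      by (rule plus_emeasure) auto
    also have "(E' - ?B) \<union> (E' \<inter> ?B) = E'" by auto
    also have "emeasure lborel E' = emeasure lborel ?B" using that by (simp add: S_def)
    also have "emeasure lborel ?B = emeasure lborel ((?B - E') \<union> (E' \<inter> ?B))"
      by (rule arg_cong[where f="emeasure lborel"]) auto
    also have "\<dots> = emeasure lborel (?B - E') + emeasure lborel (E' \<inter> ?B)"
      by (rule plus_emeasure[symmetric]) auto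
    finally have "emeasure lborel (?B - E') = emeasure lborel (E' - ?B)"
      using emeasure_lborel_eq_measure_subset_ball[of "E' \<inter> ?B" Q] Q B
      by (metis (no_types, lifting) add.commute ennreal_add_left_cancel ennreal_neq_top infinity_ennreal_def le_infI1)
    then show "emeasure lborel (?B - E') = ennreal (m E')" using 1 by simp
  qed
  have "M = 0"
  proof (rule ccontr)
    assume "M \<noteq> 0"
    then have M: "M > 0" using M0 by simp
    obtain r where r: "r \<ge> 0" "measure lborel (ball (0::'a) r) = M / 2"
      using exists_ball_measure[of "M / 2"] M by auto
    have "r \<noteq> 0" using r M by auto
    then have rp: "r > 0" using r by simp
    define w where "w = measure lborel (ball (0::'a) 1)"
    have w: "w > 0" by (simp add: w_def content_ball)
    have we: "emeasure lborel (ball (0::'a) 1) = ennreal w"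
      unfolding w_def by (rule emeasure_lborel_eq_measure_subset_ball[OF order_refl])
    define c where "c = 1 / ((2 * Q + 1) ^ DIM('a) * (2 * (2 * Q + 1)\<^sup>2))"
    have c: "c > 0" using EQ by (simp add: c_def)
    \<comment> \<open>Half of the gain that averaging forces when both mismatched parts have mass at
      least \<open>M\<close>; the factor two is what makes the contradiction strict.\<close>
    define \<eta> where "\<eta> = c * (M * (r\<^sup>2 * (M / 2))) / (2 * Q * w)"
    have \<eta>: "\<eta> > 0" using c M rp EQ w by (simp add: \<eta>_def)
    obtain E' where E': "E' \<in> S" "m E' < M + \<eta>" using near[OF \<eta>] by blast
    have [measurable]: "E' \<in> sets borel" and Q: "E' \<subseteq> ball 0 Q" using E' by (auto simp: S_def)
    have "\<exists>u h. u \<noteq> 0 \<and> h > 0 \<and> ennreal \<eta> < emeasure lborel {x \<in> ?B - E'. reflection u h x \<in> E' - ?B}"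
    proof (rule ccontr)
      assume "\<not> ?thesis"
      then have le: "emeasure lborel {x \<in> ?B - E'. reflection u h x \<in> E' - ?B} \<le> ennreal \<eta>" if "u \<noteq> 0" "h > 0" for u h
        using that by (meson linorder_not_le)
      have "ennreal c * ennreal (M * (r\<^sup>2 * (M / 2))) \<le> ennreal c *
        (\<integral>\<^sup>+x. (\<integral>\<^sup>+y. ennreal ((dist x y)\<^sup>2) * indicator (?B - E') x * indicator (E' - ?B) y \<partial>lborel) \<partial>lborel)"
        using E' M r M_le[OF E'(1)] by (intro mult_left_mono dist_sq_integral_lower) (auto simp: sym ennreal_leI)
      also have "\<dots> \<le> ennreal \<eta> * ennreal Q * emeasure lborel (ball (0::'a) 1)"
        unfolding c_def using EQ Q by (intro reflection_average_lower le) auto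
      finally have "ennreal (c * (M * (r\<^sup>2 * (M / 2)))) \<le> ennreal (\<eta> * Q * w)"
        using c \<eta> EQ w M by (simp add: we ennreal_mult'[symmetric])
      then have "c * (M * (r\<^sup>2 * (M / 2))) \<le> \<eta> * Q * w"
        using \<eta> EQ w by (simp add: ennreal_le_iff)
      also have "\<dots> = c * (M * (r\<^sup>2 * (M / 2))) / 2"
        using EQ w by (simp add: \<eta>_def)
      finally show False using c M rp by (simp add: mult_le_0_iff)
    qed
    then obtain u h where uh: "u \<noteq> 0" "h > 0" and big: "ennreal \<eta> < emeasure lborel {x \<in> ?B - E'. reflection u h x \<in> E' - ?B}"
      by blast
    interpret polarizer "reflection u h" "{x. x \<bullet> u < h}" by (rule polarizer_reflection[OF uh(1)])
    let ?E = "polarize E'"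
    have "perimeter \<kappa> ?E \<le> perimeter \<kappa> E'"
      using perimeter_polarize[of \<phi> E'] anti int E' emeasure_lborel_eq_measure_subset_ball[OF Q]
      unfolding \<kappa>_def by (metis (no_types, lifting) \<open>E' \<in> sets borel\<close> assms(2) ennreal_neq_top infinity_ennreal_def le_iff_add)
    then have PS: "?E \<in> S"
      using E' emeasure_polarize_diff_ball(2)[OF uh, of E' Q] by (auto simp: S_def emeasure_polarize)
    have "ennreal (m ?E + \<eta>) = emeasure lborel (?E - ?B) + ennreal \<eta>"
      using sym[OF PS] \<eta> by (simp add: m_def)
    also have "\<dots> \<le> emeasure lborel (?E - ?B) + emeasure lborel {x \<in> ?B - E'. reflection u h x \<in> E' - ?B}"
      using big by (intro add_mono) auto
    also have "\<dots> \<le> ennreal (m E')"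
      using emeasure_polarize_diff_ball(1)[OF uh, of E' R] sym[OF E'(1)] by simp
    finally have "m ?E + \<eta> \<le> m E'" by (simp add: m_def)
    then show False using E'(2) M_le[OF PS] by simp
  qed
  define K where "K = enn2real (\<integral>\<^sup>+z. \<kappa> z \<partial>lborel)"
  have K: "(\<integral>\<^sup>+z. \<kappa> z \<partial>lborel) = ennreal K" "K \<ge> 0"
    using int by (simp_all add: K_def less_top)
  show ?thesis
  proof (rule ennreal_le_epsilon)
    fix e :: real assume e: "e > 0"
    then obtain E' where E': "E' \<in> S" "m E' < e / (2 * K + 1)"
      using near[of "e / (2 * K + 1)"] K \<open>M = 0\<close> by auto
    have [measurable]: "E' \<in> sets borel" using E' by (auto simp: S_def)
    have "perimeter \<kappa> ?B \<le> perimeter \<kappa> E' + (emeasure lborel (?B - E') + emeasure lborel (E' - ?B)) * (\<integral>\<^sup>+z. \<kappa> z \<partial>lborel)"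
      by (rule perimeter_le_perimeter_plus_symdiff) (auto simp: \<kappa>_def)
    also have "\<dots> = perimeter \<kappa> E' + ennreal (2 * m E' * K)"
      using K E' by (simp add: sym ennreal_mult' m_def ennreal_plus[symmetric] del: ennreal_plus)
    also have "\<dots> \<le> perimeter \<kappa> E + ennreal e"
    proof (rule add_mono)
      show "perimeter \<kappa> E' \<le> perimeter \<kappa> E" using E' by (simp add: S_def)
      have "2 * m E' * K \<le> m E' * (2 * K + 1)" by (simp add: m_def algebra_simps)
      also have "\<dots> \<le> e" using E' K by (simp add: pos_less_divide_eq less_imp_le)
      finally show "ennreal (2 * m E' * K) \<le> ennreal e" by (rule ennreal_leI)
    qed
    finally show "perimeter \<kappa> ?B \<le> perimeter \<kappa> E + ennreal e" .
  qed
qed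


theorem perimeter_ball_le:
  fixes \<phi> :: "real \<Rightarrow> ennreal" and E :: "'a::euclidean_space set"
  defines "\<kappa> \<equiv> \<lambda>z. \<phi> (norm z)"
  assumes [measurable]: "\<phi> \<in> borel_measurable borel" "E \<in> sets borel"
    and anti: "\<And>a b. 0 \<le> a \<Longrightarrow> a \<le> b \<Longrightarrow> \<phi> b \<le> \<phi> a"
    and int: "(\<integral>\<^sup>+z. \<kappa> z \<partial>lborel) \<noteq> \<infinity>" and R: "R \<ge> 0"
    and ER: "emeasure lborel E = emeasure lborel (ball (0::'a) R)"
  shows "perimeter \<kappa> (ball 0 R) \<le> perimeter \<kappa> E"
proof -
  have [measurable]: "\<kappa> \<in> borel_measurable borel" by (simp add: \<kappa>_def)
  have even: "\<kappa> (- z) = \<kappa> z" for z by (simp add: \<kappa>_def)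
  let ?B = "ball 0 R :: 'a set"
  define K where "K = enn2real (\<integral>\<^sup>+z. \<kappa> z \<partial>lborel)"
  have K: "(\<integral>\<^sup>+z. \<kappa> z \<partial>lborel) = ennreal K" "K \<ge> 0"
    using int by (simp_all add: K_def less_top)
  have fE: "emeasure lborel E \<noteq> \<infinity>"
    using ER emeasure_lborel_ball_finite[of "0::'a" R] by simp
  show ?thesis
  proof (rule ennreal_le_epsilon)
    fix e :: real assume e: "e > 0"
    \<comment> \<open>Truncating \<open>E\<close> and shrinking the ball each cost at most
      \<open>d * K\<close>; the added one keeps the denominator positive.\<close>
    define d where "d = e / (2 * K + 1)"
    have d: "d > 0" using e K by (simp add: d_def)
    have "(\<lambda>j. emeasure lborel (E - ball 0 (real j))) \<longlonglongrightarrow> emeasure lborel (\<Inter>j. E - ball 0 (real j))"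
    proof (rule Lim_emeasure_decseq)
      show "range (\<lambda>j. E - ball 0 (real j)) \<subseteq> sets lborel" by auto
      show "decseq (\<lambda>j. E - ball 0 (real j))" by (auto simp: decseq_def)
      show "emeasure lborel (E - ball 0 (real j)) \<noteq> \<infinity>" for j
        using fE emeasure_mono[of "E - ball 0 (real j)" E lborel] by (auto simp: top_unique)
    qed
    also have "(\<Inter>j. E - ball 0 (real j)) = {}"
    proof -
      have "\<exists>j. norm x < real j" for x :: 'a by (rule reals_Archimedean2)
      then show ?thesis by auto
    qed
    finally have "\<forall>\<^sub>F j in sequentially. emeasure lborel (E - ball 0 (real j)) < ennreal d"
      using d by (intro order_tendstoD(2)) auto
    then obtain j where j: "emeasure lborel (E - ball 0 (real j)) < ennreal d"
      by (auto simp: eventually_sequentially)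
    define F where "F = E \<inter> ball 0 (real j)"
    have [measurable]: "F \<in> sets borel" by (simp add: F_def)
    have FE: "emeasure lborel (E - F) < ennreal d" using j by (simp add: F_def Diff_Int)
    obtain r where r: "r \<ge> 0" "measure lborel (ball (0::'a) r) = measure lborel F"
      using exists_ball_measure[of "measure lborel F"] by auto
    have Fr: "emeasure lborel F = emeasure lborel (ball (0::'a) r)"
      using r emeasure_lborel_eq_measure_subset_ball[of F "real j"]
        emeasure_lborel_eq_measure_subset_ball[of "ball (0::'a) r" r] by (simp add: F_def)
    have "emeasure lborel (ball (0::'a) r) \<le> emeasure lborel (ball (0::'a) R)"
      using ER Fr emeasure_mono[of F E lborel] by (simp add: F_def)
    then have "unit_ball_vol (real DIM('a)) * r ^ DIM('a) \<le> unit_ball_vol (real DIM('a)) * R ^ DIM('a)"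
      using r(1) R by (simp add: emeasure_ball ennreal_le_iff)
    then have rR: "r \<le> R"
      using r(1) R by (simp add: power_mono_iff)
    have "emeasure lborel (?B - ball 0 r) = emeasure lborel ?B - emeasure lborel (ball (0::'a) r)"
      using rR emeasure_lborel_ball_finite[of "0::'a" r] by (intro emeasure_Diff) auto
    also have "\<dots> = emeasure lborel E - emeasure lborel F" using ER Fr by simp
    also have "\<dots> = emeasure lborel (E - F)"
      using fE emeasure_mono[of F E lborel] by (intro emeasure_Diff[symmetric]) (auto simp: F_def top_unique)
    finally have BR: "emeasure lborel (?B - ball 0 r) = emeasure lborel (E - F)" .
    have "perimeter \<kappa> ?B \<le> perimeter \<kappa> (ball 0 r) + (emeasure lborel (?B - ball 0 r) + emeasure lborel (ball 0 r - ?B)) * ennreal K"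
      unfolding K(1)[symmetric] by (rule perimeter_le_perimeter_plus_symdiff) (auto simp: even)
    also have "ball 0 r - ?B = {}" using rR by auto
    also have "perimeter \<kappa> (ball 0 r) \<le> perimeter \<kappa> F"
      unfolding \<kappa>_def
      by (rule perimeter_ball_le_bounded[where Q="real j + r + 1"])
         (use anti int r Fr in \<open>auto simp: F_def \<kappa>_def\<close>)
    also have "perimeter \<kappa> F \<le> perimeter \<kappa> E + (emeasure lborel (F - E) + emeasure lborel (E - F)) * ennreal K"
      unfolding K(1)[symmetric] by (rule perimeter_le_perimeter_plus_symdiff) (auto simp: even)
    also have "F - E = {}" by (auto simp: F_def)
    finally have "perimeter \<kappa> ?B \<le> perimeter \<kappa> E + (emeasure lborel (E - F) * ennreal K + emeasure lborel (E - F) * ennreal K)"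
      by (simp add: BR add_mono ac_simps)
    also have "\<dots> \<le> perimeter \<kappa> E + (ennreal d * ennreal K + ennreal d * ennreal K)"
      using FE by (intro add_mono mult_right_mono order_refl) auto
    also have "ennreal d * ennreal K + ennreal d * ennreal K = ennreal (d * (2 * K))"
      using d K by (simp add: ennreal_mult'[symmetric] ennreal_plus[symmetric] del: ennreal_plus)
    also have "\<dots> \<le> ennreal e"
      using e K by (intro ennreal_leI) (simp add: d_def field_simps)
    finally show "perimeter \<kappa> ?B \<le> perimeter \<kappa> E + ennreal e" by simp
  qed
qed

section \<open>The Riesz kernel\<close>

text \<open>Dyadic shells stand in for polar coordinates: where
  \<open>2 powr - (j + 1) < norm z\<close> and \<open>norm z \<le> 2 powr - j\<close>, the integrand
  is at most \<open>2 powr (a * (j + 1))\<close>. With the volumes of the balls this gives a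
  geometric series of ratio \<open>2 powr (a - n)\<close>, where \<open>n\<close> is the
  dimension.\<close>

lemma nn_integral_norm_powr_cball_unit:
  assumes a: "0 \<le> a" "a < real DIM('a)"
  shows "(\<integral>\<^sup>+z\<in>cball 0 1. ennreal (norm (z::'a::euclidean_space) powr - a) \<partial>lborel) < \<infinity>"
proof -
  define v where "v = unit_ball_vol (real DIM('a))"
  have v: "v \<ge> 0" by (simp add: v_def)
  define q where "q = 2 powr (a - real DIM('a))"
  have q: "0 \<le> q" "q < 1" using a powr_less_mono[of _ 0 "2::real"] by (auto simp: q_def)
  define g :: "nat \<Rightarrow> 'a \<Rightarrow> ennreal" where "g = (\<lambda>j z. ennreal (2 powr (a * (real j + 1))) * indicator (cball 0 (2 powr - real j)) z)"
  have [measurable]: "g j \<in> borel_measurable borel" for j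
    unfolding g_def by (intro borel_measurable_times_ennreal borel_measurable_const borel_measurable_indicator borel_closed) simp
  have le: "ennreal (norm z powr - a) * indicator (cball 0 1) z \<le> (\<Sum>j. g j z)" for z :: 'a
  proof (cases "z = 0 \<or> norm z > 1")
    case False
    define t where "t = - log 2 (norm z)"
    have z: "norm z = 2 powr - t" using False by (simp add: t_def)
    have "t \<ge> 0" using False by (simp add: t_def)
    define j where "j = nat \<lfloor>t\<rfloor>"
    have j: "real j \<le> t" "t < real j + 1"
      using \<open>t \<ge> 0\<close> by (auto simp: j_def)
    have "norm z powr - a = 2 powr (a * t)" by (simp add: z powr_powr mult.commute)
    also have "\<dots> \<le> 2 powr (a * (real j + 1))"
      using j a by (intro powr_mono mult_left_mono) auto
    finally have "ennreal (norm z powr - a) * indicator (cball 0 1) z \<le> g j z"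
      using z j by (simp add: g_def indicator_def ennreal_leI)
    also have "\<dots> \<le> (\<Sum>j. g j z)"
      using sum_le_suminf[of "\<lambda>j. g j z" "{j}"] by simp
    finally show ?thesis .
  qed (auto simp: indicator_def)
  have gi: "(\<integral>\<^sup>+z. g j z \<partial>lborel) = ennreal (2 powr a * v * q ^ j)" for j
  proof -
    have "(\<integral>\<^sup>+z. g j z \<partial>lborel) = ennreal (2 powr (a * (real j + 1))) * ennreal (v * (2 powr - real j) ^ DIM('a))"
      unfolding g_def by (subst nn_integral_cmult_indicator) (auto simp: emeasure_cball v_def)
    also have "\<dots> = ennreal (2 powr (a * (real j + 1)) * (v * (2 powr - real j) ^ DIM('a)))"
      using v by (simp add: ennreal_mult')
    also have "2 powr (a * (real j + 1)) * (v * (2 powr - real j) ^ DIM('a)) = 2 powr a * v * q ^ j"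
      by (simp add: q_def powr_power powr_add[symmetric] algebra_simps)
    finally show ?thesis .
  qed
  have "(\<integral>\<^sup>+z\<in>cball 0 1. ennreal (norm (z::'a) powr - a) \<partial>lborel) \<le> (\<integral>\<^sup>+z. (\<Sum>j. g j z) \<partial>lborel)"
    by (intro nn_integral_mono le)
  also have "\<dots> = (\<Sum>j. \<integral>\<^sup>+z. g j z \<partial>lborel)"
    by (rule nn_integral_suminf) measurable
  also have "\<dots> = ennreal (\<Sum>j. 2 powr a * v * q ^ j)"
    unfolding gi using q v by (intro suminf_ennreal2) (auto intro!: summable_mult summable_geometric)
  also have "\<dots> < \<infinity>" by simp
  finally show ?thesis .
qed

lemma nn_integral_norm_powr_outside_unit:
  assumes a: "real DIM('a) < a"
  shows "(\<integral>\<^sup>+z\<in>- cball 0 1. ennreal (norm (z::'a::euclidean_space) powr - a) \<partial>lborel) < \<infinity>"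
proof -
  define v where "v = unit_ball_vol (real DIM('a))"
  have v: "v \<ge> 0" by (simp add: v_def)
  define q where "q = 2 powr (real DIM('a) - a)"
  have q: "0 \<le> q" "q < 1" using a powr_less_mono[of _ 0 "2::real"] by (auto simp: q_def)
  define g :: "nat \<Rightarrow> 'a \<Rightarrow> ennreal" where "g = (\<lambda>j z. ennreal (2 powr (- a * real j)) * indicator (cball 0 (2 powr (real j + 1))) z)"
  have [measurable]: "g j \<in> borel_measurable borel" for j
    unfolding g_def by (intro borel_measurable_times_ennreal borel_measurable_const borel_measurable_indicator borel_closed) simp
  have le: "ennreal (norm z powr - a) * indicator (- cball 0 1) z \<le> (\<Sum>j. g j z)" for z :: 'a
  proof (cases "norm z > 1")
    case True
    define t where "t = log 2 (norm z)"
    have "norm z > 0" using True by linarith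
    then have z: "norm z = 2 powr t" by (simp add: t_def)
    have "t \<ge> 0" using True \<open>norm z > 0\<close> by (simp add: t_def zero_le_log_cancel_iff)
    define j where "j = nat \<lfloor>t\<rfloor>"
    have j: "real j \<le> t" "t < real j + 1"
      using \<open>t \<ge> 0\<close> by (auto simp: j_def)
    have "norm z powr - a = 2 powr (- a * t)" by (simp add: z powr_powr mult.commute)
    also have "\<dots> \<le> 2 powr (- a * real j)"
      using j a by (intro powr_mono mult_left_mono_neg) auto
    finally have "ennreal (norm z powr - a) * indicator (- cball 0 1) z \<le> g j z"
      using z j by (simp add: g_def indicator_def ennreal_leI)
    also have "\<dots> \<le> (\<Sum>j. g j z)"
      using sum_le_suminf[of "\<lambda>j. g j z" "{j}"] by simp
    finally show ?thesis .
  qed (auto simp: indicator_def)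
  have gi: "(\<integral>\<^sup>+z. g j z \<partial>lborel) = ennreal (2 powr real DIM('a) * v * q ^ j)" for j
  proof -
    have "(\<integral>\<^sup>+z. g j z \<partial>lborel) = ennreal (2 powr (- a * real j)) * ennreal (v * (2 powr (real j + 1)) ^ DIM('a))"
      unfolding g_def by (subst nn_integral_cmult_indicator) (auto simp: emeasure_cball v_def)
    also have "\<dots> = ennreal (2 powr (- a * real j) * (v * (2 powr (real j + 1)) ^ DIM('a)))"
      using v by (simp add: ennreal_mult')
    also have "2 powr (- a * real j) * (v * (2 powr (real j + 1)) ^ DIM('a)) = 2 powr real DIM('a) * v * q ^ j"
      by (simp add: q_def powr_power powr_add[symmetric] algebra_simps)
    finally show ?thesis .
  qed
  have "(\<integral>\<^sup>+z\<in>- cball 0 1. ennreal (norm (z::'a) powr - a) \<partial>lborel) \<le> (\<integral>\<^sup>+z. (\<Sum>j. g j z) \<partial>lborel)"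
    by (intro nn_integral_mono le)
  also have "\<dots> = (\<Sum>j. \<integral>\<^sup>+z. g j z \<partial>lborel)"
    by (rule nn_integral_suminf) measurable
  also have "\<dots> = ennreal (\<Sum>j. 2 powr real DIM('a) * v * q ^ j)"
    unfolding gi using q v by (intro suminf_ennreal2) (auto intro!: summable_mult summable_geometric)
  also have "\<dots> < \<infinity>" by simp
  finally show ?thesis .
qed

text \<open>The value at the origin is infinite, as in \<open>per_kernel\<close>;
  \<open>powr\<close> alone would give \<open>0\<close> there, and the approximation from below by
  positive kernels would fail.\<close>

definition riesz_kernel :: "real \<Rightarrow> 'a::euclidean_space \<Rightarrow> ennreal" where
  "riesz_kernel s z = (if norm z = 0 then \<infinity> else ennreal (norm z powr - (real DIM('a) + s)))"

text \<open>The type argument only carries the dimension, as the profile is a function of one real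
  variable. For positive \<open>\<epsilon>\<close> it is bounded and decreasing, so the results on
  polarization apply, and it increases to the Riesz kernel as \<open>\<epsilon>\<close> tends to
  0.\<close>

definition reg_profile :: "'a::euclidean_space itself \<Rightarrow> real \<Rightarrow> real \<Rightarrow> real \<Rightarrow> ennreal" where
  "reg_profile _ s \<epsilon> t = ennreal ((t\<^sup>2 + \<epsilon>) powr - ((real DIM('a) + s) / 2))"

definition reg_kernel :: "real \<Rightarrow> real \<Rightarrow> 'a::euclidean_space \<Rightarrow> ennreal" where
  "reg_kernel s \<epsilon> z = reg_profile TYPE('a) s \<epsilon> (norm z)"

lemma riesz_kernel_measurable[measurable]: "riesz_kernel s \<in> borel_measurable borel"
  unfolding riesz_kernel_def by measurable

lemma reg_profile_measurable[measurable]: "reg_profile T s \<epsilon> \<in> borel_measurable borel"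
  unfolding reg_profile_def by measurable

lemma reg_kernel_measurable[measurable]: "reg_kernel s \<epsilon> \<in> borel_measurable borel"
  unfolding reg_kernel_def by measurable

lemma riesz_kernel_minus[simp]: "riesz_kernel s (- z) = riesz_kernel s z"
  by (simp add: riesz_kernel_def)

lemma reg_profile_antimono:
  fixes T :: "'a::euclidean_space itself"
  assumes "s > 0" "\<epsilon> > 0" "0 \<le> a" "a \<le> b"
  shows "reg_profile T s \<epsilon> b \<le> reg_profile T s \<epsilon> a"
  unfolding reg_profile_def using assms
  by (intro ennreal_leI powr_mono2') (auto intro: power_mono add_nonneg_pos)

lemma norm_sq_powr: "((norm z)\<^sup>2) powr - (a / 2) = norm z powr - a"
proof (cases "z = 0")
  case False
  then have "(norm z)\<^sup>2 = norm z powr 2" by simp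
  then show ?thesis by (simp only: powr_powr) simp
qed simp

lemma reg_kernel_le_riesz:
  assumes "s > 0" "\<epsilon> > 0"
  shows "reg_kernel s \<epsilon> (z::'a::euclidean_space) \<le> riesz_kernel s z"
proof (cases "z = 0")
  case False
  have "((norm z)\<^sup>2 + \<epsilon>) powr - ((real DIM('a) + s) / 2) \<le> ((norm z)\<^sup>2) powr - ((real DIM('a) + s) / 2)"
    using assms False by (intro powr_mono2') auto
  also have "\<dots> = norm z powr - (real DIM('a) + s)"
    using False by (simp add: norm_sq_powr)
  finally show ?thesis using False
    by (simp add: reg_kernel_def reg_profile_def riesz_kernel_def ennreal_leI)
qed (simp add: riesz_kernel_def)

lemma reg_kernel_antimono:
  assumes "s > 0" "0 < \<epsilon>" "\<epsilon> \<le> \<epsilon>'"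
  shows "reg_kernel s \<epsilon>' (z::'a::euclidean_space) \<le> reg_kernel s \<epsilon> z"
  unfolding reg_kernel_def reg_profile_def using assms
  by (intro ennreal_leI powr_mono2') (auto intro: add_nonneg_pos)

lemma SUP_reg_kernel:
  assumes s: "s > 0"
  shows "(SUP j. reg_kernel s (1 / real (Suc j)) z) = riesz_kernel s (z::'a::euclidean_space)"
proof (rule LIMSEQ_unique[OF LIMSEQ_SUP])
  let ?p = "(real DIM('a) + s) / 2"
  show "incseq (\<lambda>j. reg_kernel s (1 / real (Suc j)) z)"
    unfolding incseq_def using s by (auto intro!: reg_kernel_antimono divide_left_mono)
  have lim0: "(\<lambda>j. (norm z)\<^sup>2 + 1 / real (Suc j)) \<longlonglongrightarrow> (norm z)\<^sup>2 + 0"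
    by (intro tendsto_add tendsto_const LIMSEQ_Suc[OF lim_1_over_n])
  show "(\<lambda>j. reg_kernel s (1 / real (Suc j)) z) \<longlonglongrightarrow> riesz_kernel s z"
  proof (cases "z = 0")
    case False
    have "(\<lambda>j. ((norm z)\<^sup>2 + 1 / real (Suc j)) powr - ?p) \<longlonglongrightarrow> ((norm z)\<^sup>2 + 0) powr - ?p"
      using False by (intro tendsto_powr lim0 tendsto_const) auto
    also have "((norm z)\<^sup>2 + 0) powr - ?p = norm z powr - (real DIM('a) + s)"
      using False by (simp add: norm_sq_powr)
    finally show ?thesis using False
      unfolding reg_kernel_def reg_profile_def riesz_kernel_def by (auto intro: tendsto_ennrealI)
  next
    case True
    have "reg_kernel s (1 / real (Suc j)) z = ennreal (real (Suc j) powr ?p)" for j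
      by (simp add: True reg_kernel_def reg_profile_def powr_minus powr_divide)
    moreover have "filterlim (\<lambda>j. real (Suc j) powr ?p) at_top sequentially"
    proof -
      have "filterlim (\<lambda>j. exp (?p * ln (real (Suc j)))) at_top sequentially"
      proof (rule filterlim_compose[OF exp_at_top])
        show "filterlim (\<lambda>j. ?p * ln (real (Suc j))) at_top sequentially"
        proof (rule filterlim_tendsto_pos_mult_at_top[OF tendsto_const])
          show "0 < ?p" using s by (simp add: add_nonneg_pos)
          show "filterlim (\<lambda>j. ln (real (Suc j))) at_top sequentially"
            by (rule filterlim_compose[OF ln_at_top filterlim_compose[OF filterlim_real_sequentially filterlim_Suc]])
        qed
      qed
      then show ?thesis by (simp add: powr_def)
    qed
    ultimately show ?thesis
      using True by (simp add: riesz_kernel_def ennreal_tendsto_top_eq_at_top)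
  qed
qed

text \<open>The factor \<open>min (norm z) 1\<close> lowers the order of the singularity to
  \<open>n + s - 1\<close>, which is below the dimension \<open>n\<close> because
  \<open>s < 1\<close>; at infinity the decay of order \<open>n + s\<close> is integrable because
  \<open>s > 0\<close>.\<close>

lemma riesz_kernel_min_integrable:
  assumes "0 < s" "s < 1"
  shows "(\<integral>\<^sup>+z. ennreal (min (norm z) 1) * riesz_kernel s (z::'a::euclidean_space) \<partial>lborel) < \<infinity>"
proof -
  have [measurable]: "cball (0::'a) 1 \<in> sets borel" by (rule borel_closed) simp
  have "(\<integral>\<^sup>+z. ennreal (min (norm z) 1) * riesz_kernel s (z::'a) \<partial>lborel)
    \<le> (\<integral>\<^sup>+z. ennreal (norm (z::'a) powr - (real DIM('a) + s - 1)) * indicator (cball 0 1) z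
        + ennreal (norm z powr - (real DIM('a) + s)) * indicator (- cball 0 1) z \<partial>lborel)"
  proof (rule nn_integral_mono)
    fix z :: 'a
    have "norm z * norm z powr - (real DIM('a) + s) = norm z powr - (real DIM('a) + s - 1)" if "z \<noteq> 0"
    proof -
      have "norm z * norm z powr - (real DIM('a) + s) = norm z powr 1 * norm z powr - (real DIM('a) + s)"
        using that by simp
      also have "\<dots> = norm z powr (1 + - (real DIM('a) + s))" by (rule powr_add[symmetric])
      finally show ?thesis by (simp add: algebra_simps)
    qed
    then show "ennreal (min (norm z) 1) * riesz_kernel s z
      \<le> ennreal (norm z powr - (real DIM('a) + s - 1)) * indicator (cball 0 1) z
        + ennreal (norm z powr - (real DIM('a) + s)) * indicator (- cball 0 1) z"
      by (auto simp: riesz_kernel_def indicator_def min_def ennreal_mult'[symmetric])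
  qed
  also have "\<dots> = (\<integral>\<^sup>+z\<in>cball 0 1. ennreal (norm (z::'a) powr - (real DIM('a) + s - 1)) \<partial>lborel)
     + (\<integral>\<^sup>+z\<in>- cball 0 1. ennreal (norm (z::'a) powr - (real DIM('a) + s)) \<partial>lborel)"
    by (rule nn_integral_add) measurable
  also have "\<dots> < \<infinity>"
    using nn_integral_norm_powr_cball_unit[where 'a='a, of "real DIM('a) + s - 1"]
      nn_integral_norm_powr_outside_unit[where 'a='a, of "real DIM('a) + s"] assms DIM_positive[where 'a='a]
    by (simp add: ennreal_add_eq_top less_top)
  finally show ?thesis .
qed

lemma reg_kernel_integrable:
  assumes s: "0 < s" "s < 1" and e: "\<epsilon> > 0"
  shows "(\<integral>\<^sup>+z. reg_kernel s \<epsilon> (z::'a::euclidean_space) \<partial>lborel) < \<infinity>"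
proof -
  have [measurable]: "cball (0::'a) 1 \<in> sets borel" by (rule borel_closed) simp
  let ?M = "ennreal (\<epsilon> powr - ((real DIM('a) + s) / 2))"
  have "(\<integral>\<^sup>+z. reg_kernel s \<epsilon> (z::'a) \<partial>lborel)
    \<le> (\<integral>\<^sup>+z. ?M * indicator (cball 0 1) z + ennreal (min (norm z) 1) * riesz_kernel s (z::'a) \<partial>lborel)"
  proof (rule nn_integral_mono)
    fix z :: 'a
    show "reg_kernel s \<epsilon> z \<le> ?M * indicator (cball 0 1) z + ennreal (min (norm z) 1) * riesz_kernel s z"
    proof (cases "norm z \<le> 1")
      case True
      have "reg_kernel s \<epsilon> z \<le> ?M"
        unfolding reg_kernel_def reg_profile_def using s e by (intro ennreal_leI powr_mono2') auto
      then show ?thesis using True by (simp add: add_increasing2)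
    next
      case False
      then show ?thesis using reg_kernel_le_riesz[OF s(1) e, of z] by (simp add: add_increasing)
    qed
  qed
  also have "\<dots> = ?M * emeasure lborel (cball (0::'a) 1) + (\<integral>\<^sup>+z. ennreal (min (norm z) 1) * riesz_kernel s (z::'a) \<partial>lborel)"
    by (subst nn_integral_add) (measurable, simp add: nn_integral_cmult_indicator)
  also have "\<dots> < \<infinity>"
    using riesz_kernel_min_integrable[OF s, where 'a='a] by (simp add: ennreal_mult_less_top emeasure_cball)
  finally show ?thesis .
qed

lemma perimeter_riesz_SUP:
  fixes E :: "'a::euclidean_space set"
  assumes s: "s > 0" and [measurable]: "E \<in> sets borel"
  shows "perimeter (riesz_kernel s) E = (SUP j. perimeter (reg_kernel s (1 / real (Suc j))) E)"
proof -
  have inc: "reg_kernel s (1 / real (Suc i)) z \<le> reg_kernel s (1 / real (Suc j)) z" if "i \<le> j" for i j and z :: 'a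
    using s that by (auto intro!: reg_kernel_antimono divide_left_mono)
  let ?f = "\<lambda>j x y. reg_kernel s (1 / real (Suc j)) (x - y) * indicator E x * indicator (- E) y"
  have "perimeter (riesz_kernel s) E = (\<integral>\<^sup>+x. (\<integral>\<^sup>+y. (SUP j. ?f j x y) \<partial>lborel) \<partial>lborel)"
    unfolding perimeter_def interaction_def
    by (intro nn_integral_cong) (simp add: SUP_reg_kernel[OF s, symmetric] SUP_mult_right_ennreal)
  also have "\<dots> = (\<integral>\<^sup>+x. (SUP j. (\<integral>\<^sup>+y. ?f j x y \<partial>lborel)) \<partial>lborel)"
  proof (intro nn_integral_cong nn_integral_monotone_convergence_SUP)
    show "incseq (\<lambda>j y. ?f j x y)" for x
      unfolding incseq_def le_fun_def by (intro allI impI mult_right_mono inc) simp_all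
  qed measurable
  also have "\<dots> = (SUP j. (\<integral>\<^sup>+x. (\<integral>\<^sup>+y. ?f j x y \<partial>lborel) \<partial>lborel))"
  proof (intro nn_integral_monotone_convergence_SUP)
    show "incseq (\<lambda>j x. (\<integral>\<^sup>+y. ?f j x y \<partial>lborel))"
      unfolding incseq_def le_fun_def by (intro allI impI nn_integral_mono mult_right_mono inc) simp_all
  qed measurable
  finally show ?thesis by (simp add: perimeter_def interaction_def)
qed

lemma perimeter_reg_ball_le:
  fixes E :: "'a::euclidean_space set"
  assumes s: "0 < s" "s < 1" and e: "\<epsilon> > 0" and "E \<in> sets borel" "R \<ge> 0"
    and "emeasure lborel E = emeasure lborel (ball (0::'a) R)"
  shows "perimeter (reg_kernel s \<epsilon>) (ball (0::'a) R) \<le> perimeter (reg_kernel s \<epsilon>) E"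
proof -
  have "(\<integral>\<^sup>+z. reg_profile TYPE('a) s \<epsilon> (norm (z::'a)) \<partial>lborel) \<noteq> \<infinity>"
    using reg_kernel_integrable[OF s e, where 'a='a] by (simp add: reg_kernel_def[abs_def])
  then show ?thesis
    unfolding reg_kernel_def[abs_def]
    by (intro perimeter_ball_le reg_profile_measurable reg_profile_antimono[OF s(1) e] assms(4-))
qed

theorem perimeter_riesz_ball_le:
  fixes E :: "'a::euclidean_space set"
  assumes s: "0 < s" "s < 1" and E: "E \<in> sets borel" "R \<ge> 0"
    "emeasure lborel E = emeasure lborel (ball (0::'a) R)"
  shows "perimeter (riesz_kernel s) (ball (0::'a) R) \<le> perimeter (riesz_kernel s) E"
proof -
  have "perimeter (riesz_kernel s) (ball (0::'a) R) = (SUP j. perimeter (reg_kernel s (1 / real (Suc j))) (ball (0::'a) R))"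
    by (rule perimeter_riesz_SUP) (use s in auto)
  also have "\<dots> \<le> (SUP j. perimeter (reg_kernel s (1 / real (Suc j))) E)"
    using perimeter_reg_ball_le[OF s _ E] by (intro SUP_mono') auto
  also have "\<dots> = perimeter (riesz_kernel s) E"
    by (rule perimeter_riesz_SUP[symmetric]) (use s E in auto)
  finally show ?thesis .
qed

text \<open>The points in question lie in the shell of width \<open>norm z\<close> inside the unit
  sphere, whose volume Bernoulli's inequality makes linear in \<open>norm z\<close>. For larger
  \<open>z\<close> the volume of the whole ball is enough.\<close>

lemma emeasure_ball_diff_translate:
  fixes z :: "'a::euclidean_space"
  shows "emeasure lborel {x \<in> ball 0 1. x - z \<notin> ball 0 1} \<le> ennreal (unit_ball_vol (real DIM('a)) * real DIM('a) * min (norm z) 1)"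
proof (cases "norm z \<le> 1")
  case True
  let ?v = "unit_ball_vol (real DIM('a))"
  have "emeasure lborel {x \<in> ball 0 1. x - z \<notin> ball 0 1} \<le> emeasure lborel (ball (0::'a) 1 - ball 0 (1 - norm z))"
  proof (rule emeasure_mono)
    show "{x \<in> ball 0 1. x - z \<notin> ball 0 1} \<subseteq> ball (0::'a) 1 - ball 0 (1 - norm z)"
      using norm_triangle_ineq4 by (auto simp: not_less) (smt (verit) norm_triangle_ineq4)
  qed auto
  also have "\<dots> = emeasure lborel (ball (0::'a) 1) - emeasure lborel (ball (0::'a) (1 - norm z))"
    using emeasure_lborel_ball_finite[of "0::'a" "1 - norm z"] by (intro emeasure_Diff) (auto intro!: subset_ball)
  also have "\<dots> = ennreal (?v * 1 ^ DIM('a) - ?v * (1 - norm z) ^ DIM('a))"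
    using True by (simp add: emeasure_ball ennreal_minus)
  also have "\<dots> \<le> ennreal (?v * real DIM('a) * min (norm z) 1)"
  proof (rule ennreal_leI)
    have "1 + real DIM('a) * (- norm z) \<le> (1 + - norm z) ^ DIM('a)"
      using True by (intro Bernoulli_inequality) simp
    then have "?v * (1 - (1 - norm z) ^ DIM('a)) \<le> ?v * (real DIM('a) * norm z)"
      by (intro mult_left_mono) auto
    then show "?v * 1 ^ DIM('a) - ?v * (1 - norm z) ^ DIM('a) \<le> ?v * real DIM('a) * min (norm z) 1"
      using True by (simp add: algebra_simps)
  qed
  finally show ?thesis .
next
  case False
  have "emeasure lborel {x \<in> ball 0 1. x - z \<notin> ball 0 1} \<le> emeasure lborel (ball (0::'a) 1)"
    by (rule emeasure_mono) auto
  also have "\<dots> \<le> ennreal (unit_ball_vol (real DIM('a)) * real DIM('a) * min (norm z) 1)"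
    using False DIM_positive[where 'a='a] unfolding emeasure_ball[OF zero_le_one]
    by (intro ennreal_leI) (simp add: Suc_le_eq[symmetric])
  finally show ?thesis .
qed

text \<open>With \<open>z = x - y\<close> as a variable, the perimeter is the kernel integrated
  against the volume of the points of the ball that translation by \<open>- z\<close> takes outside.
  That volume is at most a multiple of \<open>min (norm z) 1\<close>, which tames the
  singularity.\<close>

lemma perimeter_riesz_ball_finite:
  assumes s: "0 < s" "s < 1"
  shows "perimeter (riesz_kernel s) (ball (0::'a::euclidean_space) 1) < \<infinity>"
proof -
  let ?B = "ball 0 1 :: 'a set" and ?v = "unit_ball_vol (real DIM('a)) * real DIM('a)"
  define b where "b = (indicator ?B :: 'a \<Rightarrow> ennreal)"
  define b' where "b' = (indicator (- ?B) :: 'a \<Rightarrow> ennreal)"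
  have [measurable]: "b \<in> borel_measurable borel" "b' \<in> borel_measurable borel"
    unfolding b_def b'_def by (auto intro!: borel_measurable_indicator)
  have "perimeter (riesz_kernel s) ?B = (\<integral>\<^sup>+x. (\<integral>\<^sup>+y. riesz_kernel s (x - y) * b x * b' y \<partial>lborel) \<partial>lborel)"
    by (simp add: perimeter_def interaction_def b_def b'_def)
  also have "\<dots> = (\<integral>\<^sup>+x. (\<integral>\<^sup>+z. riesz_kernel s z * b x * b' (x - z) \<partial>lborel) \<partial>lborel)"
  proof (rule nn_integral_cong)
    fix x
    show "(\<integral>\<^sup>+y. riesz_kernel s (x - y) * b x * b' y \<partial>lborel) = (\<integral>\<^sup>+z. riesz_kernel s z * b x * b' (x - z) \<partial>lborel)"
      using nn_integral_lborel_diff(1)[of "\<lambda>z. riesz_kernel s z * b x * b' (x - z)" x] by simp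
  qed
  also have "\<dots> = (\<integral>\<^sup>+z. (\<integral>\<^sup>+x. riesz_kernel s z * b x * b' (x - z) \<partial>lborel) \<partial>lborel)"
    by (rule nn_integral_lborel_swap) measurable
  also have "\<dots> = (\<integral>\<^sup>+z. riesz_kernel s z * emeasure lborel {x \<in> ?B. x - z \<notin> ?B} \<partial>lborel)"
  proof (rule nn_integral_cong)
    fix z :: 'a
    have "(\<integral>\<^sup>+x. riesz_kernel s z * b x * b' (x - z) \<partial>lborel)
        = (\<integral>\<^sup>+x. riesz_kernel s z * indicator {x \<in> ?B. x - z \<notin> ?B} x \<partial>lborel)"
      by (intro nn_integral_cong) (auto simp: b_def b'_def indicator_def)
    also have "\<dots> = riesz_kernel s z * emeasure lborel {x \<in> ?B. x - z \<notin> ?B}"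
    proof (rule nn_integral_cmult_indicator)
      have "{x \<in> ?B. x - z \<notin> ?B} = ?B \<inter> - ball z 1" by (auto simp: dist_norm norm_minus_commute)
      then show "{x \<in> ?B. x - z \<notin> ?B} \<in> sets lborel" by auto
    qed
    finally show "(\<integral>\<^sup>+x. riesz_kernel s z * b x * b' (x - z) \<partial>lborel) = riesz_kernel s z * emeasure lborel {x \<in> ?B. x - z \<notin> ?B}" .
  qed
  also have "\<dots> \<le> (\<integral>\<^sup>+z. riesz_kernel s z * ennreal (?v * min (norm (z::'a)) 1) \<partial>lborel)"
    by (intro nn_integral_mono mult_left_mono emeasure_ball_diff_translate) auto
  also have "\<dots> = (\<integral>\<^sup>+z. ennreal ?v * (ennreal (min (norm (z::'a)) 1) * riesz_kernel s z) \<partial>lborel)"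
    by (intro nn_integral_cong) (simp add: ennreal_mult' ac_simps)
  also have "\<dots> = ennreal ?v * (\<integral>\<^sup>+z. (ennreal (min (norm (z::'a)) 1) * riesz_kernel s z) \<partial>lborel)"
    by (rule nn_integral_cmult) measurable
  also have "\<dots> < \<infinity>"
    using riesz_kernel_min_integrable[OF s, where 'a='a] by (simp add: ennreal_mult_less_top)
  finally show ?thesis .
qed

lemma riesz_kernel_scaleR:
  assumes "c > 0"
  shows "riesz_kernel s (c *\<^sub>R z) = ennreal (c powr - (real DIM('a) + s)) * riesz_kernel s (z::'a::euclidean_space)"
  using assms by (auto simp: riesz_kernel_def ennreal_mult'[symmetric] powr_mult ennreal_mult_top)

text \<open>The two changes of variables contribute twice the dimension to the exponent of
  \<open>c\<close>, and the kernel takes away \<open>n + s\<close>; energies are thus homogeneous of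
  degree \<open>n - s\<close>.\<close>

lemma interaction_riesz_scaleR:
  fixes U V :: "'a::euclidean_space set"
  assumes c: "c > 0" and [measurable]: "U \<in> sets borel" "V \<in> sets borel"
  shows "interaction (riesz_kernel s) ((\<lambda>x. c *\<^sub>R x) -` U) ((\<lambda>x. c *\<^sub>R x) -` V)
    = ennreal (c powr (s - real DIM('a))) * interaction (riesz_kernel s) U V"
proof -
  let ?d = "real DIM('a)"
  let ?f = "\<lambda>x y. riesz_kernel s (x - y) * indicator U x * indicator V y"
  let ?I = "\<lambda>f. (\<integral>\<^sup>+x. (\<integral>\<^sup>+y. f x y \<partial>lborel) \<partial>lborel) :: ennreal"
  have "interaction (riesz_kernel s) U V = (\<integral>\<^sup>+x. ennreal (c ^ DIM('a)) * (\<integral>\<^sup>+y. ?f x (c *\<^sub>R y) \<partial>lborel) \<partial>lborel)"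
    unfolding interaction_def using c by (intro nn_integral_cong) (subst nn_integral_lborel_scaleR[where c=c], auto)
  also have "\<dots> = ennreal (c ^ DIM('a)) * (\<integral>\<^sup>+x. (\<integral>\<^sup>+y. ?f x (c *\<^sub>R y) \<partial>lborel) \<partial>lborel)"
    by (rule nn_integral_cmult) measurable
  also have "(\<integral>\<^sup>+x. (\<integral>\<^sup>+y. ?f x (c *\<^sub>R y) \<partial>lborel) \<partial>lborel)
      = ennreal (c ^ DIM('a)) * (\<integral>\<^sup>+x. (\<integral>\<^sup>+y. ?f (c *\<^sub>R x) (c *\<^sub>R y) \<partial>lborel) \<partial>lborel)"
    using c by (subst nn_integral_lborel_scaleR[where c=c]) auto
  also have "?I (\<lambda>x y. ?f (c *\<^sub>R x) (c *\<^sub>R y)) = ?I (\<lambda>x y. ennreal (c powr - (?d + s)) *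
       (riesz_kernel s (x - y) * indicator ((\<lambda>x. c *\<^sub>R x) -` U) x * indicator ((\<lambda>x. c *\<^sub>R x) -` V) y))"
    using c by (intro nn_integral_cong) (simp add: scaleR_diff_right[symmetric] riesz_kernel_scaleR indicator_def)
  also have "\<dots> = ennreal (c powr - (?d + s)) * interaction (riesz_kernel s) ((\<lambda>x. c *\<^sub>R x) -` U) ((\<lambda>x. c *\<^sub>R x) -` V)"
    unfolding interaction_def by (simp add: nn_integral_cmult)
  finally have "ennreal (c powr (s - ?d)) * interaction (riesz_kernel s) U V =
     ennreal (c powr (s - ?d) * (c ^ DIM('a) * (c ^ DIM('a) * c powr - (?d + s)))) *
       interaction (riesz_kernel s) ((\<lambda>x. c *\<^sub>R x) -` U) ((\<lambda>x. c *\<^sub>R x) -` V)"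
    using c by (simp add: ennreal_mult' mult.assoc)
  also have "c powr (s - ?d) * (c ^ DIM('a) * (c ^ DIM('a) * c powr - (?d + s))) = 1"
  proof -
    have "c ^ DIM('a) = c powr ?d" using c by (simp add: powr_realpow)
    then show ?thesis using c by (simp only: powr_add[symmetric]) simp
  qed
  finally show ?thesis by simp
qed

lemma perimeter_riesz_scaleR:
  fixes E :: "'a::euclidean_space set"
  assumes "c > 0" "E \<in> sets borel"
  shows "perimeter (riesz_kernel s) ((\<lambda>x. c *\<^sub>R x) -` E) = ennreal (c powr (s - real DIM('a))) * perimeter (riesz_kernel s) E"
  using interaction_riesz_scaleR[of c E "- E" s] assms unfolding perimeter_def by (simp add: vimage_Compl)

section \<open>Reflection defect of star-shaped sets\<close>

text \<open>Convexity: \<open>t powr - p\<close> lies above its tangent at \<open>b\<close>, here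
  evaluated at \<open>a\<close>.\<close>

lemma powr_neg_diff_lower:
  fixes a b p :: real
  assumes "0 < a" "a \<le> b" "0 < p"
  shows "p * (b - a) * b powr (- p - 1) \<le> a powr - p - b powr - p"
proof -
  have b: "b > 0" using assms by simp
  have "ln (a / b) \<le> a / b - 1" using assms b by (intro ln_le_minus_one) auto
  then have "p * (1 - a / b) \<le> - p * ln (a / b)"
    using assms mult_left_mono[of "1 - a / b" "- ln (a / b)" p] by simp
  then have "1 + p * (1 - a / b) \<le> exp (- p * ln (a / b))"
    using exp_ge_add_one_self[of "- p * ln (a / b)"] by linarith
  then have "b powr - p * (1 + p * (1 - a / b)) \<le> b powr - p * exp (- p * ln (a / b))"
    by (intro mult_left_mono) auto
  also have "b powr - p * exp (- p * ln (a / b)) = a powr - p"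
    using assms b by (simp add: powr_def exp_add[symmetric] ln_div algebra_simps)
  finally have "b powr - p * (p * ((b - a) / b)) \<le> a powr - p - b powr - p"
    using b by (simp add: algebra_simps diff_divide_distrib)
  also have "b powr - p * (p * ((b - a) / b)) = p * (b - a) * b powr (- p - 1)"
    using b by (simp add: powr_diff)
  finally show ?thesis .
qed

text \<open>The profile is a convex decreasing function of the squared distance, which a reflection
  raises by \<open>4 * D\<close>. The lower bound is linear in \<open>D\<close> and its constant is
  free of \<open>\<epsilon>\<close>, so it survives the limit.\<close>

lemma reg_profile_diff_lower:
  fixes T :: "'a::euclidean_space itself"
  assumes s: "0 < s" and e: "0 < \<epsilon>" "\<epsilon> \<le> 1" and ab: "0 \<le> b" "b\<^sup>2 = a\<^sup>2 + 4 * D" "0 \<le> D" "b \<le> 2 * Q"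
  defines "p \<equiv> (real DIM('a) + s) / 2"
  shows "ennreal (4 * p * (4 * Q\<^sup>2 + 1) powr (- p - 1) * D) \<le> reg_profile T s \<epsilon> a - reg_profile T s \<epsilon> b"
proof -
  have p: "p > 0" using s by (simp add: p_def add_nonneg_pos)
  have b2: "b\<^sup>2 + \<epsilon> \<le> 4 * Q\<^sup>2 + 1"
    using power_mono[OF ab(4) ab(1), of 2] e by (simp add: power_mult_distrib)
  have pos: "0 < a\<^sup>2 + \<epsilon>" "0 < b\<^sup>2 + \<epsilon>" using e by (simp_all add: add_nonneg_pos)
  have "4 * p * (4 * Q\<^sup>2 + 1) powr (- p - 1) * D \<le> 4 * p * (b\<^sup>2 + \<epsilon>) powr (- p - 1) * D"
    using pos b2 p ab by (intro mult_right_mono mult_left_mono powr_mono2') auto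
  also have "\<dots> = p * ((b\<^sup>2 + \<epsilon>) - (a\<^sup>2 + \<epsilon>)) * (b\<^sup>2 + \<epsilon>) powr (- p - 1)"
    using ab by simp
  also have "\<dots> \<le> (a\<^sup>2 + \<epsilon>) powr - p - (b\<^sup>2 + \<epsilon>) powr - p"
    using pos p ab by (intro powr_neg_diff_lower) auto
  finally show ?thesis
    unfolding reg_profile_def p_def[symmetric] by (simp add: ennreal_minus ennreal_leI)
qed

text \<open>The factor \<open>\<bar>x \<bullet> u\<bar> / norm u\<close> is the distance from
  \<open>x\<close> to the mirror, that is, the weight with which a point enters the gain of the
  polarization.\<close>

definition reflection_defect :: "real \<Rightarrow> 'a::euclidean_space set \<Rightarrow> 'a \<Rightarrow> ennreal" where
  "reflection_defect Q E u = (\<integral>\<^sup>+x. ennreal (\<bar>x \<bullet> u\<bar> / norm u) * indicator (ball 0 Q) x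
       * indicator E x * indicator (- E) (reflection u 0 x) \<partial>lborel)"

lemma nn_integral_reflection:
  "f \<in> borel_measurable borel \<Longrightarrow> (\<integral>\<^sup>+x. f (reflection u h x) \<partial>lborel) = (\<integral>\<^sup>+x. f x \<partial>lborel)"
  by (subst (2) distr_lborel_reflection[of u h, symmetric]) (simp add: nn_integral_distr)

text \<open>The polarized set has the volume of the ball, hence at least its perimeter, so the gain
  of the polarization is at most \<open>\<delta>\<close>. The gain dominates the product of the
  weighted masses of \<open>kept E\<close> and \<open>gained E\<close>. Each of these is half of the
  defect, which explains the square.\<close>

lemma reflection_defect_le_deficit:
  fixes E :: "'a::euclidean_space set"
  assumes s: "0 < s" "s < 1" and [measurable]: "E \<in> sets borel"
    and vol: "emeasure lborel E = emeasure lborel (ball (0::'a) 1)"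
    and even: "\<And>x. x \<in> E \<Longrightarrow> - x \<in> E"
    and P: "perimeter (riesz_kernel s) E \<le> perimeter (riesz_kernel s) (ball (0::'a) 1) + \<delta>"
    and u: "u \<noteq> 0" and Q: "Q > 0"
  defines "p \<equiv> (real DIM('a) + s) / 2"
  shows "ennreal (2 * p * (4 * Q\<^sup>2 + 1) powr (- p - 1)) * (reflection_defect Q E u)\<^sup>2 \<le> \<delta>"
proof -
  interpret polarizer "reflection u 0" "{x. x \<bullet> u < 0}" by (rule polarizer_reflection[OF u])
  let ?\<sigma> = "reflection u 0"
  define c where "c = 4 * p * (4 * Q\<^sup>2 + 1) powr (- p - 1)"
  have p: "p > 0" using s by (simp add: p_def add_nonneg_pos)
  have c: "c \<ge> 0" using p by (simp add: c_def)
  define d where "d = (\<lambda>x. \<bar>x \<bullet> u\<bar> / norm u)"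
  have d0: "d x \<ge> 0" for x by (simp add: d_def)
  have [measurable]: "d \<in> borel_measurable borel" unfolding d_def by measurable
  have BQ[measurable]: "ball (0::'a) Q \<in> sets borel" by auto
  have evenI: "- x \<in> E \<longleftrightarrow> x \<in> E" for x using even[of x] even[of "- x"] by auto
  have lin: "?\<sigma> (- x) = - ?\<sigma> x" for x using linear_neg[OF linear_reflection] by blast
  have dm: "d (?\<sigma> x) = d x" "d (- x) = d x" for x
    by (simp_all add: d_def reflection_inner[OF u])
  let ?A = "kept E" and ?B = "gained E"
  have [measurable]: "?A \<in> sets borel" "?B \<in> sets borel" by (simp_all add: kept_sets gained_sets)
  define a where "a = (\<integral>\<^sup>+x. ennreal (d x) * indicator (ball 0 Q) x * indicator ?A x \<partial>lborel)"
  define b where "b = (\<integral>\<^sup>+x. ennreal (d x) * indicator (ball 0 Q) x * indicator ?B x \<partial>lborel)"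
  \<comment> \<open>The map sending \<open>x\<close> to \<open>- ?\<sigma> x\<close> keeps the side
    of the hyperplane and the distance to it. As \<open>E\<close> is even, it also exchanges the
    conditions on a point and on its mirror image, so it matches the two mismatched parts.\<close>
  have AB: "x \<in> ?A \<longleftrightarrow> - ?\<sigma> x \<in> ?B" for x
  proof -
    have "x \<in> E \<Longrightarrow> ?\<sigma> x \<notin> E \<Longrightarrow> \<not> ?\<sigma> x \<bullet> u < 0 \<Longrightarrow> ?\<sigma> x \<bullet> u > 0"
      using sides[of x] other_side[of x] by (metis invol linorder_neqE_linordered_idom mem_Collect_eq reflection_inner[OF u] diff_0 mult_zero_right neg_less_0_iff_less)
    then show ?thesis
      by (auto simp: kept_def gained_def evenI lin)
  qed
  have ab: "a = b"
  proof -
    have "b = (\<integral>\<^sup>+x. ennreal (d (- x)) * indicator (ball 0 Q) (- x) * indicator ?B (- x) \<partial>lborel)"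
      unfolding b_def by (rule nn_integral_lborel_uminus[symmetric]) measurable
    also have "\<dots> = (\<integral>\<^sup>+x. ennreal (d (- ?\<sigma> x)) * indicator (ball 0 Q) (- ?\<sigma> x) * indicator ?B (- ?\<sigma> x) \<partial>lborel)"
      by (rule nn_integral_refl[symmetric]) measurable
    also have "\<dots> = a"
      unfolding a_def by (intro nn_integral_cong) (auto simp: dm indicator_def AB)
    finally show ?thesis by simp
  qed
  have w: "reflection_defect Q E u = 2 * b"
  proof -
    have "reflection_defect Q E u = (\<integral>\<^sup>+x. ennreal (d x) * indicator (ball 0 Q) x * indicator ?A x
        + ennreal (d x) * indicator (ball 0 Q) x * indicator ?B (?\<sigma> x) \<partial>lborel)"
      unfolding reflection_defect_def
      by (intro nn_integral_cong) (auto simp: indicator_def kept_def gained_def d_def)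
    also have "\<dots> = a + (\<integral>\<^sup>+x. ennreal (d x) * indicator (ball 0 Q) x * indicator ?B (?\<sigma> x) \<partial>lborel)"
      unfolding a_def by (rule nn_integral_add) measurable
    also have "(\<integral>\<^sup>+x. ennreal (d x) * indicator (ball 0 Q) x * indicator ?B (?\<sigma> x) \<partial>lborel)
      = (\<integral>\<^sup>+x. ennreal (d (?\<sigma> x)) * indicator (ball 0 Q) (?\<sigma> x) * indicator ?B (?\<sigma> x) \<partial>lborel)"
      by (intro nn_integral_cong) (simp add: dm indicator_def)
    also have "\<dots> = b" unfolding b_def by (rule nn_integral_refl) measurable
    finally show ?thesis by (simp add: ab mult_2)
  qed
  have gain: "ennreal c * (a * b) \<le> (\<integral>\<^sup>+x. (\<integral>\<^sup>+y. (reg_profile TYPE('a) s \<epsilon> (dist x y) - reg_profile TYPE('a) s \<epsilon> (dist x (?\<sigma> y)))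
            * indicator ?A x * indicator ?B y \<partial>lborel) \<partial>lborel)" (is "_ \<le> ?G \<epsilon>")
    if e: "0 < \<epsilon>" "\<epsilon> \<le> 1" for \<epsilon>
  proof -
    let ?f = "\<lambda>x. ennreal (d x) * indicator (ball 0 Q) x * indicator ?A x"
    let ?g = "\<lambda>x. ennreal (d x) * indicator (ball 0 Q) x * indicator ?B x"
    have "ennreal c * (a * b) = (\<integral>\<^sup>+x. ennreal c * (?f x * b) \<partial>lborel)"
      unfolding a_def by (simp add: nn_integral_multc nn_integral_cmult)
    also have "\<dots> = (\<integral>\<^sup>+x. (\<integral>\<^sup>+y. ennreal c * (?f x * ?g y) \<partial>lborel) \<partial>lborel)"
      unfolding b_def by (simp add: nn_integral_cmult)
    also have "\<dots> \<le> ?G \<epsilon>"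
    proof (intro nn_integral_mono)
      fix x y
      show "ennreal c * (?f x * ?g y) \<le> (reg_profile TYPE('a) s \<epsilon> (dist x y) - reg_profile TYPE('a) s \<epsilon> (dist x (?\<sigma> y)))
            * indicator ?A x * indicator ?B y"
      proof (cases "x \<in> ball 0 Q \<and> y \<in> ball 0 Q \<and> x \<in> ?A \<and> y \<in> ?B")
        case True
        have y: "y \<bullet> u < 0" using True by (auto simp: gained_def)
        have x: "x \<bullet> u < 0" using True AB[of x] by (auto simp: gained_def reflection_inner[OF u])
        have "dist x (?\<sigma> y) \<le> norm x + norm (?\<sigma> y)" unfolding dist_norm by (rule norm_triangle_ineq4)
        also have "\<dots> \<le> 2 * Q" using True by simp
        finally have le: "dist x (?\<sigma> y) \<le> 2 * Q" .
        have "d x * d y = (x \<bullet> u) * (y \<bullet> u) / (u \<bullet> u)"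
          using x y by (simp add: d_def power2_norm_eq_inner[symmetric] power2_eq_square)
        then have eq: "(dist x (?\<sigma> y))\<^sup>2 = (dist x y)\<^sup>2 + 4 * (d x * d y)"
          by (simp add: dist_reflection_sq[OF u])
        have "ennreal c * (?f x * ?g y) = ennreal (c * (d x * d y))"
          using True d0 c by (simp add: ennreal_mult')
        also have "\<dots> \<le> reg_profile TYPE('a) s \<epsilon> (dist x y) - reg_profile TYPE('a) s \<epsilon> (dist x (?\<sigma> y))"
          unfolding c_def p_def using e s le eq d0 by (intro reg_profile_diff_lower) auto
        finally show ?thesis using True by simp
      qed (auto simp: indicator_def)
    qed
    finally show ?thesis .
  qed
  have fin: "emeasure lborel E \<noteq> \<infinity>" using vol emeasure_lborel_ball_finite[of "0::'a" 1] by simp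
  have step: "perimeter (reg_kernel s \<epsilon>) (ball (0::'a) 1) + 2 * (ennreal c * (a * b)) \<le> perimeter (riesz_kernel s) (ball (0::'a) 1) + \<delta>"
    if e: "0 < \<epsilon>" "\<epsilon> \<le> 1" for \<epsilon>
  proof -
    have "perimeter (reg_kernel s \<epsilon>) (ball (0::'a) 1) + 2 * (ennreal c * (a * b))
      \<le> perimeter (reg_kernel s \<epsilon>) (polarize E) + 2 * ?G \<epsilon>"
      using gain[OF e] vol e s
      by (intro add_mono mult_left_mono perimeter_reg_ball_le) (auto simp: emeasure_polarize)
    also have "\<dots> = perimeter (reg_kernel s \<epsilon>) E"
    proof -
      have "(\<integral>\<^sup>+z. reg_profile TYPE('a) s \<epsilon> (norm (z::'a)) \<partial>lborel) \<noteq> \<infinity>"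
        using reg_kernel_integrable[OF s e(1), where 'a='a] by (simp add: reg_kernel_def[abs_def])
      then show ?thesis
        unfolding reg_kernel_def[abs_def]
        by (intro perimeter_polarize reg_profile_measurable reg_profile_antimono[OF s(1) e(1)] fin assms)
    qed
    also have "\<dots> \<le> perimeter (riesz_kernel s) E"
      by (rule perimeter_mono) (rule reg_kernel_le_riesz[OF s(1) e(1)])
    also note P
    finally show ?thesis .
  qed
  \<comment> \<open>Only the perimeter of the ball still depends on the regularization. Its limit is
    finite, so it can be cancelled.\<close>
  have "perimeter (riesz_kernel s) (ball (0::'a) 1) + 2 * (ennreal c * (a * b))
     = (SUP j. perimeter (reg_kernel s (1 / real (Suc j))) (ball (0::'a) 1) + 2 * (ennreal c * (a * b)))"
    using s by (simp add: perimeter_riesz_SUP ennreal_SUP_add_left)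
  also have "\<dots> \<le> perimeter (riesz_kernel s) (ball (0::'a) 1) + \<delta>"
    by (rule SUP_least) (rule step, auto)
  finally have "2 * (ennreal c * (a * b)) \<le> \<delta>"
    using perimeter_riesz_ball_finite[OF s, where 'a='a] by (auto simp: ennreal_add_left_cancel_le)
  moreover have "ennreal (c / 2) * (2 * b)\<^sup>2 = 2 * (ennreal c * (a * b))"
  proof -
    have "ennreal c = 2 * ennreal (c / 2)"
      using c by (simp add: ennreal_numeral[symmetric] ennreal_mult'[symmetric] del: ennreal_numeral)
    then show ?thesis by (simp add: ab power2_eq_square ac_simps)
  qed
  moreover have "2 * p * (4 * Q\<^sup>2 + 1) powr (- p - 1) = c / 2" by (simp add: c_def)
  ultimately show ?thesis unfolding w by (simp only:)
qed

section \<open>Averaging over mirrors through the origin\<close>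

lemma emeasure_UN_le_count_space:
  assumes I: "countable I" and [measurable]: "\<And>i. i \<in> I \<Longrightarrow> A i \<in> sets M"
  shows "emeasure M (\<Union>i\<in>I. A i) \<le> (\<integral>\<^sup>+i. emeasure M (A i) \<partial>count_space I)"
proof -
  have U: "(\<Union>i\<in>I. A i) \<in> sets M" by (rule sets.countable_UN''[OF I]) (rule assms(2))
  have "emeasure M (\<Union>i\<in>I. A i) = (\<integral>\<^sup>+x. indicator (\<Union>i\<in>I. A i) x \<partial>M)"
    using U by simp
  also have "\<dots> \<le> (\<integral>\<^sup>+x. (\<integral>\<^sup>+i. indicator (A i) x \<partial>count_space I) \<partial>M)"
  proof (rule nn_integral_mono)
    fix x
    show "indicator (\<Union>i\<in>I. A i) x \<le> (\<integral>\<^sup>+i. indicator (A i) x \<partial>count_space I)"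
    proof (cases "x \<in> (\<Union>i\<in>I. A i)")
      case True
      then obtain i where i: "i \<in> I" "x \<in> A i" by blast
      have "(\<integral>\<^sup>+j. indicator {i} j \<partial>count_space I) \<le> (\<integral>\<^sup>+j. indicator (A j) x \<partial>count_space I)"
        using i by (intro nn_integral_mono) (auto simp: indicator_def)
      moreover have "(\<integral>\<^sup>+j. indicator {i} j \<partial>count_space I) = (1::ennreal)"
        using i by simp
      ultimately show ?thesis using True by simp
    qed simp
  qed
  also have "\<dots> = (\<integral>\<^sup>+i. (\<integral>\<^sup>+x. indicator (A i) x \<partial>M) \<partial>count_space I)"
    by (rule nn_integral_count_space_nn_integral[OF I]) measurable
  also have "\<dots> = (\<integral>\<^sup>+i. emeasure M (A i) \<partial>count_space I)"
    by (intro nn_integral_cong) auto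
  finally show ?thesis .
qed

text \<open>On \<open>D\<close> the map \<open>g\<close> has a 2-Lipschitz inverse, so volumes of
  preimages grow by at most a constant factor; Vitali balls give this without any derivative. The
  preimage of a ball of radius \<open>5 * r\<close> lies in a ball of radius \<open>20 * r\<close>,
  which is compared with the disjoint ball of radius \<open>r\<close>. Outer regularity then passes
  from open to Borel sets.\<close>

lemma emeasure_expanding_vimage:
  fixes g :: "'a::euclidean_space \<Rightarrow> 'a"
  assumes [measurable]: "g \<in> borel_measurable borel" "D \<in> sets borel" "U \<in> sets borel"
    and exp: "\<And>z w. z \<in> D \<Longrightarrow> w \<in> D \<Longrightarrow> dist z w \<le> 2 * dist (g z) (g w)"
  shows "emeasure lborel {z \<in> D. g z \<in> U} \<le> ennreal (20 ^ DIM('a)) * emeasure lborel U"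
proof -
  define v where "v = unit_ball_vol (real DIM('a))"
  have v: "v \<ge> 0" by (simp add: v_def)
  have op: "emeasure lborel {z \<in> D. g z \<in> V} \<le> ennreal (20 ^ DIM('a)) * emeasure lborel V" if V: "open V" for V
  proof -
    have "\<exists>r. 0 < r \<and> r \<le> 1 \<and> ball x r \<subseteq> V" if x: "x \<in> V" for x
    proof -
      obtain e where "e > 0" "ball x e \<subseteq> V" by (rule openE[OF V x])
      then show ?thesis by (intro exI[of _ "min e 1"]) auto
    qed
    then obtain r where r: "\<And>x. x \<in> V \<Longrightarrow> 0 < r x \<and> r x \<le> 1 \<and> ball x (r x) \<subseteq> V" by metis
    obtain C where C: "countable C" "C \<subseteq> V"
      "pairwise (\<lambda>i j. disjnt (ball i (r i)) (ball j (r j))) C" "V \<subseteq> (\<Union>i\<in>C. ball i (5 * r i))"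
    proof (rule Vitali_covering_lemma_balls[where S=V and K=V and a="\<lambda>x. x" and r=r and B=1])
      show "V \<subseteq> (\<Union>i\<in>V. ball i (r i))" using r by force
      show "0 < r i \<and> r i \<le> 1" if "i \<in> V" for i using r[OF that] by simp
    qed
    have [measurable]: "ball x q \<in> sets borel" for x :: 'a and q by simp
    have piece: "emeasure lborel {z \<in> D. g z \<in> ball x (5 * r x)} \<le> ennreal (20 ^ DIM('a)) * emeasure lborel (ball x (r x))"
      if x: "x \<in> C" for x
    proof (cases "{z \<in> D. g z \<in> ball x (5 * r x)} = {}")
      case False
      then obtain z0 where z0: "z0 \<in> D" "g z0 \<in> ball x (5 * r x)" by blast
      have rx: "r x > 0" using r x C by blast
      have "{z \<in> D. g z \<in> ball x (5 * r x)} \<subseteq> cball z0 (20 * r x)"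
      proof safe
        fix z assume z: "z \<in> D" "g z \<in> ball x (5 * r x)"
        have "dist z0 z \<le> 2 * dist (g z0) (g z)" using exp z0 z by blast
        also have "\<dots> \<le> 2 * (dist x (g z0) + dist x (g z))" using dist_triangle3[of "g z0" "g z" x] by simp
        also have "\<dots> \<le> 20 * r x" using z z0 by simp
        finally show "z \<in> cball z0 (20 * r x)" by simp
      qed
      then have "emeasure lborel {z \<in> D. g z \<in> ball x (5 * r x)} \<le> emeasure lborel (cball z0 (20 * r x))"
        by (intro emeasure_mono) auto
      also have "\<dots> = ennreal (20 ^ DIM('a)) * emeasure lborel (ball x (r x))"
        using rx v by (simp add: emeasure_cball emeasure_ball power_mult_distrib ennreal_mult'[symmetric] ac_simps)
      finally show ?thesis .
    next
      case True
      then show ?thesis by (simp only: emeasure_empty) simp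
    qed
    have "emeasure lborel {z \<in> D. g z \<in> V} \<le> emeasure lborel (\<Union>x\<in>C. {z \<in> D. g z \<in> ball x (5 * r x)})"
    proof (rule emeasure_mono)
      show "{z \<in> D. g z \<in> V} \<subseteq> (\<Union>x\<in>C. {z \<in> D. g z \<in> ball x (5 * r x)})" using C(4) by blast
      show "(\<Union>x\<in>C. {z \<in> D. g z \<in> ball x (5 * r x)}) \<in> sets lborel"
        by (rule sets.countable_UN''[OF C(1)]) simp
    qed
    also have "\<dots> \<le> (\<integral>\<^sup>+x. emeasure lborel {z \<in> D. g z \<in> ball x (5 * r x)} \<partial>count_space C)"
      using C(1) by (intro emeasure_UN_le_count_space) auto
    also have "\<dots> \<le> (\<integral>\<^sup>+x. ennreal (20 ^ DIM('a)) * emeasure lborel (ball x (r x)) \<partial>count_space C)"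
      by (intro nn_integral_mono piece) auto
    also have "\<dots> = ennreal (20 ^ DIM('a)) * (\<integral>\<^sup>+x. emeasure lborel (ball x (r x)) \<partial>count_space C)"
      by (rule nn_integral_cmult) auto
    also have "(\<integral>\<^sup>+x. emeasure lborel (ball x (r x)) \<partial>count_space C) = emeasure lborel (\<Union>x\<in>C. ball x (r x))"
      using C by (intro emeasure_UN_countable[symmetric]) (auto simp: disjoint_family_on_def pairwise_def disjnt_def)
    also have "\<dots> \<le> emeasure lborel V"
      using C r by (intro emeasure_mono) (auto simp: V)
    finally show ?thesis by (simp add: mult_left_mono)
  qed
  show ?thesis
  proof (rule ennreal_le_epsilon)
    fix e :: real assume e: "e > 0"
    obtain V where V: "open V" "U \<subseteq> V" "emeasure lborel V \<le> emeasure lborel U + ennreal (e / 20 ^ DIM('a))"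
    proof -
      obtain V where V: "open V" "U \<subseteq> V" "emeasure lborel (V - U) \<le> ennreal (e / 20 ^ DIM('a))"
        using outer_regular_lborel_le[of U "e / 20 ^ DIM('a)"] e by auto
      have "emeasure lborel V \<le> emeasure lborel U + emeasure lborel (V - U)"
        using V emeasure_subadditive[of U lborel "V - U"] by (simp add: Un_absorb1 borel_open)
      also have "\<dots> \<le> emeasure lborel U + ennreal (e / 20 ^ DIM('a))"
        using V by (intro add_mono) auto
      finally show ?thesis using that V by blast
    qed
    have [measurable]: "V \<in> sets borel" using V(1) by (rule borel_open)
    have "emeasure lborel {z \<in> D. g z \<in> U} \<le> emeasure lborel {z \<in> D. g z \<in> V}"
    proof (rule emeasure_mono)
      show "{z \<in> D. g z \<in> U} \<subseteq> {z \<in> D. g z \<in> V}" using V(2) by blast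
    qed measurable
    also have "\<dots> \<le> ennreal (20 ^ DIM('a)) * emeasure lborel V" by (rule op[OF V(1)])
    also have "\<dots> \<le> ennreal (20 ^ DIM('a)) * (emeasure lborel U + ennreal (e / 20 ^ DIM('a)))"
      using V by (intro mult_left_mono) auto
    also have "\<dots> = ennreal (20 ^ DIM('a)) * emeasure lborel U + ennreal e"
      using e by (simp add: distrib_left ennreal_mult'[symmetric])
    finally show "emeasure lborel {z \<in> D. g z \<in> U} \<le> ennreal (20 ^ DIM('a)) * emeasure lborel U + ennreal e" .
  qed
qed


text \<open>With \<open>v = z - w\<close> and \<open>m = (z + w) / (norm z + norm w)\<close> one has
  \<open>norm z - norm w = m \<bullet> v\<close>, so the images differ by
  \<open>q = v - (m \<bullet> v) y\<close>. Since \<open>m \<bullet> y \<le> 0\<close> and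
  \<open>norm m \<le> 1\<close>, the identity
  \<open>m \<bullet> q = (m \<bullet> v) (1 - m \<bullet> y)\<close> bounds
  \<open>m \<bullet> v\<close> by \<open>norm q\<close>, and then \<open>norm v\<close> is at most
  twice \<open>norm q\<close>.\<close>

lemma half_space_expanding:
  fixes y z w :: "'a::euclidean_space"
  assumes y: "norm y = 1" and "z \<bullet> y \<le> 0" "w \<bullet> y \<le> 0"
  shows "dist z w \<le> 2 * dist (z - norm z *\<^sub>R y) (w - norm w *\<^sub>R y)"
proof (cases "z = 0 \<and> w = 0")
  case False
  define m where "m = (1 / (norm z + norm w)) *\<^sub>R (z + w)"
  define v where "v = z - w"
  define q where "q = v - (m \<bullet> v) *\<^sub>R y"
  have pos: "norm z + norm w > 0" using False by (auto simp: add_pos_nonneg add_nonneg_pos)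
  have "(z + w) \<bullet> (z - w) = (norm z + norm w) * (norm z - norm w)"
    by (simp add: inner_add_left inner_diff_right power2_norm_eq_inner[symmetric] inner_commute power2_eq_square algebra_simps)
  then have mv: "m \<bullet> v = norm z - norm w"
    using pos by (simp add: m_def v_def)
  have q: "(z - norm z *\<^sub>R y) - (w - norm w *\<^sub>R y) = q"
    unfolding q_def mv by (simp add: v_def scaleR_diff_left)
  have "norm m \<le> 1"
    using pos norm_triangle_ineq[of z w] by (simp add: m_def)
  have my: "m \<bullet> y \<le> 0"
    using assms pos by (simp add: m_def inner_add_left divide_le_0_iff)
  have "m \<bullet> q = (m \<bullet> v) * (1 - m \<bullet> y)"
    by (simp add: q_def inner_diff_right algebra_simps)
  then have "\<bar>m \<bullet> v\<bar> * (1 - m \<bullet> y) = \<bar>m \<bullet> q\<bar>"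
    using my by (simp add: abs_mult)
  also have "\<dots> \<le> norm m * norm q" by (rule Cauchy_Schwarz_ineq2)
  also have "\<dots> \<le> 1 * norm q" using \<open>norm m \<le> 1\<close> by (intro mult_right_mono) auto
  finally have "\<bar>m \<bullet> v\<bar> * (1 - m \<bullet> y) \<le> norm q" by simp
  moreover have "\<bar>m \<bullet> v\<bar> * 1 \<le> \<bar>m \<bullet> v\<bar> * (1 - m \<bullet> y)"
    using my by (intro mult_left_mono) auto
  ultimately have "\<bar>m \<bullet> v\<bar> \<le> norm q" by simp
  moreover have "norm v \<le> norm q + \<bar>m \<bullet> v\<bar>"
    using norm_triangle_ineq[of q "(m \<bullet> v) *\<^sub>R y"] y by (simp add: q_def)
  ultimately show ?thesis by (simp add: dist_norm q v_def)
qed simp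

text \<open>The reflection in the direction \<open>z - |z| y/|y|\<close> sends \<open>y\<close> to the point of norm \<open>|y|\<close> in direction \<open>z\<close>;
  this turns an average over reflections into an average over directions without polar coordinates.\<close>
lemma reflection_direction_lower:
  fixes y :: "'a::euclidean_space"
  assumes y: "y \<noteq> 0" and [measurable]: "Z \<in> sets borel" "T \<in> sets borel"
    and Z: "Z \<subseteq> ball 0 (1/2)" "0 \<notin> Z" "\<And>z. z \<in> Z \<Longrightarrow> - z \<in> Z"
    and ZT: "\<And>z. z \<in> Z \<Longrightarrow> (norm y / norm z) *\<^sub>R z \<in> T"
  shows "ennreal (norm y / (4 * 20 ^ DIM('a))) * emeasure lborel Z \<le>
    (\<integral>\<^sup>+u. ennreal (\<bar>y \<bullet> u\<bar> / norm u) * indicator (ball 0 1) u * indicator T (reflection u 0 y) \<partial>lborel)"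
proof -
  define e where "e = (1 / norm y) *\<^sub>R y"
  have e: "norm e = 1" "y = norm y *\<^sub>R e" using y by (simp_all add: e_def)
  define g where "g = (\<lambda>z::'a. z - norm z *\<^sub>R e)"
  \<comment> \<open>On the ray through \<open>e\<close> the map \<open>g\<close> collapses to
    \<open>0\<close>; on this half-space it is expanding up to the factor two. Evenness of
    \<open>Z\<close> allows the restriction at the cost of another factor two.\<close>
  define D where "D = {z::'a. z \<bullet> e \<le> 0}"
  \<comment> \<open>The last condition bounds the weight below by \<open>norm y / 2\<close>.
    Together with the factor lost in passing from \<open>Z\<close> to \<open>Z \<inter> D\<close>,
    this makes the 4 in the constant.\<close>
  define U where "U = {u::'a. u \<in> ball 0 1 \<and> u \<noteq> 0 \<and> reflection u 0 y \<in> T \<and> norm y / 2 * norm u \<le> \<bar>y \<bullet> u\<bar>}"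
  have [measurable]: "ball (0::'a) 1 \<in> sets borel" by auto
  have meas[measurable]: "g \<in> borel_measurable borel" "D \<in> sets borel" "U \<in> sets borel"
    unfolding g_def D_def U_def by measurable
  have sub: "Z \<inter> D \<subseteq> {z \<in> D. g z \<in> U}"
  proof safe
    fix z assume z: "z \<in> Z" "z \<in> D"
    define u where "u = g z"
    have nz: "norm z > 0" "norm z < 1/2" using z Z by auto
    have ze: "z \<bullet> e \<le> 0" using z by (simp add: D_def)
    have ee: "e \<bullet> e = 1" using e by (simp add: norm_eq_1)
    have uu: "u \<bullet> u = 2 * norm z * (norm z - z \<bullet> e)"
    proof -
      have "u \<bullet> u = z \<bullet> z - 2 * (norm z * (z \<bullet> e)) + norm z * norm z * (e \<bullet> e)"
        by (simp add: u_def g_def inner_diff_left inner_diff_right inner_commute algebra_simps)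
      then show ?thesis unfolding ee dot_square_norm[of z] by (simp add: power2_eq_square algebra_simps)
    qed
    have "u \<bullet> u \<ge> 2 * norm z * norm z"
      unfolding uu using ze nz by (intro mult_left_mono) auto
    then have u2: "(norm u)\<^sup>2 \<ge> 2 * (norm z)\<^sup>2"
      unfolding power2_norm_eq_inner[of u] by (simp add: power2_eq_square)
    have "(norm z)\<^sup>2 > 0" using nz by simp
    with u2 have u0: "u \<noteq> 0" by auto
    have unz: "norm u \<ge> norm z"
    proof (rule power2_le_imp_le)
      show "(norm z)\<^sup>2 \<le> (norm u)\<^sup>2" using u2 zero_le_power2[of "norm z"] by linarith
    qed simp
    have eu: "e \<bullet> u = - (u \<bullet> u) / (2 * norm z)"
      using nz ee unfolding uu by (simp add: u_def g_def inner_diff_right inner_commute)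
    have "norm u \<le> norm z + norm z * norm e"
      unfolding u_def g_def using norm_triangle_ineq4[of z "norm z *\<^sub>R e"] by simp
    then have u1: "norm u < 1" using nz e by simp
    have yu: "y \<bullet> u = norm y * (e \<bullet> u)" by (subst e(2)) simp
    have "reflection u 0 y = y - (2 * (y \<bullet> u) / (u \<bullet> u)) *\<^sub>R u" by (simp add: reflection_def)
    also have "2 * (y \<bullet> u) / (u \<bullet> u) = - norm y / norm z"
      using u0 nz by (simp add: yu eu)
    also have "y - (- norm y / norm z) *\<^sub>R u = (norm y / norm z) *\<^sub>R z"
    proof -
      have "(norm y / norm z) *\<^sub>R u = (norm y / norm z) *\<^sub>R z - norm y *\<^sub>R e"
        using nz by (simp add: u_def g_def scaleR_diff_right)
      then show ?thesis using e(2) by simp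
    qed
    finally have "reflection u 0 y \<in> T" using ZT z by simp
    moreover have "norm y / 2 * norm u \<le> \<bar>y \<bullet> u\<bar>"
    proof -
      have "\<bar>y \<bullet> u\<bar> = norm y * ((norm u * norm u) / (2 * norm z))"
        unfolding yu eu by (simp add: abs_mult power2_norm_eq_inner[symmetric] power2_eq_square)
      also have "\<dots> \<ge> norm y * (norm u * norm z / (2 * norm z))"
        using unz nz by (intro mult_left_mono divide_right_mono) auto
      finally show ?thesis using nz by simp
    qed
    ultimately show "g z \<in> U" using u0 u1 z by (auto simp: U_def u_def)
  qed
  have "emeasure lborel Z \<le> emeasure lborel ((Z \<inter> D) \<union> uminus -` (Z \<inter> D))"
    using Z by (intro emeasure_mono) (auto simp: D_def intro!: measurable_sets_borel[of uminus borel])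
  also have "\<dots> \<le> emeasure lborel (Z \<inter> D) + emeasure lborel (uminus -` (Z \<inter> D))"
    by (intro emeasure_subadditive) (auto intro!: measurable_sets_borel[of uminus borel])
  also have "emeasure lborel (uminus -` (Z \<inter> D)) = emeasure lborel (Z \<inter> D)"
  proof -
    have "emeasure lborel (uminus -` (Z \<inter> D)) = (\<integral>\<^sup>+x. indicator (Z \<inter> D) (- x) \<partial>lborel)"
    proof -
      have "(\<integral>\<^sup>+x. indicator (Z \<inter> D) (- x) \<partial>lborel) = (\<integral>\<^sup>+x. indicator (uminus -` (Z \<inter> D)) x \<partial>lborel)"
        by (rule nn_integral_cong) (simp add: indicator_def)
      also have "\<dots> = emeasure lborel (uminus -` (Z \<inter> D))"
        by (rule nn_integral_indicator) (simp add: measurable_sets_borel[of uminus borel])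
      finally show ?thesis by simp
    qed
    also have "\<dots> = (\<integral>\<^sup>+x. indicator (Z \<inter> D) x \<partial>lborel)"
      by (rule nn_integral_lborel_uminus) measurable
    finally show ?thesis by simp
  qed
  also have "emeasure lborel (Z \<inter> D) \<le> ennreal (20 ^ DIM('a)) * emeasure lborel U"
  proof -
    have "emeasure lborel (Z \<inter> D) \<le> emeasure lborel {z \<in> D. g z \<in> U}"
      by (rule emeasure_mono[OF sub]) measurable
    also have "\<dots> \<le> ennreal (20 ^ DIM('a)) * emeasure lborel U"
      by (rule emeasure_expanding_vimage) (auto simp: D_def g_def intro!: half_space_expanding e meas)
    finally show ?thesis .
  qed
  finally have ZU: "emeasure lborel Z \<le> 2 * (ennreal (20 ^ DIM('a)) * emeasure lborel U)"
    by (simp add: mult_2 add_mono)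
  have "ennreal (norm y / (4 * 20 ^ DIM('a))) * emeasure lborel Z
     \<le> ennreal (norm y / (4 * 20 ^ DIM('a))) * (2 * (ennreal (20 ^ DIM('a)) * emeasure lborel U))"
    by (rule mult_left_mono[OF ZU]) simp
  also have "\<dots> = ennreal (norm y / (4 * 20 ^ DIM('a)) * (2 * 20 ^ DIM('a))) * emeasure lborel U"
  proof -
    have "ennreal (norm y / (4 * 20 ^ DIM('a)) * (2 * 20 ^ DIM('a))) = ennreal (norm y / (4 * 20 ^ DIM('a))) * ennreal (2 * 20 ^ DIM('a))"
      by (rule ennreal_mult) auto
    also have "ennreal (2 * 20 ^ DIM('a)) = 2 * ennreal (20 ^ DIM('a))"
      by (subst ennreal_mult) auto
    finally show ?thesis by (simp only: mult.assoc)
  qed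
  also have "norm y / (4 * 20 ^ DIM('a)) * (2 * 20 ^ DIM('a)) = norm y / 2" by simp
  also have "ennreal (norm y / 2) * emeasure lborel U = (\<integral>\<^sup>+u. ennreal (norm y / 2) * indicator U u \<partial>lborel)"
    by (rule nn_integral_cmult_indicator[symmetric]) measurable
  also have "\<dots> \<le> (\<integral>\<^sup>+u. ennreal (\<bar>y \<bullet> u\<bar> / norm u) * indicator (ball 0 1) u * indicator T (reflection u 0 y) \<partial>lborel)"
  proof (rule nn_integral_mono)
    fix u
    show "ennreal (norm y / 2) * indicator U u \<le> ennreal (\<bar>y \<bullet> u\<bar> / norm u) * indicator (ball 0 1) u * indicator T (reflection u 0 y)"
    proof (cases "u \<in> U")
      case True
      then have "norm y / 2 \<le> \<bar>y \<bullet> u\<bar> / norm u" by (simp add: U_def pos_le_divide_eq)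
      then show ?thesis using True by (simp add: U_def ennreal_leI)
    qed simp
  qed
  finally show ?thesis .
qed


definition mean_defect :: "real \<Rightarrow> 'a::euclidean_space set \<Rightarrow> ennreal" where
  "mean_defect Q E = (\<integral>\<^sup>+u. reflection_defect Q E u * indicator (ball 0 1) u \<partial>lborel)"

text \<open>\<open>J T x\<close> measures the mirrors that carry \<open>x\<close> into
  \<open>T\<close>. The same mismatch is seen once from the points of \<open>E\<close> and once,
  after substituting the mirror image, from the missing points of the ball; the two forms serve the
  two cases of the alternative below.\<close>

lemma mean_defect_eq:
  fixes E :: "'a::euclidean_space set"
  assumes [measurable]: "E \<in> sets borel"
  defines "J \<equiv> \<lambda>T x. (\<integral>\<^sup>+u. ennreal (\<bar>x \<bullet> u\<bar> / norm u) * indicator (ball 0 1) u * indicator T (reflection u 0 x) \<partial>lborel)"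
  shows "mean_defect Q E = (\<integral>\<^sup>+x. J (- E) x * indicator (E \<inter> ball 0 Q) x \<partial>lborel)"
    and "mean_defect Q E = (\<integral>\<^sup>+x. J E x * indicator (ball 0 Q - E) x \<partial>lborel)"
proof -
  have b[measurable]: "ball (0::'a) r \<in> sets borel" for r by auto
  let ?f = "\<lambda>u x. ennreal (\<bar>x \<bullet> u\<bar> / norm u) * indicator (ball 0 Q) x * indicator E x * indicator (- E) (reflection u 0 x)"
  have fub: "(\<integral>\<^sup>+u. (\<integral>\<^sup>+x. ennreal (\<bar>x \<bullet> u\<bar> / norm u) * indicator A x * indicator T (reflection u 0 x) \<partial>lborel) * indicator (ball 0 1) u \<partial>lborel)
     = (\<integral>\<^sup>+x. J T x * indicator A x \<partial>lborel)" if [measurable]: "A \<in> sets borel" "T \<in> sets borel" for A T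
  proof -
    have "(\<integral>\<^sup>+u. (\<integral>\<^sup>+x. ennreal (\<bar>x \<bullet> u\<bar> / norm u) * indicator A x * indicator T (reflection u 0 x) \<partial>lborel) * indicator (ball 0 1) u \<partial>lborel)
      = (\<integral>\<^sup>+u. (\<integral>\<^sup>+x. ennreal (\<bar>x \<bullet> u\<bar> / norm u) * indicator (ball 0 1) u * indicator T (reflection u 0 x) * indicator A x \<partial>lborel) \<partial>lborel)"
      by (intro nn_integral_cong) (auto simp: indicator_def intro!: nn_integral_cong)
    also have "\<dots> = (\<integral>\<^sup>+x. (\<integral>\<^sup>+u. ennreal (\<bar>x \<bullet> u\<bar> / norm u) * indicator (ball 0 1) u * indicator T (reflection u 0 x) * indicator A x \<partial>lborel) \<partial>lborel)"
      by (rule nn_integral_lborel_swap) measurable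
    also have "\<dots> = (\<integral>\<^sup>+x. J T x * indicator A x \<partial>lborel)"
      unfolding J_def by (intro nn_integral_cong nn_integral_multc) measurable
    finally show ?thesis .
  qed
  have "mean_defect Q E = (\<integral>\<^sup>+u. (\<integral>\<^sup>+x. ennreal (\<bar>x \<bullet> u\<bar> / norm u) * indicator (E \<inter> ball 0 Q) x * indicator (- E) (reflection u 0 x) \<partial>lborel) * indicator (ball 0 1) u \<partial>lborel)"
  proof -
    have "reflection_defect Q E u = (\<integral>\<^sup>+x. ennreal (\<bar>x \<bullet> u\<bar> / norm u) * indicator (E \<inter> ball 0 Q) x * indicator (- E) (reflection u 0 x) \<partial>lborel)" for u
      unfolding reflection_defect_def by (rule nn_integral_cong) (auto simp: indicator_def)
    then show ?thesis unfolding mean_defect_def by simp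
  qed
  also have "\<dots> = (\<integral>\<^sup>+x. J (- E) x * indicator (E \<inter> ball 0 Q) x \<partial>lborel)"
    by (rule fub) measurable
  finally show "mean_defect Q E = (\<integral>\<^sup>+x. J (- E) x * indicator (E \<inter> ball 0 Q) x \<partial>lborel)" .
  have "reflection_defect Q E u = (\<integral>\<^sup>+x. ennreal (\<bar>x \<bullet> u\<bar> / norm u) * indicator (ball 0 Q - E) x * indicator E (reflection u 0 x) \<partial>lborel)" for u
  proof -
    have "reflection_defect Q E u = (\<integral>\<^sup>+x. ?f u (reflection u 0 x) \<partial>lborel)"
      unfolding reflection_defect_def by (rule nn_integral_reflection[symmetric]) measurable
    also have "\<dots> = (\<integral>\<^sup>+x. ennreal (\<bar>x \<bullet> u\<bar> / norm u) * indicator (ball 0 Q - E) x * indicator E (reflection u 0 x) \<partial>lborel)"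
    proof (rule nn_integral_cong)
      fix x
      have "\<bar>reflection u 0 x \<bullet> u\<bar> = \<bar>x \<bullet> u\<bar>" by (cases "u = 0") (auto simp: reflection_inner)
      then show "?f u (reflection u 0 x) = ennreal (\<bar>x \<bullet> u\<bar> / norm u) * indicator (ball 0 Q - E) x * indicator E (reflection u 0 x)"
        by (auto simp: indicator_def)
    qed
    finally show ?thesis .
  qed
  then have "mean_defect Q E = (\<integral>\<^sup>+u. (\<integral>\<^sup>+x. ennreal (\<bar>x \<bullet> u\<bar> / norm u) * indicator (ball 0 Q - E) x * indicator E (reflection u 0 x) \<partial>lborel) * indicator (ball 0 1) u \<partial>lborel)"
    unfolding mean_defect_def by simp
  also have "\<dots> = (\<integral>\<^sup>+x. J E x * indicator (ball 0 Q - E) x \<partial>lborel)"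
    by (rule fub) measurable
  finally show "mean_defect Q E = (\<integral>\<^sup>+x. J E x * indicator (ball 0 Q - E) x \<partial>lborel)" .
qed

text \<open>The part of \<open>X\<close> in the inner ball lies in a copy of \<open>X\<close> shrunk
  by two, which has at most half the volume. This discards points near the origin, where the weight
  of the mirrors degenerates.\<close>

lemma emeasure_half_shell:
  fixes X :: "'a::euclidean_space set"
  assumes [measurable]: "X \<in> sets borel" and X: "X \<subseteq> ball 0 r" and r: "r > 0"
    and exp: "\<And>x. x \<in> X \<Longrightarrow> norm x < r / 2 \<Longrightarrow> 2 *\<^sub>R x \<in> X"
  shows "emeasure lborel X \<le> 2 * emeasure lborel (X - ball 0 (r / 2))"
proof -
  have [measurable]: "(\<lambda>x. 2 *\<^sub>R x) -` X \<in> sets borel"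
    using measurable_sets_borel[of "\<lambda>x. 2 *\<^sub>R x" borel X] by simp
  have b[measurable]: "ball (0::'a) (r / 2) \<in> sets borel" by auto
  have half: "2 * emeasure lborel ((\<lambda>x. 2 *\<^sub>R x) -` X) \<le> emeasure lborel X"
  proof -
    have "emeasure lborel X = ennreal (2 ^ DIM('a)) * (\<integral>\<^sup>+x. indicator X (2 *\<^sub>R x) \<partial>lborel)"
      using nn_integral_lborel_scaleR[of "indicator X" 2] by simp
    also have "(\<integral>\<^sup>+x. indicator X (2 *\<^sub>R x) \<partial>lborel) = (\<integral>\<^sup>+x. indicator ((\<lambda>x. 2 *\<^sub>R x) -` X) x \<partial>lborel)"
      by (rule nn_integral_cong) (simp add: indicator_def)
    also have "\<dots> = emeasure lborel ((\<lambda>x. 2 *\<^sub>R x) -` X)"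
      by (rule nn_integral_indicator) simp
    finally have eq: "emeasure lborel X = ennreal (2 ^ DIM('a)) * emeasure lborel ((\<lambda>x. 2 *\<^sub>R x) -` X)" .
    have "(2::real) ^ 1 \<le> 2 ^ DIM('a)" using DIM_positive[where 'a='a] by (intro power_increasing) (auto simp: Suc_le_eq)
    then have "(2::ennreal) \<le> ennreal (2 ^ DIM('a))" by (simp flip: ennreal_numeral add: ennreal_leI del: ennreal_numeral)
    then show ?thesis unfolding eq by (intro mult_right_mono) auto
  qed
  have "X \<subseteq> (\<lambda>x. 2 *\<^sub>R x) -` X \<union> (X - ball 0 (r / 2))" using exp by auto
  then have "emeasure lborel X \<le> emeasure lborel ((\<lambda>x. 2 *\<^sub>R x) -` X \<union> (X - ball 0 (r / 2)))"
    by (intro emeasure_mono) auto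
  also have "\<dots> \<le> emeasure lborel ((\<lambda>x. 2 *\<^sub>R x) -` X) + emeasure lborel (X - ball 0 (r / 2))"
    by (intro emeasure_subadditive) auto
  finally have "2 * emeasure lborel X \<le> 2 * emeasure lborel ((\<lambda>x. 2 *\<^sub>R x) -` X) + 2 * emeasure lborel (X - ball 0 (r / 2))"
    unfolding distrib_left[symmetric] by (rule mult_left_mono) simp
  also have "\<dots> \<le> emeasure lborel X + 2 * emeasure lborel (X - ball 0 (r / 2))"
    by (intro add_mono half order_refl)
  finally have "emeasure lborel X + emeasure lborel X \<le> emeasure lborel X + 2 * emeasure lborel (X - ball 0 (r / 2))"
    by (simp add: mult_2)
  moreover have "emeasure lborel X \<noteq> \<infinity>"
    using emeasure_lborel_eq_measure_subset_ball[OF X] by simp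
  ultimately show ?thesis by (simp add: ennreal_add_left_cancel_le)
qed

text \<open>Consider the directions in which \<open>E\<close> reaches radius \<open>r\<close>. If
  they make up at least half of all directions, \<open>E\<close> contains every shorter point in
  them, and each point missing from the ball is often reflected into \<open>E\<close>. Otherwise
  half of the directions miss \<open>E\<close> from radius \<open>r\<close> on, and each point of
  \<open>E\<close> beyond \<open>r\<close> is often reflected out of \<open>E\<close>.\<close>

lemma star_shaped_defect_alternative:
  fixes E :: "'a::euclidean_space set"
  assumes [measurable]: "E \<in> sets borel" and even: "\<And>x. x \<in> E \<Longrightarrow> - x \<in> E"
    and star: "\<And>x t. x \<in> E \<Longrightarrow> 0 \<le> t \<Longrightarrow> t \<le> 1 \<Longrightarrow> t *\<^sub>R x \<in> E"
    and r: "0 < r" "r \<le> Q"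
  defines "c \<equiv> measure lborel (ball (0::'a) (1/2)) / (32 * 20 ^ DIM('a))"
  shows "ennreal (c * r) * emeasure lborel (ball 0 r - E) \<le> mean_defect Q E
       \<or> ennreal (c * r) * emeasure lborel (E \<inter> ball 0 Q - ball 0 r) \<le> mean_defect Q E"
proof -
  have b[measurable]: "ball (0::'a) q \<in> sets borel" for q by auto
  let ?H = "ball (0::'a) (1/2)"
  define m where "m = measure lborel ?H"
  have m: "m \<ge> 0" "emeasure lborel ?H = ennreal m"
    unfolding m_def by (auto intro: emeasure_lborel_eq_measure_subset_ball)
  define J where "J = (\<lambda>T x::'a. (\<integral>\<^sup>+u. ennreal (\<bar>x \<bullet> u\<bar> / norm u) * indicator (ball 0 1) u * indicator T (reflection u 0 x) \<partial>lborel))"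
  \<comment> \<open>Solid cones in a small ball represent the sets of directions; \<open>Z\<close>
    collects those in which the sphere of radius \<open>r\<close> meets \<open>E\<close>.\<close>
  define Z where "Z = {z \<in> ?H. z \<noteq> 0 \<and> (r / norm z) *\<^sub>R z \<in> E}"
  define Z' where "Z' = {z \<in> ?H. z \<noteq> 0 \<and> (r / norm z) *\<^sub>R z \<notin> E}"
  have [measurable]: "Z \<in> sets borel" "Z' \<in> sets borel" unfolding Z_def Z'_def by measurable
  have evenI: "- x \<in> E \<longleftrightarrow> x \<in> E" for x using even[of x] even[of "- x"] by auto
  have "ennreal m = emeasure lborel (?H - {0})"
    unfolding m(2)[symmetric] by (rule emeasure_Diff_null_set[symmetric]) auto
  also have "?H - {0} = Z \<union> Z'" by (auto simp: Z_def Z'_def)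
  also have "emeasure lborel (Z \<union> Z') \<le> emeasure lborel Z + emeasure lborel Z'"
    by (rule emeasure_subadditive) auto
  finally have sum: "ennreal m \<le> emeasure lborel Z + emeasure lborel Z'" .
  have "ennreal (m / 2) \<le> emeasure lborel Z \<or> ennreal (m / 2) \<le> emeasure lborel Z'"
  proof (rule ccontr)
    assume "\<not> ?thesis"
    then have "emeasure lborel Z + emeasure lborel Z' < ennreal (m / 2) + ennreal (m / 2)"
      by (intro add_strict_mono) auto
    also have "\<dots> = ennreal m" using m(1) by (simp flip: ennreal_plus)
    finally show False using sum by simp
  qed
  have low: "ennreal (norm y * (4 * c)) \<le> J T y"
    if "y \<noteq> 0" and [measurable]: "T \<in> sets borel" "S \<in> sets borel" and S: "ennreal (m / 2) \<le> emeasure lborel S" "S \<subseteq> ?H" "0 \<notin> S" "\<And>z. z \<in> S \<Longrightarrow> - z \<in> S"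
      and ST: "\<And>z. z \<in> S \<Longrightarrow> (norm y / norm z) *\<^sub>R z \<in> T" for y T S
  proof -
    have "ennreal (norm y * (4 * c)) = ennreal (norm y / (4 * 20 ^ DIM('a))) * ennreal (m / 2)"
      by (simp add: c_def m_def[symmetric] ennreal_mult'[symmetric])
    also have "\<dots> \<le> ennreal (norm y / (4 * 20 ^ DIM('a))) * emeasure lborel S"
      by (rule mult_left_mono[OF S(1)]) simp
    also have "\<dots> \<le> J T y"
      unfolding J_def using that by (intro reflection_direction_lower) auto
    finally show ?thesis .
  qed
  have c0: "c \<ge> 0" by (simp add: c_def)
  show ?thesis
    using \<open>ennreal (m / 2) \<le> emeasure lborel Z \<or> ennreal (m / 2) \<le> emeasure lborel Z'\<close>
  proof
    assume Zm: "ennreal (m / 2) \<le> emeasure lborel Z"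
    define X where "X = ball 0 r - E"
    have [measurable]: "X \<in> sets borel" by (simp add: X_def)
    have "emeasure lborel X \<le> 2 * emeasure lborel (X - ball 0 (r / 2))"
    proof (rule emeasure_half_shell[OF _ _ r(1)])
      fix x assume x: "x \<in> X" "norm x < r / 2"
      then have "2 *\<^sub>R x \<notin> E" using star[of "2 *\<^sub>R x" "1/2"] by (auto simp: X_def)
      then show "2 *\<^sub>R x \<in> X" using x by (auto simp: X_def)
    qed (auto simp: X_def)
    then have "ennreal (c * r) * emeasure lborel X \<le> ennreal (c * r) * (2 * emeasure lborel (X - ball 0 (r / 2)))"
      by (rule mult_left_mono) simp
    also have "\<dots> = ennreal (c * r * 2) * emeasure lborel (X - ball 0 (r / 2))"
      using c0 r by (simp add: ennreal_mult' ac_simps)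
    also have "\<dots> = (\<integral>\<^sup>+x. ennreal (c * r * 2) * indicator (X - ball 0 (r / 2)) x \<partial>lborel)"
      by (rule nn_integral_cmult_indicator[symmetric]) measurable
    also have "\<dots> \<le> (\<integral>\<^sup>+x. J E x * indicator (ball 0 Q - E) x \<partial>lborel)"
    proof (rule nn_integral_mono)
      fix x
      show "ennreal (c * r * 2) * indicator (X - ball 0 (r / 2)) x \<le> J E x * indicator (ball 0 Q - E) x"
      proof (cases "x \<in> X - ball 0 (r / 2)")
        case True
        have x: "norm x \<ge> r / 2" "norm x < r" "x \<notin> E" using True by (auto simp: X_def)
        have "c * r * 2 \<le> norm x * (4 * c)" using mult_right_mono[OF x(1), of "4 * c"] c0 by (simp add: ac_simps)
        then have "ennreal (c * r * 2) \<le> ennreal (norm x * (4 * c))" by (rule ennreal_leI)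
        also have "\<dots> \<le> J E x"
        proof (rule low[OF _ _ _ Zm])
          show "x \<noteq> 0" using x r by auto
          show "(norm x / norm z) *\<^sub>R z \<in> E" if "z \<in> Z" for z
            using star[of "(r / norm z) *\<^sub>R z" "norm x / r"] that x r by (auto simp: Z_def)
        qed (auto simp: Z_def evenI)
        finally show ?thesis using True x r by simp
      qed simp
    qed
    also have "\<dots> = mean_defect Q E"
      unfolding J_def by (rule mean_defect_eq(2)[symmetric]) fact
    finally show ?thesis by (simp add: X_def)
  next
    assume Zm: "ennreal (m / 2) \<le> emeasure lborel Z'"
    define Y where "Y = E \<inter> ball 0 Q - ball 0 r"
    have [measurable]: "Y \<in> sets borel" by (simp add: Y_def)
    have "ennreal (c * r) * emeasure lborel Y = (\<integral>\<^sup>+x. ennreal (c * r) * indicator Y x \<partial>lborel)"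
      by (rule nn_integral_cmult_indicator[symmetric]) measurable
    also have "\<dots> \<le> (\<integral>\<^sup>+x. J (- E) x * indicator (E \<inter> ball 0 Q) x \<partial>lborel)"
    proof (rule nn_integral_mono)
      fix x
      show "ennreal (c * r) * indicator Y x \<le> J (- E) x * indicator (E \<inter> ball 0 Q) x"
      proof (cases "x \<in> Y")
        case True
        have x: "norm x \<ge> r" "norm x < Q" "x \<in> E" using True by (auto simp: Y_def)
        have "c * r \<le> c * (4 * norm x)" using x r c0 by (intro mult_left_mono) auto
        then have "ennreal (c * r) \<le> ennreal (norm x * (4 * c))" by (intro ennreal_leI) (simp add: ac_simps)
        also have "\<dots> \<le> J (- E) x"
        proof (rule low[OF _ _ _ Zm])
          show "x \<noteq> 0" using x r by auto
          show "(norm x / norm z) *\<^sub>R z \<in> - E" if "z \<in> Z'" for z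
          proof
            assume "(norm x / norm z) *\<^sub>R z \<in> E"
            then have "(r / norm x) *\<^sub>R (norm x / norm z) *\<^sub>R z \<in> E"
              using x r by (intro star[OF \<open>(norm x / norm z) *\<^sub>R z \<in> E\<close>]) (auto simp: divide_le_eq_1)
            moreover have "x \<noteq> 0" using x r by auto
            ultimately show False using that x r by (auto simp: Z'_def)
          qed
        qed (auto simp: Z'_def evenI)
        finally show ?thesis using True x by simp
      qed simp
    qed
    also have "\<dots> = mean_defect Q E"
      unfolding J_def by (rule mean_defect_eq(1)[symmetric]) fact
    finally show ?thesis by (simp add: Y_def)
  qed
qed

section \<open>Quadratic stability of the fractional isoperimetric inequality\<close>

lemma emeasure_lborel_translate:
  fixes A :: "'a::euclidean_space set"
  assumes [measurable]: "A \<in> sets borel"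
  shows "emeasure lborel ((\<lambda>x. x + a) -` A) = emeasure lborel A"
proof -
  have "emeasure lborel ((\<lambda>x. x + a) -` A) = (\<integral>\<^sup>+x. indicator ((\<lambda>x. x + a) -` A) x \<partial>lborel)"
    by (rule nn_integral_indicator[symmetric]) (simp add: measurable_sets_borel[of "\<lambda>x. x + a" borel])
  also have "\<dots> = (\<integral>\<^sup>+x. indicator A (x + a) \<partial>lborel)"
    by (rule nn_integral_cong) (simp add: indicator_def)
  also have "\<dots> = emeasure lborel A"
    by (subst nn_integral_lborel_translate) auto
  finally show ?thesis .
qed

text \<open>Sliding \<open>E \<inter> ball x r\<close> towards the origin along \<open>v\<close> produces many disjoint copies inside \<open>E\<close>.\<close>
lemma monotone_direction_density:
  fixes E :: "'a::euclidean_space set"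
  assumes [measurable]: "E \<in> sets borel" and v: "norm v = 1" "norm x \<le> 2 * (x \<bullet> v)"
    and mono: "\<And>y t. y \<in> E \<Longrightarrow> 0 \<le> t \<Longrightarrow> t \<le> 2 * (y \<bullet> v) \<Longrightarrow> y - t *\<^sub>R v \<in> E"
    and r: "r > 0" and N: "2 * r * real N \<le> norm x"
  shows "ennreal (real N) * emeasure lborel (E \<inter> ball x r) \<le> emeasure lborel E"
proof -
  have [measurable]: "ball x r \<in> sets borel" by auto
  define A where "A = (\<lambda>j::nat. (\<lambda>y. y + (2 * r * real j) *\<^sub>R v) -` (E \<inter> ball x r))"
  have meas: "A j \<in> sets borel" for j
    unfolding A_def using measurable_sets_borel[of "\<lambda>y. y + (2 * r * real j) *\<^sub>R v" borel "E \<inter> ball x r"] by simp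
  have disj: "disjoint_family_on A {..<N}"
    unfolding disjoint_family_on_def
  proof (intro ballI impI, rule ccontr)
    fix i j assume ij: "i \<noteq> j" "A i \<inter> A j \<noteq> {}"
    then obtain y where y: "dist x (y + (2 * r * real i) *\<^sub>R v) < r" "dist x (y + (2 * r * real j) *\<^sub>R v) < r"
      by (auto simp: A_def)
    have "dist (y + (2 * r * real i) *\<^sub>R v) (y + (2 * r * real j) *\<^sub>R v) = 2 * r * \<bar>real i - real j\<bar>"
      using v r by (simp add: dist_norm scaleR_diff_left[symmetric] right_diff_distrib[symmetric] abs_mult)
    moreover have "\<bar>real i - real j\<bar> \<ge> 1" using ij by linarith
    ultimately have "dist (y + (2 * r * real i) *\<^sub>R v) (y + (2 * r * real j) *\<^sub>R v) \<ge> 2 * r"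
      using r mult_left_mono[of 1 "\<bar>real i - real j\<bar>" "2 * r"] by simp
    then show False
      using y dist_triangle3[of "y + (2 * r * real i) *\<^sub>R v" "y + (2 * r * real j) *\<^sub>R v" x] by linarith
  qed
  have sub: "A j \<subseteq> E" if j: "j < N" for j
  proof
    fix y assume "y \<in> A j"
    then have y: "y + (2 * r * real j) *\<^sub>R v \<in> E" "dist x (y + (2 * r * real j) *\<^sub>R v) < r" by (auto simp: A_def)
    define z where "z = y + (2 * r * real j) *\<^sub>R v"
    have "\<bar>(x - z) \<bullet> v\<bar> \<le> norm (x - z) * norm v" by (rule Cauchy_Schwarz_ineq2)
    then have "x \<bullet> v - z \<bullet> v \<le> r" using y v by (simp add: z_def[symmetric] dist_norm inner_diff_left)
    \<comment> \<open>The slides fit: within the ball the component along \<open>v\<close> drops by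
      at most \<open>r\<close>, and \<open>x \<bullet> v\<close> is at least \<open>r * N\<close>,
      which leaves room for each \<open>j < N\<close>.\<close>
    moreover have "r * (real j + 1) \<le> r * real N" using j r by (intro mult_left_mono) auto
    ultimately have "2 * r * real j \<le> 2 * (z \<bullet> v)" using N v(2) by (simp add: algebra_simps)
    then have "z - (2 * r * real j) *\<^sub>R v \<in> E" using y r by (intro mono) (auto simp: z_def)
    then show "y \<in> E" by (simp add: z_def)
  qed
  have "ennreal (real N) * emeasure lborel (E \<inter> ball x r) = (\<Sum>j<N. emeasure lborel (A j))"
  proof -
    have "emeasure lborel (A j) = emeasure lborel (E \<inter> ball x r)" for j
      unfolding A_def by (rule emeasure_lborel_translate) simp
    then show ?thesis by (simp add: ennreal_of_nat_eq_real_of_nat)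
  qed
  also have "\<dots> = emeasure lborel (\<Union>j<N. A j)"
    using disj by (intro sum_emeasure) (auto simp: meas)
  also have "\<dots> \<le> emeasure lborel E"
    using sub by (intro emeasure_mono) auto
  finally show ?thesis .
qed

lemma interaction_null_right:
  fixes U V :: "'a::euclidean_space set"
  assumes [measurable]: "\<kappa> \<in> borel_measurable borel" "U \<in> sets borel" "V \<in> sets borel"
    and even: "\<And>z. \<kappa> (- z) = \<kappa> z" and V: "emeasure lborel V = 0"
  shows "interaction \<kappa> U V = 0"
proof -
  have "interaction \<kappa> U V = interaction \<kappa> V U"
    by (rule interaction_swap) (auto simp: even)
  also have "\<dots> = (\<integral>\<^sup>+x. (\<integral>\<^sup>+y. \<kappa> (x - y) * indicator U y \<partial>lborel) * indicator V x \<partial>lborel)"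
    unfolding interaction_def by (intro nn_integral_cong) (simp add: indicator_def)
  also have "\<dots> = 0"
    using V by (intro nn_integral_null_set) (auto simp: null_sets_def)
  finally show ?thesis .
qed

text \<open>Averaging over the radius: the spheres with radius in \<open>{R..2*R}\<close> that
  separate \<open>x\<close> from \<open>y\<close> form a set of radii of measure at most
  \<open>R * min (norm (x - y)) 1\<close>, using \<open>R \<ge> 1\<close>. The mean cost of a cut is
  therefore controlled by the integrable kernel and the mass beyond \<open>R\<close>.\<close>

lemma exists_good_cut:
  fixes E :: "'a::euclidean_space set"
  assumes s: "0 < s" "s < 1" and [measurable]: "E \<in> sets borel" and fin: "emeasure lborel E \<noteq> \<infinity>" and R: "R \<ge> 1"
  defines "C \<equiv> (\<integral>\<^sup>+z. ennreal (min (norm z) 1) * riesz_kernel s (z::'a) \<partial>lborel)"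
  shows "\<exists>\<rho>\<in>{R..2*R}. interaction (riesz_kernel s) (E \<inter> ball 0 \<rho>) (E - ball 0 \<rho>) \<le> (C + 1) * emeasure lborel (E - ball 0 R)"
proof (rule ccontr)
  have [measurable]: "ball (0::'a) q \<in> sets borel" for q by auto
  let ?k = "riesz_kernel s :: 'a \<Rightarrow> ennreal"
  define m where "m = emeasure lborel (E - ball 0 R)"
  have mfin: "m \<noteq> \<infinity>" using fin emeasure_mono[of "E - ball 0 R" E lborel] by (auto simp: m_def top_unique)
  have Cfin: "C \<noteq> \<infinity>" unfolding C_def using riesz_kernel_min_integrable[OF s, where 'a='a] by simp
  let ?I = "\<lambda>\<rho>. interaction ?k (E \<inter> ball 0 \<rho>) (E - ball 0 \<rho>)"
  assume "\<not> ?thesis"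
  then have big: "(C + 1) * m < ?I \<rho>" if "\<rho> \<in> {R..2*R}" for \<rho>
    using that by (auto simp: m_def not_le)
  \<comment> \<open>Without mass beyond \<open>R\<close>, cutting at \<open>R\<close> costs nothing.
    Otherwise the added one in \<open>C + 1\<close> produces the strict contradiction.\<close>
  have "m \<noteq> 0"
  proof
    assume "m = 0"
    then have "?I R = 0" unfolding m_def by (intro interaction_null_right) auto
    then show False using big[of R] R by simp
  qed
  let ?f = "\<lambda>\<rho> x y. ?k (x - y) * indicator E x * indicator E y * (if norm x < \<rho> \<and> \<rho> \<le> norm y \<and> R \<le> \<rho> \<and> \<rho> \<le> 2 * R then 1 else 0)"
  let ?\<kappa> = "\<lambda>z::'a. ennreal R * (ennreal (min (norm z) 1) * ?k z)"
  have "(C + 1) * m * ennreal R = (\<integral>\<^sup>+\<rho>. (C + 1) * m * indicator {R..2*R} \<rho> \<partial>lborel)"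
    using R by (subst nn_integral_cmult_indicator) auto
  also have "\<dots> \<le> (\<integral>\<^sup>+\<rho>. (\<integral>\<^sup>+x. (\<integral>\<^sup>+y. ?f \<rho> x y \<partial>lborel) \<partial>lborel) \<partial>lborel)"
  proof (rule nn_integral_mono)
    fix \<rho> :: real
    show "(C + 1) * m * indicator {R..2*R} \<rho> \<le> (\<integral>\<^sup>+x. (\<integral>\<^sup>+y. ?f \<rho> x y \<partial>lborel) \<partial>lborel)"
    proof (cases "\<rho> \<in> {R..2*R}")
      case True
      have "?I \<rho> = (\<integral>\<^sup>+x. (\<integral>\<^sup>+y. ?f \<rho> x y \<partial>lborel) \<partial>lborel)"
        unfolding interaction_def using True by (intro nn_integral_cong) (auto simp: indicator_def)
      then show ?thesis using big[OF True] True by simp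
    qed simp
  qed
  also have "\<dots> = (\<integral>\<^sup>+x. (\<integral>\<^sup>+\<rho>. (\<integral>\<^sup>+y. ?f \<rho> x y \<partial>lborel) \<partial>lborel) \<partial>lborel)"
    by (rule nn_integral_lborel_swap) measurable
  also have "\<dots> = (\<integral>\<^sup>+x. (\<integral>\<^sup>+y. (\<integral>\<^sup>+\<rho>. ?f \<rho> x y \<partial>lborel) \<partial>lborel) \<partial>lborel)"
    by (intro nn_integral_cong nn_integral_lborel_swap) measurable
  also have "\<dots> \<le> interaction ?\<kappa> UNIV (E - ball 0 R)"
    unfolding interaction_def
  proof (intro nn_integral_mono)
    fix x y :: 'a
    have "(\<integral>\<^sup>+\<rho>. ?f \<rho> x y \<partial>lborel) = (\<integral>\<^sup>+\<rho>. (?k (x - y) * indicator E x * indicator E y) * indicator ({norm x<..norm y} \<inter> {R..2*R}) \<rho> \<partial>lborel)"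
      by (intro nn_integral_cong) (auto simp: indicator_def)
    also have "\<dots> = (?k (x - y) * indicator E x * indicator E y) * emeasure lborel ({norm x<..norm y} \<inter> {R..2*R})"
      by (rule nn_integral_cmult_indicator) auto
    also have "\<dots> \<le> ?\<kappa> (x - y) * indicator UNIV x * indicator (E - ball 0 R) y"
    proof (cases "R \<le> norm y \<and> y \<in> E \<and> x \<in> E")
      case True
      have "emeasure lborel ({norm x<..norm y} \<inter> {R..2*R}) \<le> ennreal (R * min (norm (x - y)) 1)"
      proof (cases "norm (x - y) \<le> 1")
        case le: True
        have "norm y \<le> norm x + norm (x - y)"
          using norm_triangle_ineq4[of x "x - y"] by simp
        then have "emeasure lborel ({norm x<..norm y} \<inter> {R..2*R}) \<le> emeasure lborel {norm x..norm x + norm (x - y)}"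
          by (intro emeasure_mono) auto
        also have "\<dots> = ennreal (norm (x - y))" by simp
        also have "\<dots> \<le> ennreal (R * min (norm (x - y)) 1)"
          using le R mult_right_mono[of 1 R "norm (x - y)"] by (intro ennreal_leI) simp
        finally show ?thesis .
      next
        case False
        have "emeasure lborel ({norm x<..norm y} \<inter> {R..2*R}) \<le> emeasure lborel {R..2*R}"
          by (rule emeasure_mono) auto
        then show ?thesis using False R by simp
      qed
      then have "(?k (x - y) * indicator E x * indicator E y) * emeasure lborel ({norm x<..norm y} \<inter> {R..2*R})
         \<le> ?k (x - y) * ennreal (R * min (norm (x - y)) 1)"
        using True by (simp add: mult_left_mono)
      also have "\<dots> = ?\<kappa> (x - y) * indicator UNIV x * indicator (E - ball 0 R) y"
        using True R by (simp add: ennreal_mult' ac_simps)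
      finally show ?thesis .
    next
      case False
      then have "y \<notin> E \<or> x \<notin> E \<or> {norm x<..norm y} \<inter> {R..2*R} = {}" by auto
      then show ?thesis by auto
    qed
    finally show "(\<integral>\<^sup>+\<rho>. ?f \<rho> x y \<partial>lborel) \<le> ?\<kappa> (x - y) * indicator UNIV x * indicator (E - ball 0 R) y" .
  qed
  also have "\<dots> = interaction ?\<kappa> (E - ball 0 R) UNIV"
    by (rule interaction_swap) auto
  also have "\<dots> = m * (\<integral>\<^sup>+z. ?\<kappa> z \<partial>lborel)"
    unfolding m_def by (rule interaction_UNIV) auto
  also have "(\<integral>\<^sup>+z. ?\<kappa> z \<partial>lborel) = ennreal R * C"
    unfolding C_def by (rule nn_integral_cmult) measurable
  finally have "ennreal R * ((C + 1) * m) \<le> ennreal R * (C * m)" by (simp add: ac_simps)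
  then have "(C + 1) * m \<le> C * m"
    using R by (simp add: ennreal_mult_le_mult_iff)
  then have "C * m + m \<le> C * m + 0" by (simp add: distrib_right)
  moreover have "C * m \<noteq> \<infinity>" using mfin Cfin by (simp add: ennreal_mult_eq_top_iff)
  ultimately show False using \<open>m \<noteq> 0\<close> by (simp only: ennreal_add_left_cancel_le) simp
qed

text \<open>The exact factor is \<open>r powr (n - s)\<close>; the weaker \<open>r ^ n\<close> is
  preferred because it is linear in the volume.\<close>

lemma perimeter_riesz_ball_lower:
  assumes s: "0 < s" and r: "0 \<le> r" "r \<le> 1"
  shows "ennreal (r ^ DIM('a)) * perimeter (riesz_kernel s) (ball (0::'a) 1) \<le> perimeter (riesz_kernel s) (ball (0::'a::euclidean_space) r)"
proof (cases "r = 0")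
  case False
  then have r0: "r > 0" using r by simp
  have "(\<lambda>x. (1 / r) *\<^sub>R x) -` ball (0::'a) 1 = ball 0 r"
    using r0 by (auto simp: field_simps)
  then have "perimeter (riesz_kernel s) (ball (0::'a) r) = ennreal ((1 / r) powr (s - real DIM('a))) * perimeter (riesz_kernel s) (ball (0::'a) 1)"
    using perimeter_riesz_scaleR[of "1 / r" "ball (0::'a) 1" s] r0 by simp
  moreover have "r ^ DIM('a) \<le> (1 / r) powr (s - real DIM('a))"
  proof -
    have "r ^ DIM('a) = r powr real DIM('a)" using r0 by (simp add: powr_realpow)
    also have "\<dots> \<le> r powr (real DIM('a) - s)" using r0 r s by (intro powr_mono') auto
    also have "\<dots> = (1 / r) powr (s - real DIM('a))" using r0 by (simp add: powr_divide powr_minus[symmetric] powr_diff)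
    finally show ?thesis .
  qed
  ultimately show ?thesis by (simp add: mult_right_mono ennreal_leI)
qed (simp add: zero_power)

text \<open>At least half of the ball about a point of \<open>T\<close> misses \<open>E\<close>, and
  the kernel there is at least \<open>r powr - (n + s)\<close>. The energy per unit volume grows
  without bound as \<open>r\<close> shrinks, which is what makes thin tails expensive.\<close>

lemma interaction_lower_of_thin:
  fixes E T :: "'a::euclidean_space set"
  assumes s: "0 < s" and [measurable]: "E \<in> sets borel" "T \<in> sets borel" and r: "r > 0"
    and thin: "\<And>x. x \<in> T \<Longrightarrow> 2 * emeasure lborel (E \<inter> ball x r) \<le> emeasure lborel (ball x r)"
  shows "ennreal (unit_ball_vol (real DIM('a)) / 2 * r powr - s) * emeasure lborel T \<le> interaction (riesz_kernel s) T (- E)"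
proof -
  let ?v = "unit_ball_vol (real DIM('a))"
  have [measurable]: "ball (x::'a) q \<in> sets borel" for x q by auto
  have low: "ennreal (?v / 2 * r powr - s) \<le> (\<integral>\<^sup>+y. riesz_kernel s (x - y) * indicator (- E) y \<partial>lborel)" if x: "x \<in> T" for x
  proof -
    have b: "emeasure lborel (ball x r) = ennreal (?v * r ^ DIM('a))" using r by (simp add: emeasure_ball)
    have "emeasure lborel (ball x r) \<le> emeasure lborel (E \<inter> ball x r) + emeasure lborel (ball x r - E)"
      by (subst plus_emeasure) (auto intro!: emeasure_mono)
    then have "2 * emeasure lborel (ball x r) \<le> 2 * emeasure lborel (E \<inter> ball x r) + 2 * emeasure lborel (ball x r - E)"
      unfolding distrib_left[symmetric] by (rule mult_left_mono) simp
    also have "\<dots> \<le> emeasure lborel (ball x r) + 2 * emeasure lborel (ball x r - E)"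
      by (intro add_mono thin x order_refl)
    finally have "emeasure lborel (ball x r) + emeasure lborel (ball x r) \<le> emeasure lborel (ball x r) + 2 * emeasure lborel (ball x r - E)"
      by (simp add: mult_2)
    then have half: "emeasure lborel (ball x r) \<le> 2 * emeasure lborel (ball x r - E)"
      unfolding b by (simp add: ennreal_add_left_cancel_le)
    have "ennreal (?v / 2 * r powr - s) = ennreal (r powr - (real DIM('a) + s) / 2) * ennreal (?v * r ^ DIM('a))"
    proof -
      have "r powr - (real DIM('a) + s) * r ^ DIM('a) = r powr - s"
        using r by (simp add: powr_realpow[symmetric] powr_add[symmetric])
      then have "?v / 2 * r powr - s = r powr - (real DIM('a) + s) / 2 * (?v * r ^ DIM('a))" by (simp add: field_simps)
      then show ?thesis by (simp only:) (rule ennreal_mult, use r in auto)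
    qed
    also have "\<dots> \<le> ennreal (r powr - (real DIM('a) + s) / 2) * (2 * emeasure lborel (ball x r - E))"
      using half unfolding b by (intro mult_left_mono) auto
    also have "\<dots> = ennreal (r powr - (real DIM('a) + s)) * emeasure lborel (ball x r - E)"
    proof -
      have "ennreal (r powr - (real DIM('a) + s)) = ennreal (r powr - (real DIM('a) + s) / 2) * 2"
        by (subst ennreal_numeral[symmetric], subst ennreal_mult[symmetric]) auto
      then show ?thesis by (simp add: mult.assoc)
    qed
    also have "\<dots> = (\<integral>\<^sup>+y. ennreal (r powr - (real DIM('a) + s)) * indicator (ball x r - E) y \<partial>lborel)"
      by (rule nn_integral_cmult_indicator[symmetric]) measurable
    also have "\<dots> \<le> (\<integral>\<^sup>+y. riesz_kernel s (x - y) * indicator (- E) y \<partial>lborel)"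
    proof (rule nn_integral_mono)
      fix y
      show "ennreal (r powr - (real DIM('a) + s)) * indicator (ball x r - E) y \<le> riesz_kernel s (x - y) * indicator (- E) y"
      proof (cases "y \<in> ball x r - E")
        case True
        then have "norm (x - y) \<le> r" by (auto simp: dist_norm)
        then have "ennreal (r powr - (real DIM('a) + s)) \<le> riesz_kernel s (x - y)"
          using s by (auto simp: riesz_kernel_def intro!: ennreal_leI powr_mono2')
        then show ?thesis using True by simp
      qed simp
    qed
    finally show ?thesis .
  qed
  have "ennreal (?v / 2 * r powr - s) * emeasure lborel T = (\<integral>\<^sup>+x. ennreal (?v / 2 * r powr - s) * indicator T x \<partial>lborel)"
    by (rule nn_integral_cmult_indicator[symmetric]) measurable
  also have "\<dots> \<le> (\<integral>\<^sup>+x. (\<integral>\<^sup>+y. riesz_kernel s (x - y) * indicator (- E) y \<partial>lborel) * indicator T x \<partial>lborel)"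
  proof (rule nn_integral_mono)
    fix x
    show "ennreal (?v / 2 * r powr - s) * indicator T x \<le> (\<integral>\<^sup>+y. riesz_kernel s (x - y) * indicator (- E) y \<partial>lborel) * indicator T x"
      using low[of x] by (cases "x \<in> T") (auto simp del: times_divide_eq_left)
  qed
  also have "\<dots> = interaction (riesz_kernel s) T (- E)"
    unfolding interaction_def by (intro nn_integral_cong) (simp add: indicator_def)
  finally show ?thesis .
qed


text \<open>The properties that stability relies on, in a form that survives dilations. In the last
  clause, \<open>v\<close> is within 60 degrees of \<open>x\<close>, and the slide from
  \<open>y\<close> may go as far as its mirror image in the hyperplane orthogonal to
  \<open>v\<close>.\<close>

definition radially_monotone :: "'a::euclidean_space set \<Rightarrow> bool" where
  "radially_monotone E \<longleftrightarrow>
     (\<forall>x\<in>E. - x \<in> E) \<and> (\<forall>x\<in>E. \<forall>t. 0 \<le> t \<and> t \<le> 1 \<longrightarrow> t *\<^sub>R x \<in> E) \<and>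
     (\<forall>x. \<exists>v. norm v = 1 \<and> norm x \<le> 2 * (x \<bullet> v) \<and>
        (\<forall>y\<in>E. \<forall>t. 0 \<le> t \<and> t \<le> 2 * (y \<bullet> v) \<longrightarrow> y - t *\<^sub>R v \<in> E))"

lemma ennreal_square_bound:
  assumes "c > 0" "d \<ge> 0" "ennreal c * w\<^sup>2 \<le> ennreal d"
  shows "w \<le> ennreal (sqrt d / sqrt c)"
proof (cases w)
  case (real x)
  have "ennreal (c * x\<^sup>2) \<le> ennreal d"
    using assms real by (simp add: ennreal_mult' ennreal_power)
  then have "c * x\<^sup>2 \<le> d" using assms by simp
  then have "x\<^sup>2 \<le> d / c" using assms by (simp add: field_simps)
  then have "x \<le> sqrt (d / c)" by (rule real_le_rsqrt)
  then show ?thesis using real by (simp add: real_sqrt_divide ennreal_leI)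
next
  case top
  then show ?thesis using assms by (simp add: ennreal_mult_top power2_eq_square top_unique)
qed

lemma measure_le_of_emeasure:
  assumes "c > 0" "D \<ge> 0" "ennreal c * emeasure M A \<le> ennreal D"
  shows "measure M A \<le> D / c" "emeasure M A = ennreal (measure M A)"
proof -
  have fin: "emeasure M A \<noteq> \<infinity>"
    using assms by (auto simp: ennreal_mult_top top_unique)
  then show eq: "emeasure M A = ennreal (measure M A)" by (simp add: emeasure_eq_ennreal_measure)
  have "ennreal (c * measure M A) \<le> ennreal D"
    using assms by (simp add: eq ennreal_mult')
  then have "c * measure M A \<le> D" using assms by simp
  then show "measure M A \<le> D / c" using assms by (simp add: field_simps)
qed

theorem fractional_isoperimetric_stability:
  fixes s :: real
  assumes s: "0 < s" "s < 1"
  obtains C where "C > 0"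
    and "\<And>(E::'a::euclidean_space set) \<delta>. E \<in> sets borel \<Longrightarrow>
      emeasure lborel E = emeasure lborel (ball (0::'a) 1) \<Longrightarrow> radially_monotone E \<Longrightarrow> 0 \<le> \<delta> \<Longrightarrow>
      perimeter (riesz_kernel s) E \<le> perimeter (riesz_kernel s) (ball (0::'a) 1) + ennreal \<delta> \<Longrightarrow>
      measure lborel (E - ball 0 1) \<le> C * sqrt \<delta>"
proof -
  let ?k = "riesz_kernel s :: 'a \<Rightarrow> ennreal" and ?B = "ball 0 1 :: 'a set"
  define v where "v = unit_ball_vol (real DIM('a))"
  have v: "v > 0" by (simp add: v_def)
  have Bv: "emeasure lborel ?B = ennreal v" by (simp add: emeasure_ball v_def)
  define Pb where "Pb = enn2real (perimeter ?k ?B)"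
  have Pb: "perimeter ?k ?B = ennreal Pb" "Pb \<ge> 0"
    using perimeter_riesz_ball_finite[OF s, where 'a='a] by (simp_all add: Pb_def)
  define C1 where "C1 = enn2real (\<integral>\<^sup>+z. ennreal (min (norm z) 1) * ?k z \<partial>lborel)"
  have C1: "(\<integral>\<^sup>+z. ennreal (min (norm z) 1) * ?k z \<partial>lborel) = ennreal C1" "C1 \<ge> 0"
    using riesz_kernel_min_integrable[OF s, where 'a='a] by (simp_all add: C1_def)
  \<comment> \<open>A cut-off tail of volume \<open>t\<close> saves at least \<open>L * t\<close>.
    This exceeds by \<open>t\<close> the sum of \<open>(C1 + 1) * t\<close>, its share in the cost
    of the cut, and \<open>Pb / v * t\<close>, the loss in the isoperimetric bound.\<close>
  define L where "L = C1 + 1 + Pb / v + 1"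
  have "Pb / v \<ge> 0" using Pb v by simp
  then have L: "L > 0" using C1 by (simp add: L_def)
  \<comment> \<open>Solves \<open>v / 2 * r powr - s = L\<close>, so that sets thin at scale
    \<open>r\<close> have energy density at least \<open>L\<close>.\<close>
  define r where "r = (2 * L / v) powr (- 1 / s)"
  have r: "r > 0" using L v by (simp add: r_def)
  have rL: "v / 2 * r powr - s = L"
    using L v s by (simp add: r_def powr_powr)
  obtain N :: nat where N: "real N \<ge> 2 / r ^ DIM('a)" using real_arch_simple by blast
  \<comment> \<open>At distance \<open>R\<close> there is room for \<open>N\<close> disjoint slides
    of \<open>E \<inter> ball x r\<close>, so \<open>E\<close> fills at most half of
    \<open>ball x r\<close>. Moreover \<open>R \<ge> 2\<close> makes \<open>ball 0 R\<close> at
    least twice as large as \<open>E\<close>.\<close>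
  define R where "R = max 2 (2 * r * real N)"
  have R: "R \<ge> 2" "R \<ge> 2 * r * real N" by (auto simp: R_def)
  define Q where "Q = 2 * R"
  have Q: "Q > 0" using R by (simp add: Q_def)
  define p where "p = (real DIM('a) + s) / 2"
  have p: "p > 0" using s by (simp add: p_def add_nonneg_pos)
  define c0 where "c0 = 2 * p * (4 * Q\<^sup>2 + 1) powr (- p - 1)"
  have "4 * Q\<^sup>2 + 1 > 0" by (simp add: add_nonneg_pos)
  then have c0: "c0 > 0" using p by (simp add: c0_def)
  define c where "c = measure lborel (ball (0::'a) (1/2)) / (32 * 20 ^ DIM('a))"
  have c: "c > 0" by (simp add: c_def)
  define K where "K = v / sqrt c0"
  have K: "K > 0" using v c0 by (simp add: K_def)
  define C where "C = v + (C1 + 2) * (K / c) + 1"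
  have C: "C > 0" using v C1 K c by (simp add: C_def add_pos_nonneg)
  have main: "measure lborel (E - ?B) \<le> C * sqrt \<delta>"
    if E[measurable]: "E \<in> sets borel" and vol: "emeasure lborel E = emeasure lborel ?B" and E_mono: "radially_monotone E"
      and \<delta>: "0 \<le> \<delta>" and P: "perimeter ?k E \<le> perimeter ?k ?B + ennreal \<delta>" for E \<delta>
  proof -
    have [measurable]: "ball (0::'a) q \<in> sets borel" for q by auto
    have even: "\<And>x. x \<in> E \<Longrightarrow> - x \<in> E" and star: "\<And>x t. x \<in> E \<Longrightarrow> 0 \<le> t \<Longrightarrow> t \<le> 1 \<Longrightarrow> t *\<^sub>R x \<in> E"
      using E_mono by (auto simp: radially_monotone_def)
    have Ev: "emeasure lborel E = ennreal v" using vol Bv by simp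
    have finE: "emeasure lborel A = ennreal (measure lborel A)" if "A \<subseteq> E" "A \<in> sets borel" for A
      using that emeasure_mono[of A E lborel] Ev by (intro emeasure_eq_ennreal_measure) (auto simp: top_unique)
    have finB: "emeasure lborel A = ennreal (measure lborel A)" if "A \<subseteq> ball 0 q" for A :: "'a set" and q
      using that by (rule emeasure_lborel_eq_measure_subset_ball)
    define D where "D = K * sqrt \<delta>"
    have D: "D \<ge> 0" using K \<delta> by (simp add: D_def)
    have W: "mean_defect Q E \<le> ennreal D"
    proof -
      have "reflection_defect Q E u \<le> ennreal (sqrt \<delta> / sqrt c0)" if "u \<noteq> 0" for u
        using reflection_defect_le_deficit[OF s E vol even P that Q] c0 \<delta>
        by (intro ennreal_square_bound) (auto simp: c0_def p_def)
      then have "mean_defect Q E \<le> (\<integral>\<^sup>+u. ennreal (sqrt \<delta> / sqrt c0) * indicator ?B u \<partial>lborel)"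
        unfolding mean_defect_def
        by (intro nn_integral_mono_AE eventually_mono[OF AE_lborel_singleton[of 0]] mult_right_mono) auto
      also have "\<dots> = ennreal (sqrt \<delta> / sqrt c0) * emeasure lborel ?B"
        by (rule nn_integral_cmult_indicator) measurable
      also have "\<dots> = ennreal D" using v c0 \<delta> by (simp add: Bv D_def K_def ennreal_mult'[symmetric] mult.commute)
      finally show ?thesis .
    qed
    have alt: "measure lborel (ball 0 q - E) \<le> D / (c * q) \<or> measure lborel (E \<inter> ball 0 Q - ball 0 q) \<le> D / (c * q)"
      if q: "0 < q" "q \<le> Q" for q
      using star_shaped_defect_alternative[OF E even star q] W D c q
        measure_le_of_emeasure(1)[of "c * q" D lborel] unfolding c_def[symmetric]
      by (meson mult_pos_pos order_trans)
    have trivial: "measure lborel (E - ?B) \<le> v"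
    proof -
      have "ennreal (measure lborel (E - ?B)) \<le> ennreal v"
        using finE[of "E - ?B"] emeasure_mono[of "E - ?B" E lborel] Ev by simp
      then show ?thesis using v by simp
    qed
    have swapB: "measure lborel (E - ?B) = measure lborel (?B - E)"
    proof -
      have "ennreal (measure lborel (E - ?B)) + ennreal (measure lborel (E \<inter> ?B)) = emeasure lborel E"
        unfolding finE[of "E - ?B", symmetric, OF Diff_subset, simplified] finE[of "E \<inter> ?B", symmetric, OF Int_lower1, simplified]
        by (subst plus_emeasure) (auto intro!: arg_cong[where f="emeasure lborel"])
      moreover have "ennreal (measure lborel (?B - E)) + ennreal (measure lborel (E \<inter> ?B)) = emeasure lborel ?B"
        unfolding finB[of "?B - E", symmetric, OF Diff_subset] finE[of "E \<inter> ?B", symmetric, OF Int_lower1, simplified]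
        by (subst plus_emeasure) (auto intro!: arg_cong[where f="emeasure lborel"])
      ultimately have "ennreal (measure lborel (E - ?B) + measure lborel (E \<inter> ?B)) = ennreal (measure lborel (?B - E) + measure lborel (E \<inter> ?B))"
        using vol by simp
      then show ?thesis by (subst (asm) ennreal_inj) auto
    qed
    \<comment> \<open>The alternative is used at the radii \<open>1\<close> and \<open>R\<close>. At
      \<open>1\<close>, missing and excess volume agree; at \<open>R\<close>, the ball always misses
      at least \<open>v\<close>, so the first option there means that \<open>D / c\<close> already
      exceeds the trivial bound \<open>v\<close>.\<close>
    consider (big) "measure lborel (E - ?B) \<le> D / c" | (large_defect) "v \<le> D / c"
      | (small) "measure lborel (E \<inter> ball 0 Q - ?B) \<le> D / c" "measure lborel (E \<inter> ball 0 Q - ball 0 R) \<le> D / c"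
    proof -
      have "measure lborel (ball 0 R - E) \<ge> v"
      proof -
        have "ennreal (v * 2) \<le> ennreal (v * R ^ DIM('a))"
        proof (intro ennreal_leI mult_left_mono)
          have "R ^ 1 \<le> R ^ DIM('a)" using R DIM_positive[where 'a='a] by (intro power_increasing) (auto simp: Suc_le_eq)
          then show "2 \<le> R ^ DIM('a)" using R by simp
        qed (use v in auto)
        also have "\<dots> = emeasure lborel (ball (0::'a) R)" using R by (simp add: emeasure_ball v_def)
        also have "\<dots> \<le> emeasure lborel E + emeasure lborel (ball 0 R - E)"
          by (subst plus_emeasure) (auto intro!: emeasure_mono)
        also have "\<dots> = ennreal (v + measure lborel (ball 0 R - E))"
          using v by (simp add: Ev finB[of "ball 0 R - E" R])
        finally have "v * 2 \<le> v + measure lborel (ball 0 R - E)"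
          using v by (subst (asm) ennreal_le_iff) (auto simp: add_nonneg_nonneg)
        then show ?thesis by simp
      qed
      moreover have "D / (c * R) \<le> D / c" using D c R by (intro divide_left_mono) auto
      ultimately show ?thesis
        using alt[of 1] alt[of R] R that swapB by (fastforce simp: Q_def)
    qed
    then have "measure lborel (E - ?B) \<le> (C1 + 2) * (D / c) + \<delta> \<or> v \<le> D / c"
    proof cases
      case big
      have "1 * (D / c) \<le> (C1 + 2) * (D / c)" using D c C1 by (intro mult_right_mono) auto
      then show ?thesis using big \<delta> by (intro disjI1) linarith
    next
      case small
      have "emeasure lborel E \<noteq> \<infinity>" using Ev by simp
      then obtain \<rho> where \<rho>: "R \<le> \<rho>" "\<rho> \<le> 2 * R"
        and cut: "interaction ?k (E \<inter> ball 0 \<rho>) (E - ball 0 \<rho>) \<le> (ennreal C1 + 1) * emeasure lborel (E - ball 0 R)"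
        using exists_good_cut[OF s E, of R] R unfolding C1(1) by auto
      define T where "T = E - ball 0 \<rho>"
      define F where "F = E \<inter> ball 0 \<rho>"
      have [measurable]: "T \<in> sets borel" "F \<in> sets borel" by (simp_all add: T_def F_def)
      define t where "t = measure lborel T"
      have t: "emeasure lborel T = ennreal t" "t \<ge> 0"
        unfolding t_def by (auto simp: T_def intro!: finE)
      have Fv: "emeasure lborel F = ennreal (v - t)" "t \<le> v"
      proof -
        have "ennreal (measure lborel F) + ennreal t = ennreal v"
          unfolding t(1)[symmetric] Ev[symmetric] finE[of F, symmetric, unfolded F_def, OF Int_lower1, simplified, folded F_def]
          by (subst plus_emeasure) (auto simp: F_def T_def intro!: arg_cong[where f="emeasure lborel"])
        then have "ennreal (measure lborel F + t) = ennreal v" using t by simp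
        then have "measure lborel F + t = v" using v t by (subst (asm) ennreal_inj) auto
        then have "measure lborel F = v - t" by simp
        then show "emeasure lborel F = ennreal (v - t)" "t \<le> v"
          using finE[of F] measure_nonneg[of lborel F] by (auto simp: F_def)
      qed
      have tail: "measure lborel (E - ball 0 R) \<le> t + D / c"
      proof -
        have "E - ball 0 R \<subseteq> T \<union> (E \<inter> ball 0 Q - ball 0 R)" using \<rho> by (auto simp: T_def Q_def)
        then have "emeasure lborel (E - ball 0 R) \<le> emeasure lborel (T \<union> (E \<inter> ball 0 Q - ball 0 R))"
          by (intro emeasure_mono) auto
        also have "\<dots> \<le> emeasure lborel T + emeasure lborel (E \<inter> ball 0 Q - ball 0 R)"
          by (intro emeasure_subadditive) auto
        also have "\<dots> = ennreal (t + measure lborel (E \<inter> ball 0 Q - ball 0 R))"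
          using t by (simp add: finE[of "E \<inter> ball 0 Q - ball 0 R"] le_infI1 Diff_subset subset_trans[OF Diff_subset])
        finally have "ennreal (measure lborel (E - ball 0 R)) \<le> ennreal (t + measure lborel (E \<inter> ball 0 Q - ball 0 R))"
          by (simp add: finE[of "E - ball 0 R"])
        then have "measure lborel (E - ball 0 R) \<le> t + measure lborel (E \<inter> ball 0 Q - ball 0 R)"
          using t by (subst (asm) ennreal_le_iff) auto
        then show ?thesis using small by simp
      qed
      have I: "interaction ?k F T \<le> ennreal ((C1 + 1) * (t + D / c))"
      proof -
        have "interaction ?k F T \<le> (ennreal C1 + 1) * emeasure lborel (E - ball 0 R)"
          using cut by (simp add: F_def T_def)
        also have "\<dots> = ennreal ((C1 + 1) * measure lborel (E - ball 0 R))"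
          using C1 by (simp add: finE[of "E - ball 0 R"] ennreal_mult' ennreal_plus[symmetric] del: ennreal_plus flip: ennreal_1)
        also have "\<dots> \<le> ennreal ((C1 + 1) * (t + D / c))"
          using tail C1 by (intro ennreal_leI mult_left_mono) auto
        finally show ?thesis .
      qed
      have thin: "ennreal L * ennreal t \<le> interaction ?k T (- E)"
        unfolding rL[symmetric] v_def t(1)[symmetric]
      proof (rule interaction_lower_of_thin[OF s(1) E _ r])
        fix x assume x: "x \<in> T"
        then have xR: "norm x \<ge> R" using \<rho> by (auto simp: T_def)
        obtain d where d: "norm d = 1" "norm x \<le> 2 * (x \<bullet> d)"
          "\<And>y t. y \<in> E \<Longrightarrow> 0 \<le> t \<Longrightarrow> t \<le> 2 * (y \<bullet> d) \<Longrightarrow> y - t *\<^sub>R d \<in> E"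
          using E_mono unfolding radially_monotone_def by meson
        have "ennreal (real N) * emeasure lborel (E \<inter> ball x r) \<le> ennreal v"
          using monotone_direction_density[OF E d r, of N] xR R Ev by simp
        moreover have "real N > 0" using N r by (smt (verit) divide_pos_pos zero_less_power)
        ultimately have "measure lborel (E \<inter> ball x r) \<le> v / real N"
          and eq: "emeasure lborel (E \<inter> ball x r) = ennreal (measure lborel (E \<inter> ball x r))"
          using measure_le_of_emeasure[of "real N" v lborel "E \<inter> ball x r"] v by auto
        moreover have "v / real N \<le> v * r ^ DIM('a) / 2"
        proof -
          have "2 \<le> real N * r ^ DIM('a)" using N r by (simp add: pos_divide_le_eq)
          then have "v * 2 \<le> v * (real N * r ^ DIM('a))" using v by (intro mult_left_mono) auto
          then show ?thesis using \<open>real N > 0\<close> by (simp add: field_simps)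
        qed
        ultimately have "2 * measure lborel (E \<inter> ball x r) \<le> v * r ^ DIM('a)" by linarith
        then have "ennreal (2 * measure lborel (E \<inter> ball x r)) \<le> ennreal (v * r ^ DIM('a))" by (rule ennreal_leI)
        then show "2 * emeasure lborel (E \<inter> ball x r) \<le> emeasure lborel (ball x r)"
          using r by (subst eq) (simp add: emeasure_ball v_def ennreal_mult')
      qed measurable
      \<comment> \<open>The isoperimetric inequality at volume \<open>v - t\<close>, made linear in
        \<open>t\<close> by the crude scaling bound for balls.\<close>
      have PF: "ennreal ((1 - t / v) * Pb) \<le> perimeter ?k F"
      proof -
        define q where "q = root DIM('a) (1 - t / v)"
        have tv: "0 \<le> 1 - t / v" "1 - t / v \<le> 1" using Fv v t by (auto simp: divide_le_eq_1)
        have q: "q \<ge> 0" "q \<le> 1" "q ^ DIM('a) = 1 - t / v"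
          using tv by (auto simp: q_def)
        have "emeasure lborel F = emeasure lborel (ball (0::'a) q)"
          using q v by (simp add: Fv emeasure_ball v_def[symmetric] right_diff_distrib)
        then have "perimeter ?k (ball (0::'a) q) \<le> perimeter ?k F"
          using q by (intro perimeter_riesz_ball_le s) auto
        moreover have "ennreal ((1 - t / v) * Pb) \<le> perimeter ?k (ball (0::'a) q)"
          using perimeter_riesz_ball_lower[OF s(1) q(1,2), where 'a='a] tv by (simp add: q Pb ennreal_mult')
        ultimately show ?thesis by (rule order_trans[rotated])
      qed
      \<comment> \<open>Cutting trades the interaction of \<open>T\<close> with the complement of
        \<open>E\<close> for the interaction of \<open>F\<close> with \<open>T\<close>; the additive
        form needs no subtraction in \<open>ennreal\<close>.\<close>
      have "perimeter ?k E + interaction ?k F T = perimeter ?k F + interaction ?k T (- E)"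
      proof -
        have "perimeter ?k E = interaction ?k (F \<union> T) (- E)"
          unfolding perimeter_def by (rule arg_cong[where f="\<lambda>U. interaction ?k U (- E)"]) (auto simp: F_def T_def)
        also have "\<dots> = interaction ?k F (- E) + interaction ?k T (- E)"
          by (rule interaction_Un_left) (auto simp: F_def T_def)
        finally have 1: "perimeter ?k E = interaction ?k F (- E) + interaction ?k T (- E)" .
        have "perimeter ?k F = interaction ?k F (- E \<union> T)"
          unfolding perimeter_def by (rule arg_cong[where f="interaction ?k F"]) (auto simp: F_def T_def)
        also have "\<dots> = interaction ?k F (- E) + interaction ?k F T"
          by (rule interaction_Un_right) (auto simp: F_def T_def)
        finally show ?thesis using 1 by (simp add: ac_simps)
      qed
      then have "ennreal ((1 - t / v) * Pb) + ennreal L * ennreal t \<le> perimeter ?k E + interaction ?k F T"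
        using PF thin by (simp add: add_mono)
      also have "\<dots> \<le> (ennreal Pb + ennreal \<delta>) + ennreal ((C1 + 1) * (t + D / c))"
        using P I unfolding Pb(1) by (intro add_mono)
      finally have "ennreal ((1 - t / v) * Pb + L * t) \<le> ennreal (Pb + \<delta> + (C1 + 1) * (t + D / c))"
      proof -
        assume *: "ennreal ((1 - t / v) * Pb) + ennreal L * ennreal t \<le> (ennreal Pb + ennreal \<delta>) + ennreal ((C1 + 1) * (t + D / c))"
        have "0 \<le> (1 - t / v) * Pb" using Fv v Pb by (simp add: divide_le_eq_1)
        moreover have "0 \<le> (C1 + 1) * (t + D / c)" using C1 t D c by simp
        ultimately show ?thesis using * L t Pb \<delta>
          by (simp add: ennreal_mult'[symmetric])
      qed
      then have "(1 - t / v) * Pb + L * t \<le> Pb + \<delta> + (C1 + 1) * (t + D / c)"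
        using Pb \<delta> C1 t D c by (subst (asm) ennreal_le_iff) auto
      \<comment> \<open>By the choice of \<open>L\<close>, the terms containing \<open>t\<close>
        collapse to a single \<open>t\<close> on the left.\<close>
      then have tb: "t \<le> \<delta> + (C1 + 1) * (D / c)"
        by (simp add: L_def algebra_simps)
      have "measure lborel (E - ?B) \<le> D / c + t"
      proof -
        have "E - ?B \<subseteq> (E \<inter> ball 0 Q - ?B) \<union> T" using \<rho> by (auto simp: T_def Q_def)
        then have "emeasure lborel (E - ?B) \<le> emeasure lborel ((E \<inter> ball 0 Q - ?B) \<union> T)"
          by (intro emeasure_mono) auto
        also have "\<dots> \<le> emeasure lborel (E \<inter> ball 0 Q - ?B) + emeasure lborel T"
          by (intro emeasure_subadditive) auto
        also have "\<dots> = ennreal (measure lborel (E \<inter> ball 0 Q - ?B) + t)"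
          using t by (simp add: finE[of "E \<inter> ball 0 Q - ?B"] subset_trans[OF Diff_subset])
        finally have "ennreal (measure lborel (E - ?B)) \<le> ennreal (measure lborel (E \<inter> ball 0 Q - ?B) + t)"
          by (simp add: finE[of "E - ?B"])
        then have "measure lborel (E - ?B) \<le> measure lborel (E \<inter> ball 0 Q - ?B) + t"
          using t by (subst (asm) ennreal_le_iff) auto
        then show ?thesis using small by simp
      qed
      moreover have "(C1 + 2) * (D / c) = (C1 + 1) * (D / c) + D / c"
        by (simp add: ring_distribs add_divide_distrib)
      ultimately show ?thesis using tb by (intro disjI1) linarith
    qed simp
    moreover have Dc: "(C1 + 2) * (D / c) = (C1 + 2) * (K / c) * sqrt \<delta>" by (simp add: D_def)
    moreover have "C * sqrt \<delta> = v * sqrt \<delta> + (C1 + 2) * (K / c) * sqrt \<delta> + sqrt \<delta>"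
      by (simp add: C_def distrib_right)
    moreover have "D / c \<le> (C1 + 2) * (D / c)"
      using mult_right_mono[of 1 "C1 + 2" "D / c"] D c C1 by simp
    \<comment> \<open>For \<open>\<delta> > 1\<close> the summand \<open>\<delta>\<close> is not
      controlled by its square root, but then the trivial bound \<open>v\<close> is below
      \<open>v * sqrt \<delta>\<close>.\<close>
    moreover have "\<delta> \<le> sqrt \<delta> \<or> v \<le> v * sqrt \<delta>"
    proof (cases "\<delta> \<le> 1")
      case True
      then have "\<delta> * \<delta> \<le> \<delta> * 1" using \<delta> by (intro mult_left_mono) auto
      then have "\<delta> \<le> sqrt \<delta>" by (intro real_le_rsqrt) (simp add: power2_eq_square)
      then show ?thesis by simp
    next
      case False
      then show ?thesis using v by simp
    qed
    moreover have "0 \<le> v * sqrt \<delta>" "0 \<le> sqrt \<delta>" "0 \<le> (C1 + 2) * (K / c) * sqrt \<delta>" using v \<delta> C1 K c by auto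
    ultimately show ?thesis using trivial by (elim disjE) linarith+
  qed
  show ?thesis by (rule that[OF C main])
qed

section \<open>The periodic strip\<close>

lemma nn_integral_lborel_pair:
  fixes f :: "'a::euclidean_space \<times> 'b::euclidean_space \<Rightarrow> ennreal"
  assumes [measurable]: "f \<in> borel_measurable borel"
  shows "(\<integral>\<^sup>+p. f p \<partial>lborel) = (\<integral>\<^sup>+x. (\<integral>\<^sup>+y. f (x, y) \<partial>lborel) \<partial>lborel)"
proof -
  have "f \<in> borel_measurable (lborel \<Otimes>\<^sub>M lborel)" by (simp add: lborel_prod)
  then show ?thesis
    unfolding lborel_prod[symmetric] by (rule lborel.nn_integral_fst[symmetric])
qed

lemma emeasure_lborel_Times:
  assumes "A \<in> sets borel" "B \<in> sets borel"
  shows "emeasure lborel (A \<times> B) = emeasure lborel A * emeasure lborel B"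
  using assms unfolding lborel_prod[symmetric] by (simp add: lborel.emeasure_pair_measure_Times)

text \<open>Such a set is a union of open rays plus at most one point, its maximum. This gives
  measurability of monotone profiles with values in \<open>ennreal\<close>.\<close>

lemma borel_downset:
  fixes D :: "real set"
  assumes down: "\<And>x y. x \<in> D \<Longrightarrow> y \<le> x \<Longrightarrow> y \<in> D"
  shows "D \<in> sets borel"
proof -
  define U where "U = (\<Union>d\<in>D. {..<d})"
  have "finite (D - U)"
  proof (cases "D - U = {}")
    case False
    then obtain m where m: "m \<in> D - U" by blast
    have "x = m" if "x \<in> D - U" for x
      using m that by (cases x m rule: linorder_cases) (auto simp: U_def)
    then have "D - U \<subseteq> {m}" by blast
    then show ?thesis by (rule finite_subset) simp
  qed (simp only: finite.emptyI)
  moreover have "U \<in> sets borel" unfolding U_def by (intro borel_open open_UN) auto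
  moreover have "D = U \<union> (D - U)" using down by (auto simp: U_def)
  ultimately show ?thesis by (metis finite_imp_closed borel_closed sets.Un)
qed

text \<open>What remains of \<open>classK\<close> when the profile is forgotten. Unlike the class
  itself, whose sets live in a fixed strip, this property is stable under dilations.\<close>

definition orthant_monotone :: "(real \<times> 'b::euclidean_space) set \<Rightarrow> bool" where
  "orthant_monotone F \<longleftrightarrow> (\<forall>p\<in>F. \<forall>q. \<bar>fst q\<bar> \<le> \<bar>fst p\<bar> \<and> norm (snd q) \<le> norm (snd p) \<longrightarrow> q \<in> F)"

lemma strip_iff: "p \<in> strip \<longleftrightarrow> \<bar>fst p\<bar> \<le> 1/2"
  by (cases p) (auto simp: strip_def)

lemma strip_borel[measurable]: "strip \<in> sets borel"
  unfolding strip_def by (intro borel_closed closed_Times) auto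

text \<open>The radius \<open>\<rho>\<close> is the value of the profile at \<open>1/4\<close>. By
  monotonicity it bounds the set further out, and the cylinder of that radius over
  \<open>{1/8..1/4}\<close> lies inside, so volume bounds turn into bounds on \<open>\<rho>\<close>;
  finite volume makes it finite.\<close>

lemma classK_properties:
  fixes F :: "(real \<times> 'b::euclidean_space) set"
  assumes F: "F \<in> classK"
  shows "F \<in> sets borel" "F \<subseteq> strip" "orthant_monotone F"
    "emeasure lborel F \<noteq> \<infinity> \<Longrightarrow> \<exists>\<rho>\<ge>0. (\<forall>p\<in>F. 1/4 \<le> \<bar>fst p\<bar> \<longrightarrow> norm (snd p) \<le> \<rho>) \<and> {1/8..1/4} \<times> cball 0 \<rho> \<subseteq> F"
proof -
  obtain f :: "real \<Rightarrow> ennreal" where even: "\<And>t. t \<in> {-1/2..1/2} \<Longrightarrow> f (- t) = f t"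
    and anti: "\<And>a b. 0 \<le> a \<Longrightarrow> a \<le> b \<Longrightarrow> b \<le> 1/2 \<Longrightarrow> f b \<le> f a"
    and Feq: "F = {p \<in> strip. ennreal (norm (snd p)) \<le> f (fst p)}"
    using F unfolding classK_def by blast
  have f_abs: "f \<bar>t\<bar> = f t" if "\<bar>t\<bar> \<le> 1/2" for t
    using even[of t] that by (cases "t \<ge> 0") auto
  \<comment> \<open>Clamping the argument extends the profile from \<open>{0..1/2}\<close> to a
    decreasing function on the whole line.\<close>
  define g where "g = (\<lambda>t. f (min (max t 0) (1/2)))"
  have g_anti: "g b \<le> g a" if "a \<le> b" for a b
    unfolding g_def using that by (intro anti) auto
  have [measurable]: "g \<in> borel_measurable borel"
  proof (rule borel_measurableI_ge)
    fix y
    show "{x \<in> space borel. y \<le> g x} \<in> sets borel"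
      using g_anti by (intro borel_downset) (auto intro: order_trans)
  qed
  have "F = {p. \<bar>fst p\<bar> \<le> 1/2 \<and> ennreal (norm (snd p)) \<le> g \<bar>fst p\<bar>}"
    unfolding Feq by (auto simp: strip_iff g_def f_abs max_def min_def)
  also have "\<dots> = {p \<in> space ((borel :: real measure) \<Otimes>\<^sub>M (borel :: 'b measure)). \<bar>fst p\<bar> \<le> 1/2 \<and> ennreal (norm (snd p)) \<le> g \<bar>fst p\<bar>}"
    by (simp add: space_pair_measure)
  also have "\<dots> \<in> sets ((borel :: real measure) \<Otimes>\<^sub>M (borel :: 'b measure))" by measurable
  also have "sets ((borel :: real measure) \<Otimes>\<^sub>M (borel :: 'b measure)) = sets (borel :: (real \<times> 'b) measure)" by (rule arg_cong[where f=sets, OF borel_prod])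
  finally show "F \<in> sets borel" .
  show "F \<subseteq> strip" by (auto simp: Feq)
  show mono: "orthant_monotone F"
    unfolding orthant_monotone_def
  proof (intro ballI allI impI)
    fix p q :: "real \<times> 'b" assume p: "p \<in> F" and q: "\<bar>fst q\<bar> \<le> \<bar>fst p\<bar> \<and> norm (snd q) \<le> norm (snd p)"
    have ps: "\<bar>fst p\<bar> \<le> 1/2" "ennreal (norm (snd p)) \<le> f (fst p)" using p by (auto simp: Feq strip_iff)
    have "ennreal (norm (snd q)) \<le> ennreal (norm (snd p))" using q by (intro ennreal_leI) auto
    also have "\<dots> \<le> f \<bar>fst p\<bar>" using ps by (simp add: f_abs)
    also have "\<dots> \<le> f \<bar>fst q\<bar>" using ps q by (intro anti) auto
    also have "\<dots> = f (fst q)" using ps q by (intro f_abs) auto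
    finally show "q \<in> F" using ps q by (auto simp: Feq strip_iff)
  qed
  have in_F: "p \<in> F" if "\<bar>fst p\<bar> \<le> 1/4" "ennreal (norm (snd p)) \<le> f (1/4)" for p
  proof -
    have "f (1/4) \<le> f \<bar>fst p\<bar>" using that by (intro anti) auto
    also have "\<dots> = f (fst p)" using that by (intro f_abs) auto
    finally show ?thesis using that by (auto simp: Feq strip_iff intro: order_trans)
  qed
  assume fin: "emeasure lborel F \<noteq> \<infinity>"
  have "f (1/4) \<noteq> \<infinity>"
  proof
    assume top: "f (1/4) = \<infinity>"
    have "emeasure lborel ({1/8..1/4::real} \<times> (UNIV::'b set)) \<le> emeasure lborel F"
      using \<open>F \<in> sets borel\<close> by (intro emeasure_mono) (auto intro!: in_F simp: top)
    moreover have "emeasure lborel ({1/8..1/4::real} \<times> (UNIV::'b set)) = \<infinity>"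
      by (subst emeasure_lborel_Times) (auto simp: ennreal_mult_top)
    ultimately show False using fin by (simp add: top_unique)
  qed
  then obtain \<rho> where \<rho>: "\<rho> \<ge> 0" "f (1/4) = ennreal \<rho>" by (cases "f (1/4)") auto
  show "\<exists>\<rho>\<ge>0. (\<forall>p\<in>F. 1/4 \<le> \<bar>fst p\<bar> \<longrightarrow> norm (snd p) \<le> \<rho>) \<and> {1/8..1/4} \<times> cball 0 \<rho> \<subseteq> F"
  proof (intro exI[of _ \<rho>] conjI ballI impI subsetI)
    fix p assume p: "p \<in> F" "1/4 \<le> \<bar>fst p\<bar>"
    have ps: "\<bar>fst p\<bar> \<le> 1/2" "ennreal (norm (snd p)) \<le> f (fst p)" using p by (auto simp: Feq strip_iff)
    have "ennreal (norm (snd p)) \<le> f \<bar>fst p\<bar>" using ps by (simp add: f_abs)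
    also have "\<dots> \<le> f (1/4)" using ps p by (intro anti) auto
    finally show "norm (snd p) \<le> \<rho>" using \<rho> by simp
  next
    fix p :: "real \<times> 'b" assume "p \<in> {1/8..1/4} \<times> cball 0 \<rho>"
    then show "p \<in> F" by (intro in_F) (auto simp: \<rho> ennreal_leI)
  qed (use \<rho> in auto)
qed

text \<open>Slide along the larger of the two components of \<open>x\<close>: it has at least half
  the length of \<open>x\<close>. A slide that stops no later than the mirror image does not enlarge
  that component of \<open>y\<close> and leaves the other one alone.\<close>

lemma radially_monotone_scaled:
  fixes F :: "(real \<times> 'b::euclidean_space) set"
  assumes F: "orthant_monotone F" and l: "l > 0"
  shows "radially_monotone ((\<lambda>x. l *\<^sub>R x) -` F)"
proof -
  let ?E = "(\<lambda>x. l *\<^sub>R x) -` F"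
  have mono: "q \<in> ?E" if "p \<in> ?E" "\<bar>fst q\<bar> \<le> \<bar>fst p\<bar>" "norm (snd q) \<le> norm (snd p)" for p q
  proof -
    have "l *\<^sub>R p \<in> F" using that by simp
    moreover have "\<bar>fst (l *\<^sub>R q)\<bar> \<le> \<bar>fst (l *\<^sub>R p)\<bar>" "norm (snd (l *\<^sub>R q)) \<le> norm (snd (l *\<^sub>R p))"
      using that l by (auto simp: abs_mult)
    ultimately show ?thesis using F unfolding orthant_monotone_def by blast
  qed
  show ?thesis
    unfolding radially_monotone_def
  proof (intro conjI ballI allI impI)
    fix x assume "x \<in> ?E" then show "- x \<in> ?E" by (rule mono) auto
  next
    fix x t assume "x \<in> ?E" and t: "0 \<le> t \<and> t \<le> (1::real)"
    then show "t *\<^sub>R x \<in> ?E" by (rule_tac mono) (auto simp: abs_mult intro!: mult_left_le_one_le)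
  next
    fix x :: "real \<times> 'b"
    have nx: "(norm x)\<^sup>2 = \<bar>fst x\<bar>\<^sup>2 + (norm (snd x))\<^sup>2" by (simp add: norm_prod_def)
    have half: "norm x \<le> 2 * m" if "\<bar>fst x\<bar> \<le> m" "norm (snd x) \<le> m" for m
    proof (rule power2_le_imp_le)
      have "\<bar>fst x\<bar>\<^sup>2 \<le> m\<^sup>2" "(norm (snd x))\<^sup>2 \<le> m\<^sup>2" 
        using power_mono[OF that(1), of 2] power_mono[OF that(2), of 2] by simp_all
      then have "(norm x)\<^sup>2 \<le> 2 * m\<^sup>2" unfolding nx by linarith
      also have "\<dots> \<le> (2 * m)\<^sup>2" by (simp add: power_mult_distrib)
      finally show "(norm x)\<^sup>2 \<le> (2 * m)\<^sup>2" .
    qed (use that norm_ge_zero[of "snd x"] in linarith)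
    show "\<exists>v. norm v = 1 \<and> norm x \<le> 2 * (x \<bullet> v) \<and> (\<forall>y\<in>?E. \<forall>t. 0 \<le> t \<and> t \<le> 2 * (y \<bullet> v) \<longrightarrow> y - t *\<^sub>R v \<in> ?E)"
    proof (cases "norm (snd x) \<le> \<bar>fst x\<bar>")
      case True
      define a :: real where "a = (if fst x \<ge> 0 then 1 else -1)"
      have a: "\<bar>a\<bar> = 1" "fst x * a = \<bar>fst x\<bar>" by (auto simp: a_def)
      show ?thesis
      proof (intro exI[of _ "(a, 0)"] conjI ballI allI impI)
        show "norm (a, 0::'b) = 1" using a by (simp add: norm_prod_def)
        show "norm x \<le> 2 * (x \<bullet> (a, 0))" using half[of "\<bar>fst x\<bar>"] True a by (simp add: inner_prod_def)
        fix y t assume y: "y \<in> ?E" and t: "0 \<le> t \<and> t \<le> 2 * (y \<bullet> (a, 0::'b))"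
        have "\<bar>fst y - t * a\<bar> \<le> \<bar>fst y\<bar>"
          using t by (auto simp: a_def inner_prod_def split: if_splits)
        then show "y - t *\<^sub>R (a, 0) \<in> ?E" by (intro mono[OF y]) auto
      qed
    next
      case False
      define e where "e = (1 / norm (snd x)) *\<^sub>R snd x"
      have sx: "snd x \<noteq> 0" using False by auto
      have e: "norm e = 1" "snd x \<bullet> e = norm (snd x)"
        using sx by (auto simp: e_def power2_norm_eq_inner[symmetric] power2_eq_square)
      show ?thesis
      proof (intro exI[of _ "(0, e)"] conjI ballI allI impI)
        show "norm (0::real, e) = 1" using e by (simp add: norm_prod_def)
        show "norm x \<le> 2 * (x \<bullet> (0, e))" using half[of "norm (snd x)"] False e by (simp add: inner_prod_def)
        fix y t assume y: "y \<in> ?E" and t: "0 \<le> t \<and> t \<le> 2 * (y \<bullet> (0::real, e))"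
        have "norm (snd y - t *\<^sub>R e) \<le> norm (snd y)"
        proof (rule power2_le_imp_le)
          have ee: "e \<bullet> e = 1" using e by (simp add: norm_eq_1)
          have "(norm (snd y - t *\<^sub>R e))\<^sup>2 = (norm (snd y))\<^sup>2 - t * (2 * (snd y \<bullet> e) - t)"
            unfolding power2_norm_eq_inner by (simp add: inner_diff_left inner_diff_right inner_commute ee algebra_simps)
          also have "\<dots> \<le> (norm (snd y))\<^sup>2"
            using t by (simp add: inner_prod_def)
          finally show "(norm (snd y - t *\<^sub>R e))\<^sup>2 \<le> (norm (snd y))\<^sup>2" .
        qed simp
        then show "y - t *\<^sub>R (0, e) \<in> ?E" by (intro mono[OF y]) auto
      qed
    qed
  qed
qed

text \<open>Turns sums over the integers into series, for which measurability and comparison with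
  summable sequences are at hand.\<close>

lemma nn_integral_count_space_int:
  fixes f :: "int \<Rightarrow> ennreal"
  shows "(\<integral>\<^sup>+k. f k \<partial>count_space UNIV) = (\<Sum>n. f (int_decode n))"
  by (simp add: nn_integral_bij_count_space[OF bij_int_decode, symmetric] nn_integral_count_space_nat)

section \<open>Unfolding the periodic kernel\<close>

definition shift :: "int \<Rightarrow> (real \<times> 'b::euclidean_space) set \<Rightarrow> (real \<times> 'b) set" where
  "shift k A = (\<lambda>x. x - (real_of_int k, 0)) -` A"

lemma shift_borel[measurable (raw)]: "A \<in> sets borel \<Longrightarrow> shift k A \<in> sets borel"
  unfolding shift_def using measurable_sets_borel[of "\<lambda>x. x - (real_of_int k, 0)" borel A] by simp

lemma per_kernel_eq: "per_kernel s z = (\<integral>\<^sup>+k. riesz_kernel s (z + (real_of_int k, 0)) \<partial>count_space UNIV)"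
  unfolding per_kernel_def riesz_kernel_def Let_def by simp

text \<open>Each translation is moved from the kernel onto the set, so the periodic kernel on one
  strip becomes the Riesz kernel on all strips. The inner sum counts the translates of
  \<open>strip - F\<close> that contain \<open>y\<close>.\<close>

lemma per_P_eq:
  fixes F :: "(real \<times> 'b::euclidean_space) set"
  assumes [measurable]: "F \<in> sets borel" and F: "F \<subseteq> strip"
  shows "per_P s F = (\<integral>\<^sup>+x. (\<integral>\<^sup>+y. riesz_kernel s (x - y) * (\<integral>\<^sup>+k. indicator (shift k (strip - F)) y \<partial>count_space UNIV) \<partial>lborel) * indicator F x \<partial>lborel)"
proof -
  let ?k = "riesz_kernel s :: real \<times> 'b \<Rightarrow> ennreal"
  have FS: "F \<inter> strip = F" using F by auto
  have [measurable]: "shift k (strip - F) \<in> sets borel" for k by (rule shift_borel) measurable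
  have inner: "(\<integral>\<^sup>+x. per_kernel s (x - y) * indicator (strip - F) x \<partial>lborel) =
     (\<integral>\<^sup>+x. ?k (y - x) * (\<integral>\<^sup>+k. indicator (shift k (strip - F)) x \<partial>count_space UNIV) \<partial>lborel)" for y
  proof -
    have "(\<integral>\<^sup>+x. per_kernel s (x - y) * indicator (strip - F) x \<partial>lborel)
      = (\<integral>\<^sup>+x. (\<integral>\<^sup>+k. ?k (x - y + (real_of_int k, 0)) * indicator (strip - F) x \<partial>count_space UNIV) \<partial>lborel)"
      unfolding per_kernel_eq by (intro nn_integral_cong nn_integral_multc[symmetric]) simp
    also have "\<dots> = (\<integral>\<^sup>+k. (\<integral>\<^sup>+x. ?k (x - y + (real_of_int k, 0)) * indicator (strip - F) x \<partial>lborel) \<partial>count_space UNIV)"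
      by (rule nn_integral_count_space_nn_integral) (auto intro: countableI_type)
    also have "\<dots> = (\<integral>\<^sup>+k. (\<integral>\<^sup>+x. ?k (y - x) * indicator (shift k (strip - F)) x \<partial>lborel) \<partial>count_space UNIV)"
    proof (rule nn_integral_cong)
      fix k :: int
      have "(\<integral>\<^sup>+x. ?k (y - x) * indicator (shift k (strip - F)) x \<partial>lborel)
         = (\<integral>\<^sup>+x. ?k (y - (x + (real_of_int k, 0))) * indicator (shift k (strip - F)) (x + (real_of_int k, 0)) \<partial>lborel)"
        by (rule nn_integral_lborel_translate[symmetric]) measurable
      also have "\<dots> = (\<integral>\<^sup>+x. ?k (x - y + (real_of_int k, 0)) * indicator (strip - F) x \<partial>lborel)"
      proof (rule nn_integral_cong)
        fix x
        have "?k (y - (x + (real_of_int k, 0))) = ?k (x - y + (real_of_int k, 0))"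
          using riesz_kernel_minus[of s "x - y + (real_of_int k, 0)"] by (simp add: algebra_simps)
        then show "?k (y - (x + (real_of_int k, 0))) * indicator (shift k (strip - F)) (x + (real_of_int k, 0))
           = ?k (x - y + (real_of_int k, 0)) * indicator (strip - F) x"
          by (simp add: shift_def indicator_def)
      qed
      finally show "(\<integral>\<^sup>+x. ?k (x - y + (real_of_int k, 0)) * indicator (strip - F) x \<partial>lborel)
        = (\<integral>\<^sup>+x. ?k (y - x) * indicator (shift k (strip - F)) x \<partial>lborel)" by simp
    qed
    also have "\<dots> = (\<integral>\<^sup>+x. (\<integral>\<^sup>+k. ?k (y - x) * indicator (shift k (strip - F)) x \<partial>count_space UNIV) \<partial>lborel)"
      by (rule nn_integral_count_space_nn_integral[symmetric]) (auto intro: countableI_type)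
    also have "\<dots> = (\<integral>\<^sup>+x. ?k (y - x) * (\<integral>\<^sup>+k. indicator (shift k (strip - F)) x \<partial>count_space UNIV) \<partial>lborel)"
      by (intro nn_integral_cong nn_integral_cmult) simp
    finally show ?thesis .
  qed
  show ?thesis
    unfolding per_P_def FS nn_integral_completion inner ..
qed

text \<open>A point outside \<open>F\<close> lies in the translate of the strip chosen by rounding
  its first coordinate, hence in a translate of \<open>strip - F\<close> or in a translate of
  \<open>F\<close> that is not \<open>F\<close> itself. Overlaps of the translates only enlarge the
  right-hand side.\<close>

lemma perimeter_le_per_P_plus:
  fixes F :: "(real \<times> 'b::euclidean_space) set"
  assumes [measurable]: "F \<in> sets borel" and F: "F \<subseteq> strip"
  shows "perimeter (riesz_kernel s) F \<le> per_P s F +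
     (\<integral>\<^sup>+k. (if k = 0 then 0 else interaction (riesz_kernel s) F (shift k F)) \<partial>count_space UNIV)"
proof -
  let ?k = "riesz_kernel s :: real \<times> 'b \<Rightarrow> ennreal"
  let ?a = "\<lambda>y. (\<integral>\<^sup>+k. indicator (shift k (strip - F)) y \<partial>count_space UNIV) :: ennreal"
  let ?b = "\<lambda>y. (\<integral>\<^sup>+k. (if k = 0 then 0 else indicator (shift k F) y) \<partial>count_space UNIV) :: ennreal"
  have [measurable]: "shift k (strip - F) \<in> sets borel" "shift k F \<in> sets borel" for k
    by (rule shift_borel, measurable)+
  have am[measurable]: "?a \<in> borel_measurable borel" unfolding nn_integral_count_space_int by measurable
  have bm[measurable]: "?b \<in> borel_measurable borel" unfolding nn_integral_count_space_int by measurable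
  have one: "1 \<le> (\<integral>\<^sup>+k. h k \<partial>count_space UNIV)" if "h k \<ge> (1::ennreal)" for h and k :: int
  proof -
    have "1 \<le> h k" using that .
    also have "\<dots> = (\<integral>\<^sup>+j. h j * indicator {k} j \<partial>count_space UNIV)" by simp
    also have "\<dots> \<le> (\<integral>\<^sup>+j. h j \<partial>count_space UNIV)"
      by (intro nn_integral_mono) (auto simp: indicator_def)
    finally show ?thesis .
  qed
  have cover: "indicator (- F) y \<le> ?a y + ?b y" for y
  proof (cases "y \<in> F")
    case False
    define k where "k = round (fst y)"
    have "\<bar>real_of_int (round (fst y)) - fst y\<bar> \<le> 1/2" by (rule of_int_round_abs_le)
    then have st: "y - (real_of_int k, 0) \<in> strip" by (auto simp: strip_iff k_def abs_minus_commute)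
    show ?thesis
    proof (cases "y - (real_of_int k, 0) \<in> F")
      case True
      then have "k \<noteq> 0" using False by (auto simp: zero_prod_def[symmetric])
      then have "1 \<le> ?b y" using True by (intro one[of _ k]) (auto simp: shift_def)
      then show ?thesis by (simp add: add_increasing indicator_def)
    next
      case nF: False
      then have "1 \<le> ?a y" using st by (intro one[of _ k]) (auto simp: shift_def)
      then show ?thesis by (simp add: add_increasing2 indicator_def)
    qed
  qed simp
  have "perimeter ?k F = (\<integral>\<^sup>+x. (\<integral>\<^sup>+y. ?k (x - y) * indicator (- F) y \<partial>lborel) * indicator F x \<partial>lborel)"
    unfolding perimeter_def interaction_def by (intro nn_integral_cong) (simp add: indicator_def)
  also have "\<dots> \<le> (\<integral>\<^sup>+x. (\<integral>\<^sup>+y. ?k (x - y) * (?a y + ?b y) \<partial>lborel) * indicator F x \<partial>lborel)"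
    by (intro nn_integral_mono mult_right_mono mult_left_mono cover) auto
  also have "\<dots> = (\<integral>\<^sup>+x. (\<integral>\<^sup>+y. ?k (x - y) * ?a y \<partial>lborel) * indicator F x + (\<integral>\<^sup>+y. ?k (x - y) * ?b y \<partial>lborel) * indicator F x \<partial>lborel)"
    unfolding distrib_left by (subst nn_integral_add) (auto simp: distrib_right)
  also have "\<dots> = per_P s F + (\<integral>\<^sup>+x. (\<integral>\<^sup>+y. ?k (x - y) * ?b y \<partial>lborel) * indicator F x \<partial>lborel)"
    unfolding per_P_eq[OF assms] by (rule nn_integral_add) measurable
  also have "(\<integral>\<^sup>+x. (\<integral>\<^sup>+y. ?k (x - y) * ?b y \<partial>lborel) * indicator F x \<partial>lborel)
     = (\<integral>\<^sup>+k. (if k = 0 then 0 else interaction ?k F (shift k F)) \<partial>count_space UNIV)"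
  proof -
    have "(\<integral>\<^sup>+x. (\<integral>\<^sup>+y. ?k (x - y) * ?b y \<partial>lborel) * indicator F x \<partial>lborel)
      = (\<integral>\<^sup>+x. (\<integral>\<^sup>+y. (\<integral>\<^sup>+k. ?k (x - y) * (if k = 0 then 0 else indicator (shift k F) y) * indicator F x \<partial>count_space UNIV) \<partial>lborel) \<partial>lborel)"
      by (subst nn_integral_multc[symmetric], measurable) (auto simp: nn_integral_cmult nn_integral_multc intro!: nn_integral_cong)
    also have "\<dots> = (\<integral>\<^sup>+x. (\<integral>\<^sup>+k. (\<integral>\<^sup>+y. ?k (x - y) * (if k = 0 then 0 else indicator (shift k F) y) * indicator F x \<partial>lborel) \<partial>count_space UNIV) \<partial>lborel)"
      by (intro nn_integral_cong nn_integral_count_space_nn_integral) (auto intro: countableI_type)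
    also have "\<dots> = (\<integral>\<^sup>+k. (\<integral>\<^sup>+x. (\<integral>\<^sup>+y. ?k (x - y) * (if k = 0 then 0 else indicator (shift k F) y) * indicator F x \<partial>lborel) \<partial>lborel) \<partial>count_space UNIV)"
      by (intro nn_integral_count_space_nn_integral) (auto intro: countableI_type)
    also have "\<dots> = (\<integral>\<^sup>+k. (if k = 0 then 0 else interaction ?k F (shift k F)) \<partial>count_space UNIV)"
      unfolding interaction_def by (intro nn_integral_cong) (auto simp: ac_simps)
    finally show ?thesis .
  qed
  finally show ?thesis .
qed


section \<open>The ball as a competitor\<close>

lemma AE_lborel_hyperplane:
  fixes a :: "'a::euclidean_space"
  assumes "a \<noteq> 0"
  shows "AE x in lborel. a \<bullet> x \<noteq> b"
proof -
  have "negligible {x. a \<bullet> x = b}" using assms by (intro negligible_hyperplane) auto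
  moreover have "{x. a \<bullet> x = b} \<in> sets borel" by (intro borel_closed closed_hyperplane)
  ultimately have "{x. a \<bullet> x = b} \<in> null_sets lborel"
    by (auto simp: null_sets_completion_iff negligible_iff_null_sets)
  then show ?thesis by (rule AE_I') auto
qed

text \<open>Profiles are nonnegative, so every set in \<open>classK\<close> contains the whole
  segment of the axis in the strip and a small ball is never in the class. For a small radius this
  is the closed ball with the rest of that segment, a null set, added.\<close>

definition capped_ball :: "real \<Rightarrow> (real \<times> 'b::euclidean_space) set" where
  "capped_ball l = {p \<in> strip. ennreal (norm (snd p)) \<le> ennreal (if \<bar>fst p\<bar> \<le> l then sqrt (l\<^sup>2 - (fst p)\<^sup>2) else 0)}"

lemma capped_ball_classK:
  assumes "0 \<le> l"
  shows "capped_ball l \<in> classK"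
  unfolding classK_def capped_ball_def
proof (intro CollectI exI[of _ "\<lambda>t. ennreal (if \<bar>t\<bar> \<le> l then sqrt (l\<^sup>2 - t\<^sup>2) else 0)"] conjI ballI allI impI)
  fix a b :: real assume "0 \<le> a \<and> a \<le> b \<and> b \<le> 1/2"
  moreover have "\<bar>b\<bar> \<le> l \<Longrightarrow> 0 \<le> l\<^sup>2 - b\<^sup>2" using abs_le_square_iff[of b l] assms by simp
  ultimately show "ennreal (if \<bar>b\<bar> \<le> l then sqrt (l\<^sup>2 - b\<^sup>2) else 0) \<le> ennreal (if \<bar>a\<bar> \<le> l then sqrt (l\<^sup>2 - a\<^sup>2) else 0)"
    using power_mono[of a b 2] abs_le_square_iff[of a l] assms by (intro ennreal_leI) auto
qed auto

lemma capped_ball_AE: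
  fixes l :: real
  assumes l: "0 < l" "l < 1/2"
  shows "AE p in lborel. p \<in> (capped_ball l :: (real \<times> 'b::euclidean_space) set) \<longleftrightarrow> p \<in> ball 0 l"
    and "ball 0 l \<subseteq> (capped_ball l :: (real \<times> 'b) set)"
proof -
  have eq: "p \<in> capped_ball l \<longleftrightarrow> p \<in> cball 0 l \<or> (\<bar>fst p\<bar> \<le> 1/2 \<and> l < \<bar>fst p\<bar> \<and> snd p = 0)" for p :: "real \<times> 'b"
  proof (cases "\<bar>fst p\<bar> \<le> l")
    case True
    then have sq: "(fst p)\<^sup>2 \<le> l\<^sup>2" using abs_le_square_iff[of "fst p" l] l by simp
    have "p \<in> capped_ball l \<longleftrightarrow> norm (snd p) \<le> sqrt (l\<^sup>2 - (fst p)\<^sup>2)"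
      using True l sq by (auto simp: capped_ball_def strip_iff)
    also have "\<dots> \<longleftrightarrow> (norm (snd p))\<^sup>2 \<le> l\<^sup>2 - (fst p)\<^sup>2"
      using sq by (metis norm_ge_zero real_sqrt_le_iff real_sqrt_abs abs_of_nonneg)
    also have "\<dots> \<longleftrightarrow> (norm p)\<^sup>2 \<le> l\<^sup>2" by (auto simp: norm_prod_def)
    also have "\<dots> \<longleftrightarrow> norm p \<le> l" using l by (metis abs_le_square_iff abs_norm_cancel abs_of_pos)
    finally show ?thesis using True by auto
  next
    case False
    have "\<bar>fst p\<bar> \<le> norm p" using norm_fst_le[of "fst p" "snd p"] by simp
    then show ?thesis using False by (auto simp: capped_ball_def strip_iff)
  qed
  show "ball 0 l \<subseteq> (capped_ball l :: (real \<times> 'b) set)" by (auto simp: eq)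
  obtain b :: 'b where b: "b \<in> Basis" using nonempty_Basis by blast
  have "AE p in lborel. (0::real, b) \<bullet> p \<noteq> 0"
    using b by (intro AE_lborel_hyperplane) (auto simp: zero_prod_def)
  moreover have "AE p in lborel. p \<notin> sphere (0::real \<times> 'b) l"
  proof -
    have "sphere (0::real \<times> 'b) l \<in> null_sets lborel"
      using negligible_sphere[of "0::real \<times> 'b" l]
      by (auto simp: null_sets_completion_iff negligible_iff_null_sets)
    then show ?thesis by (rule AE_not_in)
  qed
  ultimately show "AE p in lborel. p \<in> (capped_ball l :: (real \<times> 'b) set) \<longleftrightarrow> p \<in> ball 0 l"
  proof eventually_elim
    case (elim p)
    have "snd p \<noteq> 0" using elim(1) by (auto simp: inner_prod_def)
    then show ?case using elim(2) by (auto simp: eq)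
  qed
qed

lemma emeasure_capped_ball:
  assumes l: "0 < l" "l < 1/2"
  shows "emeasure lborel (capped_ball l :: (real \<times> 'b::euclidean_space) set) = emeasure lborel (ball (0::real \<times> 'b) l)"
proof (rule emeasure_eq_AE)
  show "AE p in lborel. p \<in> (capped_ball l :: (real \<times> 'b) set) \<longleftrightarrow> p \<in> ball 0 l" by (rule capped_ball_AE[OF l])
  show "(capped_ball l :: (real \<times> 'b) set) \<in> sets lborel"
    using classK_properties(1)[OF capped_ball_classK[where 'a='b], of l] l by simp
qed simp

text \<open>Translates of the strip overlap only where the first coordinate is a half-integer, so
  almost every point is counted at most once. Points of the ball lie in a single translate, the
  strip itself, as \<open>l < 1/2\<close>, and are not counted.\<close>

lemma per_P_capped_ball_le:
  assumes l: "0 < l" "l < 1/2"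
  shows "per_P s (capped_ball l :: (real \<times> 'b::euclidean_space) set) \<le> perimeter (riesz_kernel s) (ball (0::real \<times> 'b) l)"
proof -
  let ?G = "capped_ball l :: (real \<times> 'b) set" and ?B = "ball (0::real \<times> 'b) l"
  let ?k = "riesz_kernel s :: real \<times> 'b \<Rightarrow> ennreal"
  have G: "?G \<in> sets borel" "?G \<subseteq> strip"
    using classK_properties[OF capped_ball_classK, of l] l by auto
  let ?a = "\<lambda>y. (\<integral>\<^sup>+k. indicator (shift k (strip - ?G)) y \<partial>count_space UNIV) :: ennreal"
  have "AE y in lborel. \<forall>k::int. (1::real, 0::'b) \<bullet> y \<noteq> real_of_int k + 1/2"
    by (subst AE_all_countable) (intro allI AE_lborel_hyperplane, simp add: zero_prod_def)
  then have le: "AE y in lborel. ?a y \<le> indicator (- ?B) y"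
  proof eventually_elim
    case (elim y)
    have y: "fst y \<noteq> real_of_int k + 1/2" for k using elim by (auto simp: inner_prod_def)
    define j where "j = round (fst y)"
    have uniq: "k = j" if "\<bar>fst y - real_of_int k\<bar> \<le> 1/2" for k
    proof -
      have "\<bar>real_of_int j - fst y\<bar> \<le> 1/2" unfolding j_def by (rule of_int_round_abs_le)
      moreover have "fst y \<noteq> real_of_int k + 1/2" "fst y \<noteq> real_of_int (k - 1) + 1/2" using y[of k] y[of "k - 1"] by auto
      ultimately have "\<bar>real_of_int k - real_of_int j\<bar> < 1" using that by (auto simp: abs_if split: if_splits)
      then show ?thesis by linarith
    qed
    show ?case
    proof (cases "y \<in> ?B")
      case True
      have "\<bar>fst y\<bar> \<le> norm y" using norm_fst_le[of "fst y" "snd y"] by simp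
      then have "\<bar>fst y\<bar> < 1/2" using True l by simp
      then have j0: "j = 0" using uniq[of 0] by simp
      have yG: "y \<in> ?G" using True capped_ball_AE(2)[OF l] by blast
      have "indicator (shift k (strip - ?G)) y = (0::ennreal)" for k
        using uniq[of k] yG j0 by (auto simp: shift_def indicator_def strip_iff zero_prod_def[symmetric])
      then show ?thesis by simp
    next
      case False
      have "?a y \<le> (\<integral>\<^sup>+k. indicator {j} k \<partial>count_space UNIV)"
        using uniq by (intro nn_integral_mono) (auto simp: indicator_def shift_def strip_iff)
      then show ?thesis using False by simp
    qed
  qed
  have "per_P s ?G = (\<integral>\<^sup>+x. (\<integral>\<^sup>+y. ?k (x - y) * ?a y \<partial>lborel) * indicator ?G x \<partial>lborel)"
    by (rule per_P_eq[OF G])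
  also have "\<dots> \<le> (\<integral>\<^sup>+x. (\<integral>\<^sup>+y. ?k (x - y) * indicator (- ?B) y \<partial>lborel) * indicator ?B x \<partial>lborel)"
    using capped_ball_AE(1)[OF l, where 'b='b]
  proof (intro nn_integral_mono_AE, eventually_elim)
    case (elim x)
    have "(\<integral>\<^sup>+y. ?k (x - y) * ?a y \<partial>lborel) \<le> (\<integral>\<^sup>+y. ?k (x - y) * indicator (- ?B) y \<partial>lborel)"
      by (intro nn_integral_mono_AE eventually_mono[OF le] mult_left_mono) auto
    moreover have "indicator ?G x = (indicator ?B x :: ennreal)" using elim by (simp add: indicator_def)
    ultimately show ?case by (simp add: mult_right_mono)
  qed
  also have "\<dots> = perimeter ?k ?B"
    unfolding perimeter_def interaction_def by (intro nn_integral_cong) (simp add: indicator_def)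
  finally show ?thesis .
qed

lemma nn_integral_inverse_squares_int:
  "(\<integral>\<^sup>+k. ennreal (1 / (real_of_int k)\<^sup>2) \<partial>count_space UNIV) < \<infinity>"
proof -
  \<comment> \<open>\<open>int_decode\<close> alternates between the signs, so the absolute value of
    \<open>int_decode n\<close> is at least \<open>n / 2\<close>. At \<open>n = 0\<close> both sides
    vanish because division by zero gives zero.\<close>
  have "ennreal (1 / (real_of_int (int_decode n))\<^sup>2) \<le> ennreal (4 / (real n)\<^sup>2)" for n
  proof (cases "n = 0")
    case False
    have "real n \<le> 2 * \<bar>real_of_int (int_decode n)\<bar>"
      by (auto simp: int_decode_def sum_decode_def split: if_splits elim!: oddE evenE)
    then have "(real n)\<^sup>2 \<le> (2 * \<bar>real_of_int (int_decode n)\<bar>)\<^sup>2" by (intro power_mono) auto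
    then have "(real n)\<^sup>2 \<le> 4 * (real_of_int (int_decode n))\<^sup>2" by (simp add: power_mult_distrib)
    moreover have "(real n)\<^sup>2 > 0" using False by simp
    moreover from calculation have "(real_of_int (int_decode n))\<^sup>2 > 0" by linarith
    ultimately show ?thesis by (intro ennreal_leI) (simp add: field_simps)
  qed (simp add: int_decode_def sum_decode_def)
  then have "(\<integral>\<^sup>+k. ennreal (1 / (real_of_int k)\<^sup>2) \<partial>count_space UNIV) \<le> (\<Sum>n. ennreal (4 / (real n)\<^sup>2))"
    unfolding nn_integral_count_space_int by (intro suminf_le) auto
  also have "summable (\<lambda>n. 4 / (real n)\<^sup>2)"
    using summable_mult[OF inverse_power_summable[of 2, where 'a=real], of 4] by (simp add: field_simps)
  then have "(\<Sum>n. ennreal (4 / (real n)\<^sup>2)) = ennreal (\<Sum>n. 4 / (real n)\<^sup>2)"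
    by (intro suminf_ennreal2) auto
  also have "\<dots> < \<infinity>" by simp
  finally show ?thesis .
qed

section \<open>Interaction between periods\<close>

text \<open>A power with a genuine singularity: \<open>powr\<close> would give \<open>0\<close> at
  \<open>t = 0\<close>, and products of such powers would fail to dominate the kernel there.\<close>

definition pole :: "real \<Rightarrow> real \<Rightarrow> ennreal" where
  "pole a t = (if t = 0 then \<infinity> else ennreal (t powr - a))"

lemma pole_measurable[measurable]: "pole a \<in> borel_measurable borel"
  unfolding pole_def by measurable

lemma pole_nonzero: "t \<ge> 0 \<Longrightarrow> pole a t \<noteq> 0"
  by (auto simp: pole_def)

lemma nn_integral_pole_cball_unit:
  assumes a: "0 \<le> a" "a < real DIM('a)"
  shows "(\<integral>\<^sup>+z\<in>cball 0 1. pole a (norm (z::'a::euclidean_space)) \<partial>lborel) < \<infinity>"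
proof -
  have "(\<integral>\<^sup>+z\<in>cball 0 1. pole a (norm (z::'a)) \<partial>lborel) = (\<integral>\<^sup>+z\<in>cball 0 1. ennreal (norm (z::'a) powr - a) \<partial>lborel)"
    by (intro nn_integral_cong_AE eventually_mono[OF AE_lborel_singleton[of 0]]) (auto simp: pole_def)
  then show ?thesis using nn_integral_norm_powr_cball_unit[OF a] by simp
qed

lemma nn_integral_pole_cball:
  fixes R :: real
  assumes R: "R > 0"
  shows "(\<integral>\<^sup>+z\<in>cball 0 R. pole a (norm (z::'a::euclidean_space)) \<partial>lborel)
     = ennreal (R powr (real DIM('a) - a)) * (\<integral>\<^sup>+z\<in>cball 0 1. pole a (norm (z::'a)) \<partial>lborel)"
proof -
  have [measurable]: "cball (0::'a) q \<in> sets borel" for q by (rule borel_closed) simp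
  have "(\<integral>\<^sup>+z\<in>cball 0 R. pole a (norm (z::'a)) \<partial>lborel)
     = ennreal (R ^ DIM('a)) * (\<integral>\<^sup>+z. pole a (norm (R *\<^sub>R z)) * indicator (cball 0 R) (R *\<^sub>R z :: 'a) \<partial>lborel)"
    using R by (subst nn_integral_lborel_scaleR[where c=R]) auto
  also have "(\<integral>\<^sup>+z. pole a (norm (R *\<^sub>R z)) * indicator (cball 0 R) (R *\<^sub>R z :: 'a) \<partial>lborel)
     = (\<integral>\<^sup>+z. ennreal (R powr - a) * (pole a (norm (z::'a)) * indicator (cball 0 1) z) \<partial>lborel)"
  proof (rule nn_integral_cong)
    fix z :: 'a
    have "pole a (norm (R *\<^sub>R z)) = ennreal (R powr - a) * pole a (norm z)"
      using R by (auto simp: pole_def powr_mult ennreal_mult' ennreal_mult_top)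
    moreover have "R *\<^sub>R z \<in> cball 0 R \<longleftrightarrow> z \<in> cball 0 1" using R by auto
    ultimately show "pole a (norm (R *\<^sub>R z)) * indicator (cball 0 R) (R *\<^sub>R z) = ennreal (R powr - a) * (pole a (norm z) * indicator (cball 0 1) z)"
      by (simp add: indicator_def)
  qed
  also have "\<dots> = ennreal (R powr - a) * (\<integral>\<^sup>+z\<in>cball 0 1. pole a (norm (z::'a)) \<partial>lborel)"
    by (rule nn_integral_cmult) measurable
  also have "ennreal (R ^ DIM('a)) * (ennreal (R powr - a) * (\<integral>\<^sup>+z\<in>cball 0 1. pole a (norm (z::'a)) \<partial>lborel))
     = ennreal (R ^ DIM('a) * R powr - a) * (\<integral>\<^sup>+z\<in>cball 0 1. pole a (norm (z::'a)) \<partial>lborel)"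
    using R by (simp add: ennreal_mult' mult.assoc)
  also have "R ^ DIM('a) * R powr - a = R powr (real DIM('a) - a)"
  proof -
    have "R ^ DIM('a) = R powr real DIM('a)" using R by (simp add: powr_realpow)
    then show ?thesis by (simp only: powr_add[symmetric]) simp
  qed
  finally show ?thesis .
qed

lemma riesz_kernel_le:
  assumes "0 < t" "t \<le> norm (z::'a::euclidean_space)" "s > 0"
  shows "riesz_kernel s z \<le> ennreal (t powr - (real DIM('a) + s))"
  using assms by (auto simp: riesz_kernel_def intro!: ennreal_leI powr_mono2')

text \<open>With \<open>a = 1/2 - x\<^sub>1\<close> and \<open>b = y\<^sub>1 - 1/2\<close> one has \<open>|x - y| \<ge> max (a + b) |x' - y'|\<close> and \<open>(a + b)\<^sup>2 \<ge> a b\<close>,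
  so the kernel is dominated by a product in separated variables.\<close>
lemma riesz_kernel_le_poles:
  fixes x y :: "real \<times> 'b::euclidean_space"
  assumes s: "0 < s" and ab: "fst x \<le> 1/2" "1/2 \<le> fst y"
    and \<alpha>\<beta>: "\<alpha> + \<beta> = real DIM(real \<times> 'b) + s" "\<alpha> \<ge> 0" "\<beta> \<ge> 0"
  shows "riesz_kernel s (x - y) \<le> pole (\<alpha> / 2) (1/2 - fst x) * pole (\<alpha> / 2) (fst y - 1/2) * pole \<beta> (norm (snd x - snd y))"
proof (cases "1/2 - fst x = 0 \<or> fst y - 1/2 = 0 \<or> norm (snd x - snd y) = 0")
  \<comment> \<open>On the singular set one factor is infinite and none is zero, so the product is
    infinite.\<close>
  case True
  have "pole (\<alpha> / 2) (1/2 - fst x) \<noteq> 0" "pole (\<alpha> / 2) (fst y - 1/2) \<noteq> 0" "pole \<beta> (norm (snd x - snd y)) \<noteq> 0"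
    using ab by (auto intro!: pole_nonzero)
  moreover have "pole (\<alpha> / 2) (1/2 - fst x) = \<infinity> \<or> pole (\<alpha> / 2) (fst y - 1/2) = \<infinity> \<or> pole \<beta> (norm (snd x - snd y)) = \<infinity>"
    using True by (auto simp: pole_def)
  ultimately have "pole (\<alpha> / 2) (1/2 - fst x) * pole (\<alpha> / 2) (fst y - 1/2) * pole \<beta> (norm (snd x - snd y)) = \<infinity>"
    by (auto simp: ennreal_mult_eq_top_iff)
  then show ?thesis by simp
next
  case False
  define a b d N where "a = 1/2 - fst x" and "b = fst y - 1/2" and "d = norm (snd x - snd y)" and "N = norm (x - y)"
  have pos: "a > 0" "b > 0" "d > 0" using False ab by (auto simp: a_def b_def d_def)
  have "\<bar>fst (x - y)\<bar> \<le> N" unfolding N_def using norm_fst_le[of "fst (x - y)" "snd (x - y)"] unfolding prod.collapse by simp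
  then have N1: "a + b \<le> N" by (simp add: a_def b_def)
  have N2: "d \<le> N" unfolding N_def d_def using norm_snd_le[of "snd (x - y)" "fst (x - y)"] unfolding prod.collapse by simp
  have "N powr - (real DIM(real \<times> 'b) + s) = N powr - \<alpha> * N powr - \<beta>"
    unfolding \<alpha>\<beta>(1)[symmetric] by (simp add: powr_add[symmetric])
  also have "\<dots> \<le> (a + b) powr - \<alpha> * d powr - \<beta>"
    using pos N1 N2 \<alpha>\<beta> by (intro mult_mono powr_mono2') auto
  also have "(a + b) powr - \<alpha> \<le> a powr - (\<alpha> / 2) * b powr - (\<alpha> / 2)"
  proof -
    have "(a + b) powr - \<alpha> = ((a + b)\<^sup>2) powr - (\<alpha> / 2)"
      using norm_sq_powr[of "a + b" \<alpha>] pos by simp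
    also have "\<dots> \<le> (a * b) powr - (\<alpha> / 2)"
    proof (rule powr_mono2')
      show "a * b \<le> (a + b)\<^sup>2" using pos by (simp add: power2_eq_square algebra_simps)
    qed (use pos \<alpha>\<beta> in auto)
    finally show ?thesis using pos by (simp add: powr_mult)
  qed
  finally have le: "N powr - (real DIM(real \<times> 'b) + s) \<le> a powr - (\<alpha> / 2) * b powr - (\<alpha> / 2) * d powr - \<beta>"
    by (simp add: mult_right_mono)
  have "x - y \<noteq> 0" using pos N2 by (auto simp: N_def)
  then have "riesz_kernel s (x - y) = ennreal (N powr - (real DIM(real \<times> 'b) + s))"
    by (simp add: riesz_kernel_def N_def)
  also have "\<dots> \<le> ennreal (a powr - (\<alpha> / 2) * b powr - (\<alpha> / 2) * d powr - \<beta>)" by (rule ennreal_leI[OF le])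
  also have "\<dots> = pole (\<alpha> / 2) a * pole (\<alpha> / 2) b * pole \<beta> d"
    using pos by (simp add: pole_def ennreal_mult')
  finally show ?thesis by (simp add: a_def b_def d_def)
qed

text \<open>The cylinders touch across a face. Integrability in the two normal variables needs
  \<open>\<alpha> < 2\<close>, and in the tangential ones \<open>\<beta> < n - 1\<close>, that is
  \<open>\<alpha> > 1 + s\<close>; the choice \<open>(3 + s) / 2\<close> is the midpoint of that
  interval, nonempty because \<open>s < 1\<close>. The tangential integrals give the power
  \<open>2 * (n - 1) - \<beta>\<close> of \<open>\<rho>\<close>, which is the stated
  exponent.\<close>

lemma neck_interaction_bound:
  fixes s :: real
  assumes s: "0 < s" "s < 1"
  shows "\<exists>C\<ge>0. \<forall>\<rho>\<ge>0. interaction (riesz_kernel s) ({1/4..1/2::real} \<times> cball (0::'b::euclidean_space) \<rho>) ({1/2..3/4::real} \<times> cball 0 \<rho>)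
     \<le> ennreal (C * \<rho> powr (real DIM('b) + 1 - (1 + s) / 2))"
proof -
  let ?m = "real DIM('b)"
  define \<alpha> where "\<alpha> = (3 + s) / 2"
  define \<beta> where "\<beta> = ?m - 1 + (1 + s) / 2"
  have m1: "?m \<ge> 1" using DIM_positive[where 'a='b] by linarith
  have "\<alpha> + \<beta> = real DIM(real \<times> 'b) + s" by (simp add: \<alpha>_def \<beta>_def field_simps)
  moreover have "0 \<le> \<alpha>" "\<alpha> / 2 < 1" "\<beta> < ?m" using s by (simp_all add: \<alpha>_def \<beta>_def)
  moreover have "0 \<le> \<beta>" unfolding \<beta>_def using s m1 by (intro add_nonneg_nonneg) auto
  ultimately have \<alpha>\<beta>: "\<alpha> + \<beta> = real DIM(real \<times> 'b) + s" "0 \<le> \<alpha>" "0 \<le> \<beta>" "\<beta> < ?m" "\<alpha> / 2 < 1"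
    by blast+
  define Ka where "Ka = (\<integral>\<^sup>+t\<in>cball 0 1. pole (\<alpha> / 2) (norm (t::real)) \<partial>lborel)"
  have Ka: "Ka < \<infinity>" unfolding Ka_def using \<alpha>\<beta> by (intro nn_integral_pole_cball_unit) auto
  define Kb where "Kb = (\<integral>\<^sup>+z\<in>cball 0 1. pole \<beta> (norm (z::'b)) \<partial>lborel)"
  have Kb: "Kb < \<infinity>" unfolding Kb_def using \<alpha>\<beta> by (intro nn_integral_pole_cball_unit) auto
  define v where "v = unit_ball_vol ?m"
  have v: "v \<ge> 0" by (simp add: v_def)
  define C where "C = enn2real Ka * enn2real Ka * v * 2 powr (?m - \<beta>) * enn2real Kb"
  have C: "C \<ge> 0" using v by (simp add: C_def)
  have main: "interaction (riesz_kernel s) ({1/4..1/2::real} \<times> cball (0::'b) \<rho>) ({1/2..3/4::real} \<times> cball 0 \<rho>)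
     \<le> ennreal (C * \<rho> powr (?m + 1 - (1 + s) / 2))" if \<rho>: "\<rho> \<ge> 0" for \<rho>
  proof -
    let ?k = "riesz_kernel s :: real \<times> 'b \<Rightarrow> ennreal"
    define h where "h = (\<lambda>t. pole (\<alpha> / 2) t * indicator {0..1/4} t)"
    define cb where "cb = (indicator (cball (0::'b) \<rho>) :: 'b \<Rightarrow> ennreal)"
    have cbm[measurable]: "cb \<in> borel_measurable borel"
      unfolding cb_def by (intro borel_measurable_indicator borel_closed) simp
    have hm[measurable]: "h \<in> borel_measurable borel" unfolding h_def by measurable
    have hKa: "(\<integral>\<^sup>+t. h t \<partial>lborel) \<le> Ka"
      unfolding h_def Ka_def by (intro nn_integral_mono) (auto simp: indicator_def)
    define J where "J = (\<integral>\<^sup>+z\<in>cball 0 (2 * \<rho>). pole \<beta> (norm (z::'b)) \<partial>lborel)"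
    have Jx: "(\<integral>\<^sup>+y. pole \<beta> (norm (x - y)) * cb y \<partial>lborel) * cb x \<le> J * cb x" for x :: 'b
    proof (cases "x \<in> cball 0 \<rho>")
      case True
      have [measurable]: "cball (0::'b) (2 * \<rho>) \<in> sets borel" by (rule borel_closed) simp
      have "(\<integral>\<^sup>+y. pole \<beta> (norm (x - y)) * cb y \<partial>lborel) \<le> (\<integral>\<^sup>+y. pole \<beta> (norm (x - y)) * indicator (cball 0 (2 * \<rho>)) (x - y) \<partial>lborel)"
      proof (rule nn_integral_mono)
        fix y
        have "norm (x - y) \<le> 2 * \<rho>" if "y \<in> cball 0 \<rho>"
          using that True norm_triangle_ineq4[of x y] by auto
        then show "pole \<beta> (norm (x - y)) * cb y \<le> pole \<beta> (norm (x - y)) * indicator (cball 0 (2 * \<rho>)) (x - y)"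
          by (auto simp: cb_def indicator_def)
      qed
      also have "\<dots> = J"
        unfolding J_def by (rule nn_integral_lborel_diff(1)[of "\<lambda>z. pole \<beta> (norm z) * indicator (cball 0 (2 * \<rho>)) z"]) measurable
      finally show ?thesis by (rule mult_right_mono) simp
    qed (simp add: cb_def)
    have "interaction ?k ({1/4..1/2::real} \<times> cball 0 \<rho>) ({1/2..3/4::real} \<times> cball 0 \<rho>)
      \<le> (\<integral>\<^sup>+x. (\<integral>\<^sup>+y. (h (1/2 - fst x) * h (fst y - 1/2)) * (pole \<beta> (norm (snd x - snd y)) * cb (snd x) * cb (snd y)) \<partial>lborel) \<partial>lborel)"
      unfolding interaction_def
    proof (intro nn_integral_mono)
      fix x y :: "real \<times> 'b"
      show "?k (x - y) * indicator ({1/4..1/2::real} \<times> cball 0 \<rho>) x * indicator ({1/2..3/4::real} \<times> cball 0 \<rho>) y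
        \<le> (h (1/2 - fst x) * h (fst y - 1/2)) * (pole \<beta> (norm (snd x - snd y)) * cb (snd x) * cb (snd y))"
      proof (cases "x \<in> {1/4..1/2::real} \<times> cball 0 \<rho> \<and> y \<in> {1/2..3/4::real} \<times> cball 0 \<rho>")
        case True
        then have xy: "fst x \<in> {1/4..1/2}" "fst y \<in> {1/2..3/4}" "snd x \<in> cball 0 \<rho>" "snd y \<in> cball 0 \<rho>" by (auto simp: mem_Times_iff)
        have "?k (x - y) \<le> pole (\<alpha> / 2) (1/2 - fst x) * pole (\<alpha> / 2) (fst y - 1/2) * pole \<beta> (norm (snd x - snd y))"
          using xy s \<alpha>\<beta> by (intro riesz_kernel_le_poles) auto
        moreover have "h (1/2 - fst x) = pole (\<alpha> / 2) (1/2 - fst x)" "h (fst y - 1/2) = pole (\<alpha> / 2) (fst y - 1/2)"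
          "cb (snd x) = 1" "cb (snd y) = 1"
          using xy by (auto simp: h_def cb_def indicator_def)
        ultimately show ?thesis using True by simp
      next
        case False
        then show ?thesis by (auto simp: indicator_def)
      qed
    qed
    also have "\<dots> = (\<integral>\<^sup>+x1. (\<integral>\<^sup>+x2. (\<integral>\<^sup>+y1. (\<integral>\<^sup>+y2. (h (1/2 - x1) * h (y1 - 1/2)) * (pole \<beta> (norm (x2 - y2)) * cb x2 * cb y2) \<partial>lborel) \<partial>lborel) \<partial>lborel) \<partial>lborel)"
    proof -
      have in_eq: "(\<integral>\<^sup>+y. (h (1/2 - fst x) * h (fst y - 1/2)) * (pole \<beta> (norm (snd x - snd y)) * cb (snd x) * cb (snd y)) \<partial>lborel)
        = (\<integral>\<^sup>+y1. (\<integral>\<^sup>+y2. (h (1/2 - fst x) * h (y1 - 1/2)) * (pole \<beta> (norm (snd x - y2)) * cb (snd x) * cb y2) \<partial>lborel) \<partial>lborel)" for x :: "real \<times> 'b"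
        by (subst nn_integral_lborel_pair) (simp_all add: borel_prod[symmetric])
      show ?thesis
        unfolding in_eq by (subst nn_integral_lborel_pair) (simp_all add: borel_prod[symmetric])
    qed
    also have "\<dots> = (\<integral>\<^sup>+x1. h (1/2 - x1) \<partial>lborel) * (\<integral>\<^sup>+y1. h (y1 - 1/2) \<partial>lborel) * (\<integral>\<^sup>+x2. (\<integral>\<^sup>+y2. pole \<beta> (norm (x2 - y2)) * cb y2 \<partial>lborel) * cb x2 \<partial>lborel)"
    proof -
      define c where "c = (\<lambda>x2. (\<integral>\<^sup>+y2. pole \<beta> (norm (x2 - y2)) * cb y2 \<partial>lborel) * cb x2)"
      have cm[measurable]: "c \<in> borel_measurable borel" unfolding c_def by measurable
      have 1: "(\<integral>\<^sup>+y2. (h (1/2 - x1) * h (y1 - 1/2)) * (pole \<beta> (norm (x2 - y2)) * cb x2 * cb y2) \<partial>lborel) = h (1/2 - x1) * h (y1 - 1/2) * c x2" for x1 y1 x2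
      proof -
        have "(\<integral>\<^sup>+y2. (h (1/2 - x1) * h (y1 - 1/2)) * (pole \<beta> (norm (x2 - y2)) * cb x2 * cb y2) \<partial>lborel)
          = (\<integral>\<^sup>+y2. (h (1/2 - x1) * h (y1 - 1/2) * cb x2) * (pole \<beta> (norm (x2 - y2)) * cb y2) \<partial>lborel)"
          by (intro nn_integral_cong) (simp add: ac_simps)
        also have "\<dots> = (h (1/2 - x1) * h (y1 - 1/2) * cb x2) * (\<integral>\<^sup>+y2. pole \<beta> (norm (x2 - y2)) * cb y2 \<partial>lborel)"
          by (rule nn_integral_cmult) measurable
        finally show ?thesis by (simp add: c_def ac_simps)
      qed
      have "(\<integral>\<^sup>+x1. (\<integral>\<^sup>+x2. (\<integral>\<^sup>+y1. h (1/2 - x1) * h (y1 - 1/2) * c x2 \<partial>lborel) \<partial>lborel) \<partial>lborel)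
        = (\<integral>\<^sup>+x1. (\<integral>\<^sup>+x2. h (1/2 - x1) * (\<integral>\<^sup>+y1. h (y1 - 1/2) \<partial>lborel) * c x2 \<partial>lborel) \<partial>lborel)"
        by (intro nn_integral_cong) (simp add: nn_integral_multc nn_integral_cmult)
      also have "\<dots> = (\<integral>\<^sup>+x1. h (1/2 - x1) \<partial>lborel) * (\<integral>\<^sup>+y1. h (y1 - 1/2) \<partial>lborel) * (\<integral>\<^sup>+x2. c x2 \<partial>lborel)"
        by (simp add: nn_integral_multc nn_integral_cmult)
      finally show ?thesis unfolding 1 by (simp add: c_def)
    qed
    also have "(\<integral>\<^sup>+x1. h (1/2 - x1) \<partial>lborel) = (\<integral>\<^sup>+t. h t \<partial>lborel)" by (rule nn_integral_lborel_diff(1)) measurable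
    also have "(\<integral>\<^sup>+y1. h (y1 - 1/2) \<partial>lborel) = (\<integral>\<^sup>+t. h t \<partial>lborel)" by (rule nn_integral_lborel_diff(2)) measurable
    also have "(\<integral>\<^sup>+t. h t \<partial>lborel) * (\<integral>\<^sup>+t. h t \<partial>lborel) * (\<integral>\<^sup>+x2. (\<integral>\<^sup>+y2. pole \<beta> (norm (x2 - y2)) * cb y2 \<partial>lborel) * cb x2 \<partial>lborel)
       \<le> Ka * Ka * (\<integral>\<^sup>+x2. J * cb x2 \<partial>lborel)"
      by (intro mult_mono hKa nn_integral_mono Jx) auto
    also have "(\<integral>\<^sup>+x2. J * cb x2 \<partial>lborel) = J * emeasure lborel (cball (0::'b) \<rho>)"
      unfolding cb_def by (rule nn_integral_cmult_indicator) (simp add: borel_closed)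
    also have "Ka * Ka * (J * emeasure lborel (cball (0::'b) \<rho>)) \<le> ennreal (C * \<rho> powr (?m + 1 - (1 + s) / 2))"
    proof (cases "\<rho> = 0")
      case True
      then show ?thesis by (simp add: emeasure_cball zero_power)
    next
      case False
      then have \<rho>0: "\<rho> > 0" using \<rho> by simp
      have J: "J = ennreal ((2 * \<rho>) powr (?m - \<beta>)) * Kb"
        unfolding J_def Kb_def using \<rho>0 by (intro nn_integral_pole_cball) auto
      have e: "emeasure lborel (cball (0::'b) \<rho>) = ennreal (v * \<rho> ^ DIM('b))" using \<rho> by (simp add: emeasure_cball v_def)
      have Kae: "Ka = ennreal (enn2real Ka)" "Kb = ennreal (enn2real Kb)" using Ka Kb by simp_all
      have "Ka * Ka * (J * emeasure lborel (cball (0::'b) \<rho>))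
        = ennreal (enn2real Ka * enn2real Ka * ((2 * \<rho>) powr (?m - \<beta>) * enn2real Kb * (v * \<rho> ^ DIM('b))))"
        unfolding J e using v \<rho>0 by (subst (1 2) Kae(1), subst Kae(2)) (simp add: ennreal_mult')
      also have "enn2real Ka * enn2real Ka * ((2 * \<rho>) powr (?m - \<beta>) * enn2real Kb * (v * \<rho> ^ DIM('b)))
        = C * (\<rho> powr (?m - \<beta>) * \<rho> ^ DIM('b))"
        using \<rho>0 by (simp add: C_def powr_mult ac_simps)
      also have "\<rho> powr (?m - \<beta>) * \<rho> ^ DIM('b) = \<rho> powr (?m + 1 - (1 + s) / 2)"
      proof -
        have "\<rho> ^ DIM('b) = \<rho> powr ?m" using \<rho>0 by (simp add: powr_realpow)
        then have "\<rho> powr (?m - \<beta>) * \<rho> ^ DIM('b) = \<rho> powr (?m - \<beta> + ?m)" by (simp only: powr_add)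
        also have "?m - \<beta> + ?m = ?m + 1 - (1 + s) / 2" by (simp add: \<beta>_def)
        finally show ?thesis .
      qed
      finally show ?thesis by simp
    qed
    finally show ?thesis .
  qed
  show ?thesis using C main by blast
qed

lemma interaction_uminus:
  fixes U V :: "'a::euclidean_space set"
  assumes [measurable]: "\<kappa> \<in> borel_measurable borel" "U \<in> sets borel" "V \<in> sets borel"
    and even: "\<And>z. \<kappa> (- z) = \<kappa> z"
  shows "interaction \<kappa> (uminus -` U) (uminus -` V) = interaction \<kappa> U V"
proof -
  let ?f = "\<lambda>x y. \<kappa> (x - y) * indicator U x * indicator V y"
  have "interaction \<kappa> (uminus -` U) (uminus -` V) = (\<integral>\<^sup>+x. (\<integral>\<^sup>+y. ?f (- x) (- y) \<partial>lborel) \<partial>lborel)"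
    unfolding interaction_def
  proof (intro nn_integral_cong)
    fix x y
    show "\<kappa> (x - y) * indicator (uminus -` U) x * indicator (uminus -` V) y = ?f (- x) (- y)"
      using even[of "x - y"] by (simp add: indicator_def)
  qed
  also have "\<dots> = (\<integral>\<^sup>+x. (\<integral>\<^sup>+y. ?f (- x) y \<partial>lborel) \<partial>lborel)"
    by (intro nn_integral_cong nn_integral_lborel_uminus) measurable
  also have "\<dots> = (\<integral>\<^sup>+x. (\<integral>\<^sup>+y. ?f x y \<partial>lborel) \<partial>lborel)"
    by (rule nn_integral_lborel_uminus) measurable
  finally show ?thesis by (simp add: interaction_def)
qed


lemma emeasure_shift: "A \<in> sets borel \<Longrightarrow> emeasure lborel (shift k A) = emeasure lborel A"
  unfolding shift_def diff_conv_add_uminus by (rule emeasure_lborel_translate)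

text \<open>Translates by at least two periods are at distance at least half their index, which
  gives a convergent sum times the squared volume. For the adjacent periods, pairs whose first
  coordinates differ by at least \<open>1/4\<close> obey a similar bound, and the remaining pairs
  lie in two neck cylinders.\<close>

lemma periodic_interaction_bound:
  fixes s :: real
  assumes s: "0 < s" "s < 1"
  obtains C where "C \<ge> 0"
    and "\<And>(F :: (real \<times> 'b::euclidean_space) set) \<mu> \<rho>. F \<in> sets borel \<Longrightarrow> F \<subseteq> strip \<Longrightarrow> \<forall>x\<in>F. - x \<in> F \<Longrightarrow>
     0 \<le> \<mu> \<Longrightarrow> emeasure lborel F = ennreal \<mu> \<Longrightarrow> 0 \<le> \<rho> \<Longrightarrow> \<forall>p\<in>F. 1/4 \<le> \<bar>fst p\<bar> \<longrightarrow> norm (snd p) \<le> \<rho> \<Longrightarrow>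
     (\<integral>\<^sup>+k. (if k = 0 then 0 else interaction (riesz_kernel s) F (shift k F)) \<partial>count_space UNIV)
       \<le> ennreal (C * (\<mu>\<^sup>2 + \<rho> powr (real DIM('b) + 1 - (1 + s) / 2)))"
proof -
  let ?n = "real DIM(real \<times> 'b)" and ?e = "real DIM('b) + 1 - (1 + s) / 2"
  let ?k = "riesz_kernel s :: real \<times> 'b \<Rightarrow> ennreal"
  obtain C0 where C0: "C0 \<ge> 0" and neck: "\<And>\<rho>. \<rho> \<ge> 0 \<Longrightarrow>
    interaction ?k ({1/4..1/2} \<times> cball 0 \<rho>) ({1/2..3/4} \<times> cball 0 \<rho>) \<le> ennreal (C0 * \<rho> powr ?e)"
    using neck_interaction_bound[OF s, where 'b='b] by blast
  define S where "S = enn2real (\<integral>\<^sup>+k. ennreal (1 / (real_of_int k)\<^sup>2) \<partial>count_space UNIV)"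
  have S: "(\<integral>\<^sup>+k. ennreal (1 / (real_of_int k)\<^sup>2) \<partial>count_space UNIV) = ennreal S" "S \<ge> 0"
    using nn_integral_inverse_squares_int by (simp_all add: S_def)
  define A where "A = 4 powr (?n + s)"
  have n2: "?n \<ge> 2" using DIM_positive[where 'a='b] by simp
  have A4: "A \<ge> 4"
  proof -
    have "(4::real) powr 1 \<le> 4 powr (?n + s)" using n2 s by (intro powr_mono) auto
    then show ?thesis by (simp add: A_def)
  qed
  define C where "C = A * S + 2 * C0"
  have main: "(\<integral>\<^sup>+k. (if k = 0 then 0 else interaction ?k F (shift k F)) \<partial>count_space UNIV) \<le> ennreal (C * (\<mu>\<^sup>2 + \<rho> powr ?e))"
    if F[measurable]: "F \<in> sets borel" and Fs: "F \<subseteq> strip" and even: "\<forall>x\<in>F. - x \<in> F"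
      and \<mu>: "0 \<le> \<mu>" "emeasure lborel F = ennreal \<mu>" and \<rho>: "0 \<le> \<rho>" "\<forall>p\<in>F. 1/4 \<le> \<bar>fst p\<bar> \<longrightarrow> norm (snd p) \<le> \<rho>"
    for F :: "(real \<times> 'b) set" and \<mu> \<rho>
  proof -
    let ?U = "{1/4..1/2::real} \<times> cball (0::'b) \<rho>" and ?V = "{1/2..3/4::real} \<times> cball (0::'b) \<rho>"
    have UV[measurable]: "?U \<in> sets borel" "?V \<in> sets borel"
      by (auto intro!: borel_closed closed_Times)
    have sh[measurable]: "shift k F \<in> sets borel" for k by (rule shift_borel[OF F])
    define N where "N = interaction ?k ?U ?V"
    have const: "interaction (\<lambda>_. ennreal c) F (shift k F) = ennreal (c * \<mu>\<^sup>2)" if "c \<ge> 0" for c k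
    proof -
      have "interaction (\<lambda>_. ennreal c) F (shift k F) = (\<integral>\<^sup>+x. (ennreal c * indicator F x) * ennreal \<mu> \<partial>lborel)"
        unfolding interaction_def
        by (intro nn_integral_cong) (simp add: nn_integral_cmult emeasure_shift \<mu>)
      also have "\<dots> = ennreal c * ennreal \<mu> * ennreal \<mu>"
        by (simp add: nn_integral_multc nn_integral_cmult \<mu>)
      finally show ?thesis using that \<mu> by (simp add: ennreal_mult' power2_eq_square mult.assoc)
    qed
    have one: "interaction ?k F (shift 1 F) \<le> ennreal (A * \<mu>\<^sup>2) + N"
    proof -
      have "interaction ?k F (shift 1 F) \<le>
        (\<integral>\<^sup>+x. (\<integral>\<^sup>+y. ennreal A * indicator F x * indicator (shift 1 F) y + ?k (x - y) * indicator ?U x * indicator ?V y \<partial>lborel) \<partial>lborel)"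
        unfolding interaction_def
      proof (intro nn_integral_mono)
        fix x y :: "real \<times> 'b"
        show "?k (x - y) * indicator F x * indicator (shift 1 F) y
          \<le> ennreal A * indicator F x * indicator (shift 1 F) y + ?k (x - y) * indicator ?U x * indicator ?V y"
        proof (cases "x \<in> F \<and> y \<in> shift 1 F")
          case True
          define y' where "y' = y - (1, 0)"
          have y': "y' \<in> F" "fst y' = fst y - 1" "snd y' = snd y" using True by (auto simp: shift_def y'_def)
          have xs: "\<bar>fst x\<bar> \<le> 1/2" "\<bar>fst y'\<bar> \<le> 1/2" 
            using subsetD[OF Fs, of x] subsetD[OF Fs, of y'] True y'(1) by (simp_all add: strip_iff)
          show ?thesis
          proof (cases "1/4 \<le> \<bar>fst x - fst y\<bar>")
            case far: True
            have "\<bar>fst (x - y)\<bar> \<le> norm (x - y)"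
              using norm_fst_le[of "fst (x - y)" "snd (x - y)"] unfolding prod.collapse by simp
            then have "?k (x - y) \<le> ennreal ((1/4) powr - (?n + s))"
              using far s by (intro riesz_kernel_le) auto
            also have "(1/4) powr - (?n + s) = A"
            proof -
              have "(1/4::real) powr - p = 4 powr p" for p by (simp add: powr_minus powr_divide)
              then show ?thesis unfolding A_def .
            qed
            finally show ?thesis using True by (simp add: add_increasing2)
          next
            case near: False
            \<comment> \<open>Here \<open>fst x \<le> 1/2\<close> and
              \<open>fst y \<ge> 1/2\<close>; being within \<open>1/4\<close> forces
              \<open>fst x > 1/4\<close> and \<open>fst y < 3/4\<close>, so both points belong to
              the necks.\<close>
            have "norm (snd x) \<le> \<rho>" using \<rho>(2) True near xs y' by (intro \<rho>(2)[rule_format]) auto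
            moreover have "norm (snd y') \<le> \<rho>" using near xs y' by (intro \<rho>(2)[rule_format]) auto
            ultimately have "x \<in> ?U" "y \<in> ?V" using near xs y' by (auto simp: mem_Times_iff)
            then show ?thesis using True by (simp add: add_increasing)
          qed
        qed (auto simp: indicator_def)
      qed
      also have "\<dots> = interaction (\<lambda>_. ennreal A) F (shift 1 F) + N"
        unfolding interaction_def N_def by (subst nn_integral_add[symmetric]) (auto simp: nn_integral_add)
      finally show ?thesis using A4 by (simp add: const)
    qed
    have minus_one: "interaction ?k F (shift (-1) F) = interaction ?k F (shift 1 F)"
    proof -
      have evenI: "- x \<in> F \<longleftrightarrow> x \<in> F" for x using even by (metis minus_minus)
      have "uminus -` F = F" using evenI by auto
      moreover have "uminus -` shift 1 F = shift (-1) F"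
      proof (rule set_eqI)
        fix x :: "real \<times> 'b"
        have eq: "- x - (real_of_int 1, 0) = - (x - (real_of_int (-1), 0))" by (cases x) simp
        show "x \<in> uminus -` shift 1 F \<longleftrightarrow> x \<in> shift (-1) F"
          unfolding shift_def vimage_eq eq by (rule evenI)
      qed
      ultimately show ?thesis using interaction_uminus[of ?k F "shift 1 F"] by simp
    qed
    have far: "interaction ?k F (shift k F) \<le> ennreal (A / (real_of_int k)\<^sup>2 * \<mu>\<^sup>2)" if k: "\<bar>k\<bar> \<ge> 2" for k
    proof -
      have kk: "\<bar>real_of_int k\<bar> \<ge> 2" using k by linarith
      have "interaction ?k F (shift k F) \<le> interaction (\<lambda>_. ennreal (A / (real_of_int k)\<^sup>2)) F (shift k F)"
        unfolding interaction_def
      proof (intro nn_integral_mono)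
        fix x y :: "real \<times> 'b"
        show "?k (x - y) * indicator F x * indicator (shift k F) y \<le> ennreal (A / (real_of_int k)\<^sup>2) * indicator F x * indicator (shift k F) y"
        proof (cases "x \<in> F \<and> y \<in> shift k F")
          case True
          have "y - (real_of_int k, 0) \<in> F" using True by (simp add: shift_def)
          then have xs: "\<bar>fst x\<bar> \<le> 1/2" "\<bar>fst y - real_of_int k\<bar> \<le> 1/2"
            using subsetD[OF Fs, of x] subsetD[OF Fs, of "y - (real_of_int k, 0)"] True by (simp_all add: strip_iff)
          have "\<bar>fst (x - y)\<bar> \<le> norm (x - y)"
            using norm_fst_le[of "fst (x - y)" "snd (x - y)"] unfolding prod.collapse by simp
          then have "\<bar>real_of_int k\<bar> / 2 \<le> norm (x - y)" using xs kk by (simp add: abs_if split: if_splits)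
          then have "?k (x - y) \<le> ennreal ((\<bar>real_of_int k\<bar> / 2) powr - (?n + s))"
            using kk s by (intro riesz_kernel_le) auto
          also have "\<dots> \<le> ennreal (A / (real_of_int k)\<^sup>2)"
          proof (rule ennreal_leI)
            have "(\<bar>real_of_int k\<bar> / 2) powr - (?n + s) \<le> (\<bar>real_of_int k\<bar> / 2) powr - 2"
            proof (rule powr_mono)
              show "- (?n + s) \<le> - 2" using n2 s by linarith
            qed (use kk in auto)
            also have "\<dots> = 4 / (real_of_int k)\<^sup>2"
              using kk by (simp add: powr_minus power_divide)
            also have "\<dots> \<le> A / (real_of_int k)\<^sup>2" using A4 by (intro divide_right_mono) auto
            finally show "(\<bar>real_of_int k\<bar> / 2) powr - (?n + s) \<le> A / (real_of_int k)\<^sup>2" .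
          qed
          finally show ?thesis using True by simp
        qed (auto simp: indicator_def)
      qed
      then show ?thesis using A4 by (simp add: const)
    qed
    have each: "(if k = 0 then 0 else interaction ?k F (shift k F)) \<le> ennreal (A * \<mu>\<^sup>2) * ennreal (1 / (real_of_int k)\<^sup>2) + N * indicator {1, -1} k" for k :: int
    proof -
      have pr: "ennreal (A * \<mu>\<^sup>2) * ennreal (1 / (real_of_int k)\<^sup>2) = ennreal (A / (real_of_int k)\<^sup>2 * \<mu>\<^sup>2)"
        using A4 by (simp add: ennreal_mult'[symmetric])
      consider "k = 0" | "k = 1" | "k = -1" | "\<bar>k\<bar> \<ge> 2" by linarith
      then show ?thesis
      proof cases
        case 2 then show ?thesis using one by (simp add: pr)
      next
        case 3 then show ?thesis using one minus_one by (simp add: pr)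
      next
        case 4 then show ?thesis using far[of k] unfolding pr by (auto simp: indicator_def)
      qed simp
    qed
    have "(\<integral>\<^sup>+k. (if k = 0 then 0 else interaction ?k F (shift k F)) \<partial>count_space UNIV)
       \<le> (\<integral>\<^sup>+k. ennreal (A * \<mu>\<^sup>2) * ennreal (1 / (real_of_int k)\<^sup>2) + N * indicator {1, -1} k \<partial>count_space UNIV)"
      by (intro nn_integral_mono each)
    also have "\<dots> = ennreal (A * \<mu>\<^sup>2) * ennreal S + N * 2"
      by (subst nn_integral_add) (auto simp: nn_integral_cmult nn_integral_cmult_indicator S)
    also have "\<dots> \<le> ennreal (A * \<mu>\<^sup>2) * ennreal S + ennreal (C0 * \<rho> powr ?e) * 2"
      unfolding N_def by (intro add_mono mult_right_mono neck \<rho> order_refl) auto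
    also have "\<dots> = ennreal (A * \<mu>\<^sup>2 * S + C0 * \<rho> powr ?e * 2)"
    proof -
      have "ennreal (C0 * \<rho> powr ?e) * 2 = ennreal (C0 * \<rho> powr ?e * 2)"
        using C0 by (subst ennreal_mult) auto
      moreover have "0 \<le> A * \<mu>\<^sup>2 * S" "0 \<le> C0 * \<rho> powr ?e * 2" using A4 S C0 by auto
      ultimately show ?thesis using S A4 by (simp add: ennreal_mult'[symmetric])
    qed
    also have "\<dots> \<le> ennreal (C * (\<mu>\<^sup>2 + \<rho> powr ?e))"
    proof (rule ennreal_leI)
      have "0 \<le> A * S * \<rho> powr ?e" "0 \<le> 2 * C0 * \<mu>\<^sup>2" using A4 S C0 by auto
      then show "A * \<mu>\<^sup>2 * S + C0 * \<rho> powr ?e * 2 \<le> C * (\<mu>\<^sup>2 + \<rho> powr ?e)"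
        by (simp add: C_def algebra_simps)
    qed
    finally show ?thesis .
  qed
  have "C \<ge> 0" using A4 S C0 by (simp add: C_def)
  then show ?thesis by (rule that[OF _ main])
qed

text \<open>If the first term dominates, \<open>x\<close> has order
  \<open>l powr ((n + s) / 2)\<close>. Otherwise \<open>x powr q\<close> is absorbed, as
  \<open>q < 2\<close>, and \<open>x\<close> has order \<open>l powr (w / (2 - q))\<close> with
  \<open>w = n * q - n + s\<close>. Both exponents are at least \<open>\<theta>\<close>, and
  \<open>l \<le> 1\<close>.\<close>

lemma bootstrap_exponent:
  fixes n s l x K :: real
  assumes n: "n \<ge> 2" and s: "0 < s" "s < 1" and l: "0 < l" "l \<le> 1" and x: "x \<ge> 0" and K: "K > 0"
  defines "q \<equiv> (n - (1 + s) / 2) / (n - 1)" and "\<theta> \<equiv> (n\<^sup>2 - s\<^sup>2) / (2 * n * (n - 1))"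
  assumes ineq: "x\<^sup>2 \<le> K * (l powr (n + s) + l powr (n * q - n + s) * x powr q)"
  shows "x \<le> ((2 * K) powr (1/2) + (2 * K) powr (1 / (2 - q))) * l powr \<theta>"
proof (cases "x = 0")
  case False
  then have x0: "x > 0" using x by simp
  define w where "w = n * q - n + s"
  have n1: "n - 1 > 0" using n by simp
  have q2: "2 - q = (n - 2 + (1 + s) / 2) / (n - 1)" using n1 by (simp add: q_def field_simps)
  have b0: "n - 2 + (1 + s) / 2 > 0" using n s by (intro add_nonneg_pos) auto
  then have q2p: "2 - q > 0" unfolding q2 using n1 by (intro divide_pos_pos)
  have w: "w = (n - s - n * (1 - s) / 2) / (n - 1)" using n1 by (simp add: w_def q_def field_simps)
  have \<theta>1: "\<theta> \<le> (n + s) / 2"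
  proof -
    have "n * 1 \<le> n * (n - 1)" using n by (intro mult_left_mono) auto
    then have "n - s \<le> n * (n - 1)" using s by linarith
    then have "(n + s) * (n - s) \<le> (n + s) * (n * (n - 1))" using n s by (intro mult_left_mono) auto
    moreover have "n\<^sup>2 - s\<^sup>2 = (n + s) * (n - s)" by (simp add: power2_eq_square algebra_simps)
    moreover have "(n + s) / 2 * (2 * n * (n - 1)) = (n + s) * (n * (n - 1))" by simp
    ultimately have "n\<^sup>2 - s\<^sup>2 \<le> (n + s) / 2 * (2 * n * (n - 1))" by (simp only:)
    then show ?thesis unfolding \<theta>_def using n by (simp add: pos_divide_le_eq)
  qed
  \<comment> \<open>Dropping the square of \<open>s\<close> gives
    \<open>\<theta> \<le> n / (2 * (n - 1))\<close>. With
    \<open>n - 2 + (1 + s) / 2 \<le> n - 1\<close> the claim reduces to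
    \<open>2 * s \<le> n * s\<close>.\<close>
  have \<theta>2: "\<theta> \<le> w / (2 - q)"
  proof -
    have 1: "\<theta> \<le> n / (2 * (n - 1))"
    proof -
      have "(n\<^sup>2 - s\<^sup>2) / (2 * n * (n - 1)) \<le> n\<^sup>2 / (2 * n * (n - 1))" using n by (intro divide_right_mono) auto
      also have "\<dots> = n / (2 * (n - 1))" using n by (simp add: power2_eq_square)
      finally show ?thesis by (simp add: \<theta>_def)
    qed
    have "\<theta> * (n - 2 + (1 + s) / 2) \<le> n / (2 * (n - 1)) * (n - 1)"
      using 1 b0 s n by (intro mult_mono) auto
    also have "\<dots> = n / 2"
    proof -
      have "n / (2 * d) * d = n / 2" if "d > 0" for d :: real using that by simp
      then show ?thesis using n1 by blast
    qed
    also have "\<dots> \<le> n - s - n * (1 - s) / 2"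
    proof -
      have "2 * s \<le> n * s" using n s by (intro mult_right_mono) auto
      then show ?thesis by (simp add: algebra_simps diff_divide_distrib)
    qed
    finally have "\<theta> \<le> (n - s - n * (1 - s) / 2) / (n - 2 + (1 + s) / 2)"
      using b0 by (simp add: pos_le_divide_eq)
    also have "\<dots> = w / (2 - q)" unfolding w q2 using n1 by simp
    finally show ?thesis .
  qed
  have lmono: "l powr a \<le> l powr \<theta>" if "\<theta> \<le> a" for a using l that by (intro powr_mono') auto
  have "x \<le> (2 * K) powr (1/2) * l powr \<theta> \<or> x \<le> (2 * K) powr (1 / (2 - q)) * l powr \<theta>"
  proof (cases "l powr w * x powr q \<le> l powr (n + s)")
    case True
    then have "K * (l powr (n + s) + l powr w * x powr q) \<le> K * (2 * l powr (n + s))"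
      using K by (intro mult_left_mono) auto
    then have "x\<^sup>2 \<le> 2 * K * l powr (n + s)" using ineq by (simp add: w_def)
    then have "(x\<^sup>2) powr (1/2) \<le> (2 * K * l powr (n + s)) powr (1/2)" by (intro powr_mono2) auto
    also have "(x\<^sup>2) powr (1/2) = x" using x by (simp add: powr_half_sqrt)
    also have "(2 * K * l powr (n + s)) powr (1/2) = (2 * K) powr (1/2) * l powr ((n + s) / 2)"
      using K by (simp add: powr_mult powr_powr)
    also have "\<dots> \<le> (2 * K) powr (1/2) * l powr \<theta>" by (intro mult_left_mono lmono \<theta>1) auto
    finally show ?thesis by simp
  next
    case False
    then have "K * (l powr (n + s) + l powr w * x powr q) \<le> K * (2 * (l powr w * x powr q))"
      using K by (intro mult_left_mono) auto
    then have "x\<^sup>2 \<le> 2 * K * l powr w * x powr q" using ineq by (simp add: w_def mult.assoc)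
    moreover have "x\<^sup>2 = x powr (2 - q) * x powr q" using x0 by (simp add: powr_add[symmetric])
    ultimately have "x powr (2 - q) \<le> 2 * K * l powr w" using x0 by simp
    then have "(x powr (2 - q)) powr (1 / (2 - q)) \<le> (2 * K * l powr w) powr (1 / (2 - q))"
      using q2p by (intro powr_mono2) auto
    also have "(x powr (2 - q)) powr (1 / (2 - q)) = x" using x0 q2p by (simp add: powr_powr)
    also have "(2 * K * l powr w) powr (1 / (2 - q)) = (2 * K) powr (1 / (2 - q)) * l powr (w / (2 - q))"
      using K by (simp add: powr_mult powr_powr)
    also have "\<dots> \<le> (2 * K) powr (1 / (2 - q)) * l powr \<theta>" by (intro mult_left_mono lmono \<theta>2) auto
    finally show ?thesis by simp
  qed
  moreover have "0 \<le> (2 * K) powr (1/2) * l powr \<theta>" "0 \<le> (2 * K) powr (1 / (2 - q)) * l powr \<theta>" by auto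
  ultimately show ?thesis unfolding distrib_right by linarith
qed simp

section \<open>Asymmetry of periodic minimizers\<close>

lemma emeasure_scaleR_vimage:
  fixes A :: "'a::euclidean_space set"
  assumes [measurable]: "A \<in> sets borel" and l: "l > 0"
  shows "emeasure lborel A = ennreal (l ^ DIM('a)) * emeasure lborel ((\<lambda>x. l *\<^sub>R x) -` A)"
proof -
  have "emeasure lborel A = ennreal (l ^ DIM('a)) * (\<integral>\<^sup>+x. indicator A (l *\<^sub>R x) \<partial>lborel)"
    using nn_integral_lborel_scaleR[of "indicator A" l] l by simp
  also have "(\<integral>\<^sup>+x. indicator A (l *\<^sub>R x) \<partial>lborel) = (\<integral>\<^sup>+x. indicator ((\<lambda>x. l *\<^sub>R x) -` A) x \<partial>lborel)"
    by (rule nn_integral_cong) (simp add: indicator_def)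
  also have "\<dots> = emeasure lborel ((\<lambda>x. l *\<^sub>R x) -` A)"
    by (rule nn_integral_indicator) (simp add: measurable_sets_borel[of "\<lambda>x. l *\<^sub>R x" borel])
  finally show ?thesis .
qed

text \<open>The centred ball competes in the infimum, and equal volumes make the two parts of the
  symmetric difference equally large.\<close>

lemma fraenkel_asym_le:
  fixes F :: "'a::euclidean_space set"
  assumes F: "F \<in> sets borel" "emeasure lborel F = ennreal \<mu>" "\<mu> > 0"
    and B: "measure lborel (ball (0::'a) l) = \<mu>"
  shows "fraenkel_asym F \<le> 2 * measure lborel (F - ball 0 l) / \<mu>" "measure lborel (F - ball 0 l) \<le> \<mu>"
proof -
  let ?B = "ball (0::'a) l"
  have F\<mu>: "measure lborel F = \<mu>" using F by (simp add: measure_def)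
  have fm: "F \<in> fmeasurable lborel" "?B \<in> fmeasurable lborel"
    using F emeasure_lborel_ball_finite[of "0::'a" l] by (auto simp: fmeasurable_def)
  have 1: "measure lborel (F - ?B) = \<mu> - measure lborel (F \<inter> ?B)"
    using measure_Diff[of lborel F "F \<inter> ?B"] fm F\<mu> by (simp add: Diff_Int fmeasurable_def less_top)
  have 2: "measure lborel (?B - F) = \<mu> - measure lborel (F \<inter> ?B)"
    using measure_Diff[of lborel ?B "F \<inter> ?B"] fm B by (simp add: Diff_Int fmeasurable_def less_top)
  have "measure lborel ((F - ?B) \<union> (?B - F)) = measure lborel (F - ?B) + measure lborel (?B - F)"
    using fm by (intro measure_Un_AE) auto
  then have sum: "measure lborel ((F - ?B) \<union> (?B - F)) = 2 * measure lborel (F - ?B)" using 1 2 by simp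
  have "fraenkel_asym F \<le> measure lebesgue ((F - ?B) \<union> (?B - F)) / measure lebesgue F"
    unfolding fraenkel_asym_def
  proof (rule cINF_lower)
    show "bdd_below ((\<lambda>B. measure lebesgue ((F - B) \<union> (B - F)) / measure lebesgue F) ` {ball c r |c r. measure lebesgue (ball c r) = measure lebesgue F})"
      by (rule bdd_belowI2[where m=0]) simp
    show "?B \<in> {ball c r |c r. measure lebesgue (ball c r) = measure lebesgue F}"
      using B F\<mu> F by (intro CollectI exI[of _ 0] exI[of _ l]) simp
  qed
  then show "fraenkel_asym F \<le> 2 * measure lborel (F - ball 0 l) / \<mu>"
    using F F\<mu> sum by simp
  show "measure lborel (F - ?B) \<le> \<mu>" using 1 by simp
qed

theorem theorem1p3:
  fixes s :: real
  assumes "CARD('m::finite) \<ge> 1" and "0 < s" and "s < 1"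
  shows "\<exists>C>0. \<forall>(\<mu>::real) (F :: (real \<times> (real^'m)) set).
     0 < \<mu> \<and> \<mu> < 1 \<and> F \<in> classK \<and> emeasure lebesgue F = ennreal \<mu> \<and>
     (\<forall>G :: (real \<times> (real^'m)) set. G \<in> classK \<and> emeasure lebesgue G = ennreal \<mu> \<longrightarrow> per_P s F \<le> per_P s G)
     \<longrightarrow> fraenkel_asym F \<le> C * \<mu> powr
          ((real DIM(real \<times> (real^'m)) ^ 2 - s ^ 2) /
           (2 * real DIM(real \<times> (real^'m)) ^ 2 * (real DIM(real \<times> (real^'m)) - 1)))"
proof -
  define NN where "NN = DIM(real \<times> (real^'m))"
  define MM where "MM = DIM(real^'m)"
  have s: "0 < s" "s < 1" by fact+
  define n where "n = real NN"
  have nM: "n = real MM + 1" unfolding n_def NN_def MM_def by simp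
  have M1: "real MM \<ge> 1" unfolding MM_def using DIM_positive[where 'a="real^'m"] by linarith
  have N0: "NN > 0" unfolding NN_def by simp
  have n: "n \<ge> 2" using nM M1 by simp
  let ?k = "riesz_kernel s :: real \<times> (real^'m) \<Rightarrow> ennreal"
  obtain Cs where Cs: "Cs > 0" and stab: "\<And>(E :: (real \<times> (real^'m)) set) \<delta>. E \<in> sets borel \<Longrightarrow>
    emeasure lborel E = emeasure lborel (ball (0::real \<times> (real^'m)) 1) \<Longrightarrow> radially_monotone E \<Longrightarrow> 0 \<le> \<delta> \<Longrightarrow>
    perimeter ?k E \<le> perimeter ?k (ball 0 1) + ennreal \<delta> \<Longrightarrow> measure lborel (E - ball 0 1) \<le> Cs * sqrt \<delta>"
    by (rule fractional_isoperimetric_stability[OF s, where 'a="real \<times> (real^'m)"]) (rule that)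
  obtain Ci where Ci: "Ci \<ge> 0" and inter0: "\<And>(F :: (real \<times> (real^'m)) set) \<mu> \<rho>. F \<in> sets borel \<Longrightarrow> F \<subseteq> strip \<Longrightarrow> \<forall>x\<in>F. - x \<in> F \<Longrightarrow>
     0 \<le> \<mu> \<Longrightarrow> emeasure lborel F = ennreal \<mu> \<Longrightarrow> 0 \<le> \<rho> \<Longrightarrow> \<forall>p\<in>F. 1/4 \<le> \<bar>fst p\<bar> \<longrightarrow> norm (snd p) \<le> \<rho> \<Longrightarrow>
     (\<integral>\<^sup>+k. (if k = 0 then 0 else interaction ?k F (shift k F)) \<partial>count_space UNIV)
       \<le> ennreal (Ci * (\<mu>\<^sup>2 + \<rho> powr (real DIM(real^'m) + 1 - (1 + s) / 2)))"
    by (rule periodic_interaction_bound[OF s, where 'b="real^'m"]) (rule that)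
  define e where "e = real MM + 1 - (1 + s) / 2"
  note inter = inter0[folded MM_def, folded e_def]
  define v where "v = unit_ball_vol n"
  have v: "v > 0" using n by (simp add: v_def)
  define v' where "v' = unit_ball_vol (real MM)"
  have v': "v' > 0" by (simp add: v'_def)
  define \<alpha> where "\<alpha> = (n\<^sup>2 - s\<^sup>2) / (2 * n\<^sup>2 * (n - 1))"
  define \<theta> where "\<theta> = (n\<^sup>2 - s\<^sup>2) / (2 * n * (n - 1))"
  have \<theta>: "\<theta> = n * \<alpha>" using n by (simp add: \<theta>_def \<alpha>_def power2_eq_square)
  have "s\<^sup>2 \<le> n\<^sup>2" using n s by (intro power_mono) auto
  then have \<alpha>0: "\<alpha> \<ge> 0" using n by (simp add: \<alpha>_def)
  define q where "q = (n - (1 + s) / 2) / (n - 1)"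
  have e_n: "e = n - (1 + s) / 2" by (simp add: e_def nM)
  \<comment> \<open>This fixes \<open>q\<close>: the cross-section size \<open>\<rho> ^ MM\<close>,
    raised to the power \<open>q\<close>, becomes the neck term
    \<open>\<rho> powr e\<close>.\<close>
  have qe: "real MM * q = e" using M1 unfolding q_def e_n nM by simp
  have q0: "q > 0" using n s by (simp add: q_def)
  define K where "K = Cs\<^sup>2 * Ci * (v\<^sup>2 + (8 / v') powr q) + 1"
  have K: "K > 0" using Ci by (simp add: K_def add_nonneg_pos)
  define D where "D = (2 * K) powr (1/2) + (2 * K) powr (1 / (2 - q))"
  have D: "D > 0" using K by (simp add: D_def add_pos_pos)
  \<comment> \<open>The first summand serves small radii. The second serves radii from
    \<open>1/8\<close> on, where the volume is at least \<open>v / 8 ^ NN\<close> and the asymmetry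
    at most 2.\<close>
  define C where "C = 2 * D / v * (1 / v) powr \<alpha> + 2 / (v / 8 ^ NN) powr \<alpha>"
  have C: "C > 0" using D v by (simp add: C_def add_pos_pos)
  have main: "fraenkel_asym F \<le> C * \<mu> powr \<alpha>"
    if \<mu>: "0 < \<mu>" "\<mu> < 1" and F: "F \<in> classK" "emeasure lebesgue F = ennreal \<mu>"
      and min: "\<And>G :: (real \<times> (real^'m)) set. G \<in> classK \<Longrightarrow> emeasure lebesgue G = ennreal \<mu> \<Longrightarrow> per_P s F \<le> per_P s G"
    for \<mu> and F :: "(real \<times> (real^'m)) set"
  proof -
    have Fb[measurable]: "F \<in> sets borel" and Fs: "F \<subseteq> strip" and Fm: "orthant_monotone F"
      using classK_properties[OF F(1)] by auto
    have Fv: "emeasure lborel F = ennreal \<mu>" using F(2) Fb by simp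
    define l where "l = root NN (\<mu> / v)"
    have lN: "l ^ NN = \<mu> / v" using \<mu> v N0 by (simp add: l_def)
    have l: "l > 0" using \<mu> v N0 by (simp add: l_def)
    have Bl: "emeasure lborel (ball (0::real \<times> (real^'m)) l) = ennreal \<mu>"
      using v lN unfolding emeasure_ball[OF less_imp_le[OF l]] NN_def[symmetric] n_def[symmetric] v_def[symmetric] by simp
    have Bm: "measure lborel (ball (0::real \<times> (real^'m)) l) = \<mu>"
      using Bl \<mu> by (simp add: measure_def)
    define y where "y = measure lborel (F - ball 0 l)"
    have asym: "fraenkel_asym F \<le> 2 * y / \<mu>" and y: "y \<le> \<mu>" "y \<ge> 0"
      using fraenkel_asym_le[OF Fb Fv \<mu>(1) Bm] by (auto simp: y_def)
    have lpow: "l powr \<theta> = \<mu> powr \<alpha> * (1 / v) powr \<alpha>"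
    proof -
      have "l powr \<theta> = (l powr n) powr \<alpha>" by (simp add: \<theta> powr_powr)
      also have "l powr n = \<mu> / v" using l lN by (simp add: n_def powr_realpow)
      also have "(\<mu> / v) powr \<alpha> = \<mu> powr \<alpha> * (1 / v) powr \<alpha>" using \<mu> v by (simp add: powr_mult[symmetric])
      finally show ?thesis .
    qed
    \<comment> \<open>For \<open>l < 1/8\<close> the ball fits into the strip and misses the
      cylinder over \<open>{1/8..1/4}\<close>; for larger \<open>l\<close> the trivial bound on the
      asymmetry is enough.\<close>
    show ?thesis
    proof (cases "l < 1/8")
      case False
      have "(1/8) ^ NN \<le> l ^ NN" using False by (intro power_mono) auto
      then have "v / 8 ^ NN \<le> \<mu>" using v by (simp add: lN power_one_over field_simps)
      then have "(v / 8 ^ NN) powr \<alpha> \<le> \<mu> powr \<alpha>" using v \<alpha>0 by (intro powr_mono2) auto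
      then have "2 \<le> 2 / (v / 8 ^ NN) powr \<alpha> * \<mu> powr \<alpha>" using v by (simp add: field_simps)
      also have "\<dots> \<le> C * \<mu> powr \<alpha>" unfolding C_def using D v by (intro mult_right_mono) auto
      finally have "2 \<le> C * \<mu> powr \<alpha>" .
      moreover have "2 * y / \<mu> \<le> 2" using y \<mu> by (simp add: field_simps)
      ultimately show ?thesis using asym by linarith
    next
      case l8: True
      define E where "E = (\<lambda>x. l *\<^sub>R x) -` F"
      have vim: "(\<lambda>x. l *\<^sub>R x) -` A \<in> sets borel" if "A \<in> sets borel" for A :: "(real \<times> (real^'m)) set"
        using measurable_sets_borel[of "\<lambda>x. l *\<^sub>R x" borel A] that by simp
      have Eb[measurable]: "E \<in> sets borel" unfolding E_def by (rule vim[OF Fb])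
      have ball_vim: "(\<lambda>x. l *\<^sub>R x) -` ball (0::real \<times> (real^'m)) l = ball 0 1" using l by (intro set_eqI) simp
      have Ev: "emeasure lborel E = emeasure lborel (ball (0::real \<times> (real^'m)) 1)"
      proof -
        have "ennreal (l ^ NN) * emeasure lborel E = ennreal (l ^ NN) * emeasure lborel (ball (0::real \<times> (real^'m)) 1)"
          using emeasure_scaleR_vimage[OF Fb l] emeasure_scaleR_vimage[OF _ l, of "ball (0::real \<times> (real^'m)) l"] Fv Bl
          unfolding ball_vim E_def[symmetric] NN_def[symmetric] by simp
        then show ?thesis using l by (simp add: ennreal_mult_cancel_left)
      qed
      define x where "x = measure lborel (E - ball 0 1)"
      have x0: "x \<ge> 0" by (simp add: x_def)
      have yx: "y = l ^ NN * x"
      proof -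
        have "(\<lambda>x. l *\<^sub>R x) -` (F - ball 0 l) = E - ball 0 1" using ball_vim by (auto simp: E_def vimage_Diff)
        then have "emeasure lborel (F - ball 0 l) = ennreal (l ^ NN) * emeasure lborel (E - ball 0 1)"
          using emeasure_scaleR_vimage[OF _ l, of "F - ball 0 l"] unfolding NN_def[symmetric] by simp
        then show ?thesis using l by (simp add: y_def x_def measure_def enn2real_mult)
      qed
      have finF: "emeasure lborel F \<noteq> \<infinity>" using Fv by simp
      obtain \<rho> where \<rho>: "\<rho> \<ge> 0" "\<forall>p\<in>F. 1/4 \<le> \<bar>fst p\<bar> \<longrightarrow> norm (snd p) \<le> \<rho>" "{1/8..1/4} \<times> cball 0 \<rho> \<subseteq> F"
        using classK_properties(4)[OF F(1) finF] by blast
      have even: "\<forall>p\<in>F. - p \<in> F" using Fm unfolding orthant_monotone_def by auto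
      \<comment> \<open>The bound for the deficit, transported to unit scale by the factor
        \<open>l powr (s - n)\<close> of the perimeter.\<close>
      define \<delta> where "\<delta> = l powr (s - n) * (Ci * (\<mu>\<^sup>2 + \<rho> powr e))"
      have \<delta>0: "\<delta> \<ge> 0" using Ci by (simp add: \<delta>_def)
      have "perimeter ?k E \<le> perimeter ?k (ball 0 1) + ennreal \<delta>"
      proof -
        have l2: "l < 1/2" using l8 by simp
        have "perimeter ?k F \<le> per_P s F + ennreal (Ci * (\<mu>\<^sup>2 + \<rho> powr e))"
          using perimeter_le_per_P_plus[OF Fb Fs, of s] inter[OF Fb Fs even _ Fv \<rho>(1,2)] \<mu>
          by (meson add_left_mono less_imp_le order_trans)
        also have "per_P s F \<le> per_P s (capped_ball l :: (real \<times> (real^'m)) set)"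
        proof (rule min)
          show K: "(capped_ball l :: (real \<times> (real^'m)) set) \<in> classK" using l by (intro capped_ball_classK) simp
          show "emeasure lebesgue (capped_ball l :: (real \<times> (real^'m)) set) = ennreal \<mu>"
            using emeasure_capped_ball[OF l l2, where 'b="real^'m"] classK_properties(1)[OF K] Bl by simp
        qed
        also have "\<dots> \<le> perimeter ?k (ball 0 l)" by (rule per_P_capped_ball_le[OF l l2])
        finally have PF: "perimeter ?k F \<le> perimeter ?k (ball 0 l) + ennreal (Ci * (\<mu>\<^sup>2 + \<rho> powr e))"
          by (simp add: add_right_mono)
        have "perimeter ?k E = ennreal (l powr (s - n)) * perimeter ?k F"
          unfolding E_def n_def NN_def by (rule perimeter_riesz_scaleR[OF l Fb])
        also have "\<dots> \<le> ennreal (l powr (s - n)) * (perimeter ?k (ball 0 l) + ennreal (Ci * (\<mu>\<^sup>2 + \<rho> powr e)))"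
          by (rule mult_left_mono[OF PF]) simp
        also have "\<dots> = ennreal (l powr (s - n)) * perimeter ?k (ball 0 l) + ennreal \<delta>"
          using Ci by (simp add: distrib_left \<delta>_def ennreal_mult')
        also have "ennreal (l powr (s - n)) * perimeter ?k (ball 0 l) = perimeter ?k (ball 0 1)"
          using perimeter_riesz_scaleR[OF l, of "ball (0::real \<times> (real^'m)) l" s] unfolding ball_vim n_def NN_def by simp
        finally show ?thesis .
      qed
      then have "x \<le> Cs * sqrt \<delta>"
        unfolding x_def by (intro stab Eb Ev \<delta>0) (simp_all add: E_def radially_monotone_scaled[OF Fm l])
      then have "x\<^sup>2 \<le> (Cs * sqrt \<delta>)\<^sup>2" using x0 by (intro power_mono) auto
      then have x2: "x\<^sup>2 \<le> Cs\<^sup>2 * \<delta>" using \<delta>0 by (simp add: power_mult_distrib)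
      \<comment> \<open>The cylinder over \<open>{1/8..1/4}\<close> lies in \<open>F\<close> outside
        the ball, and its volume is \<open>v' * \<rho> ^ MM / 8\<close>.\<close>
      have \<rho>y: "\<rho> ^ MM \<le> 8 / v' * (l ^ NN * x)"
      proof -
        have "emeasure lborel ({1/8..1/4::real} \<times> cball (0::real^'m) \<rho>) = ennreal (1/8) * ennreal (v' * \<rho> ^ MM)"
          by (subst emeasure_lborel_Times) (auto simp: emeasure_cball[OF \<rho>(1)] v'_def MM_def borel_closed simp del: DIM_cart)
        also have "\<dots> = ennreal (v' * \<rho> ^ MM / 8)" using v' \<rho>(1) by (simp add: ennreal_mult'[symmetric])
        finally have "ennreal (v' * \<rho> ^ MM / 8) = emeasure lborel ({1/8..1/4::real} \<times> cball (0::real^'m) \<rho>)" by simp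
        also have "\<dots> \<le> emeasure lborel (F - ball 0 l)"
        proof (rule emeasure_mono)
          show "{1/8..1/4} \<times> cball 0 \<rho> \<subseteq> F - ball 0 l"
          proof
            fix p assume p: "p \<in> {1/8..1/4::real} \<times> cball (0::real^'m) \<rho>"
            have "\<bar>fst p\<bar> \<le> norm p" using norm_fst_le[of "fst p" "snd p"] by simp
            then have "p \<notin> ball 0 l" using p l8 by (auto simp: mem_Times_iff)
            then show "p \<in> F - ball 0 l" using p \<rho>(3) by blast
          qed
        qed simp
        also have "\<dots> = ennreal y"
          unfolding y_def using emeasure_mono[of "F - ball 0 l" F lborel] Fv
          by (intro emeasure_eq_ennreal_measure) (auto simp: top_unique)
        finally have "v' * \<rho> ^ MM / 8 \<le> y" using y by simp
        then show ?thesis using v' by (simp add: yx field_simps)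
      qed
      have \<rho>e: "\<rho> powr e \<le> (8 / v') powr q * l powr (n * q) * x powr q"
      proof (cases "\<rho> = 0")
        case False
        have "\<rho> powr e = (\<rho> ^ MM) powr q"
          using False \<rho>(1) by (simp add: qe[symmetric] powr_powr[symmetric] powr_realpow)
        also have "\<dots> \<le> (8 / v' * (l ^ NN * x)) powr q"
          using \<rho>y \<rho>(1) q0 by (intro powr_mono2) auto
        also have "\<dots> = (8 / v') powr q * ((l ^ NN) powr q * x powr q)"
          using v' l x0 by (subst powr_mult; simp?)+ 
        also have "(l ^ NN) powr q = l powr (n * q)"
          using l by (simp add: n_def powr_powr[symmetric] powr_realpow)
        finally show ?thesis by (simp add: mult.assoc)
      qed simp
      \<comment> \<open>The deficit is bounded through \<open>\<rho>\<close>, and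
        \<open>\<rho>\<close> through \<open>x\<close>, so stability becomes an inequality for
        \<open>x\<close> alone.\<close>
      have "x\<^sup>2 \<le> K * (l powr (n + s) + l powr (n * q - n + s) * x powr q)"
      proof -
        let ?a = "l powr (n + s)" and ?b = "l powr (n * q - n + s) * x powr q"
        have \<mu>l: "l powr (s - n) * \<mu>\<^sup>2 = v\<^sup>2 * ?a"
        proof -
          have "\<mu> = v * l powr n" using lN l v by (simp add: n_def powr_realpow)
          then have "\<mu>\<^sup>2 = v\<^sup>2 * (l powr n * l powr n)" by (simp add: power2_eq_square)
          then have "l powr (s - n) * \<mu>\<^sup>2 = v\<^sup>2 * (l powr (s - n) * (l powr n * l powr n))" by (simp add: mult.left_commute)
          also have "l powr (s - n) * (l powr n * l powr n) = ?a"
            unfolding powr_add[symmetric] by (rule arg_cong) simp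
          finally show ?thesis .
        qed
        have "l powr (s - n) * \<rho> powr e \<le> l powr (s - n) * ((8 / v') powr q * l powr (n * q) * x powr q)"
          by (rule mult_left_mono[OF \<rho>e]) simp
        also have "\<dots> = (8 / v') powr q * ((l powr (s - n) * l powr (n * q)) * x powr q)" by simp
        also have "l powr (s - n) * l powr (n * q) = l powr (n * q - n + s)"
          unfolding powr_add[symmetric] by (rule arg_cong) simp
        finally have \<rho>l: "l powr (s - n) * \<rho> powr e \<le> (8 / v') powr q * ?b" .
        have ab: "?a \<ge> 0" "?b \<ge> 0" by auto
        have "\<delta> = Ci * (l powr (s - n) * \<mu>\<^sup>2 + l powr (s - n) * \<rho> powr e)"
          unfolding \<delta>_def by (simp add: algebra_simps)
        also have "\<dots> \<le> Ci * (v\<^sup>2 * ?a + (8 / v') powr q * ?b)"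
          unfolding \<mu>l using \<rho>l Ci by (intro mult_left_mono) auto
        also have "\<dots> \<le> Ci * ((v\<^sup>2 + (8 / v') powr q) * (?a + ?b))"
        proof (rule mult_left_mono[OF _ Ci])
          have "0 \<le> v\<^sup>2 * ?b" "0 \<le> (8 / v') powr q * ?a" using ab by (auto intro!: mult_nonneg_nonneg)
          then show "v\<^sup>2 * ?a + (8 / v') powr q * ?b \<le> (v\<^sup>2 + (8 / v') powr q) * (?a + ?b)"
            unfolding distrib_left distrib_right by linarith
        qed
        finally have "Cs\<^sup>2 * \<delta> \<le> Cs\<^sup>2 * (Ci * ((v\<^sup>2 + (8 / v') powr q) * (?a + ?b)))"
          by (rule mult_left_mono) simp
        also have "\<dots> = (Cs\<^sup>2 * Ci * (v\<^sup>2 + (8 / v') powr q)) * (?a + ?b)" by (simp only: mult.assoc)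
        also have "\<dots> \<le> K * (?a + ?b)" unfolding K_def using ab by (intro mult_right_mono) auto
        finally show ?thesis using x2 by linarith
      qed
      then have "x \<le> D * l powr \<theta>"
        unfolding D_def q_def \<theta>_def using n s l l8 x0 K by (intro bootstrap_exponent) auto
      then have "2 * x / v \<le> 2 * (D * l powr \<theta>) / v" using v by (intro divide_right_mono) auto
      moreover have "2 * y / \<mu> = 2 * x / v" using lN \<mu> v by (simp add: yx)
      ultimately have "fraenkel_asym F \<le> 2 * (D * l powr \<theta>) / v" using asym by simp
      also have "\<dots> = 2 * D / v * (1 / v) powr \<alpha> * \<mu> powr \<alpha>" by (simp add: lpow)
      also have "\<dots> \<le> C * \<mu> powr \<alpha>" unfolding C_def using v by (intro mult_right_mono) auto
      finally show ?thesis .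
    qed
  qed
  show ?thesis
    using C main unfolding \<alpha>_def n_def NN_def by blast
qed

end
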